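(* Let $\mathcal{G}$ be a metric graph with $E$ edges, equipped with the Schrödinger operator $\Delta_w$ (real continuous edge potentials $w$, Kirchhoff–Neumann vertex conditions). Then there exists a secular function $\zeta_w:\mathbb{C}\to\mathbb{C}$ of the form $$\zeta_w(k)=(\det S_w(k))^{-\frac12}\,\det(\mathrm{Id}_{2E}-S_w(k)),\qquad\text{where}\qquad S_w(k)=\Sigma\,T(k;w),$$ whose zeros correspond to the eigenvalues of the operator $\Delta_w$ including multiplicities (with the possible exception of the eigenvalue zero). Here $\Sigma$ is the vertex scattering matrix and $T(k;w)$ is the graph transition matrix, and a zero $k$ corresponds to the eigenvalue $k^2$.
   Context: **Graph.** $\mathcal{G}$ is a finite graph with vertex set $\mathcal{V}$ and edge set $\mathcal{E}$, $E=|\mathcal{E}|$. Each edge $e$ has a finite length $L_e>0$. Each edge $e$ gives two directed edges $d,\hat d$ (mutually reversed). $\mathcal{D}$ is the set of the $2E$ directed edges, and $\iota(d),\tau(d)$ are the initial and terminal vertices of $d$, so $\iota(d)=\tau(\hat d)$. Put $L_d=L_{\hat d}=L_e$. The coordinate $x_d\in[0,L_d]$ is $0$ at $\iota(d)$ and $L_d$ at $\tau(d)$, so $x_{\hat d}=L_d-x_d$. **Operator.** The potential $w$ is given by real continuous functions $w_d$ on $[0,L_d]$ with $w_d(x)=w_{\hat d}(L_d-x)$ and $w_d(0)=w_{d'}(0)$ whenever $\iota(d)=\iota(d')$. The operator $\Delta_w$ acts on each directed edge by $\psi_d\mapsto-\psi_d''+w_d\psi_d$, on functions $(\psi_d)_{d\in\mathcal{D}}$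 with $\psi_d(x)=\psi_{\hat d}(L_d-x)$ that are continuous at the vertices and satisfy the Kirchhoff–Neumann condition $\sum_{d:\iota(d)=v}\psi_d'(0)=0$ for every $v\in\mathcal{V}$. It is self-adjoint. **Edge transition matrix.** Let $\psi_d^{\pm}$ be the solutions of $-\psi''+w_d\psi=k^2\psi$ on $[0,L_d]$ with $\psi_d^\pm(0)=1$ and $(\psi_d^\pm)'(0)=\mp ik$. On an edge $e$ with directed edges $d,\hat d$, a solution of the eigenvalue equation is written in the two orientations as $a_d\psi_d^+(x)+b_d\psi_d^-(x)=a_{\hat d}\psi_{\hat d}^+(L_e-x)+b_{\hat d}\psi_{\hat d}^-(L_e-x)$. The $2\times2$ matrix $t^{(e)}(k;w_e)$ is defined by $$\begin{pmatrix} a_d \\ a_{\hat d} \end{pmatrix}=t^{(e)}(k;w_e)\begin{pmatrix} b_{\hat d} \\ b_d \end{pmatrix}.$$ **Graph matrices.** Both are $2E\times 2E$, indexed by $\mathcal{D}$. The matrix $T(k;w)$ maps $(b_d)_{d\in\mathcal{D}}$ to the vector whose $d$-entry is $a_{\hat d}$ (the amplitude of the wave travelling along $d$ and arriving at $\tau(d)$). Thus $T_{dd'}=0$ unless $d'\in\{d,\hat d\}$, and on $\{\hat d,d\}$ (in this order) the block of $T$ is $t^{(e)}(k;w_e)$. The matrix $\Sigma$ is $\Sigma_{dd'}=\delta_{\tau(d'),\iota(d)}\left(-\delta_{\hat d,d'}+\frac{2}{\deg(v)}\right)$ with $v=\iota(d)$.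
   Formalization: The zeros/eigenvalues correspondence is claimed only for k ≠ 0 where T(k;w) exists and det S_w(k) ≠ 0 (all real k ≠ 0; exceptions locally finite); elsewhere the formula is undefined and the order is wrong even after continuation. The square root is analytic only on the real and imaginary axes. *)

theory Defs
  imports
    "HOL-Complex_Analysis.Complex_Analysis"
    "HOL-Library.Function_Algebras"
    "Graph_Theory.Bidirected_Digraph"
begin

text \<open>
  A finite graph is given by its directed edges (loops and multiple edges are allowed). The
  directed edges are all elements of the finite type \<open>'d\<close>, so that they can index matrices, and
  \<open>tail\<close>, \<open>head\<close>, \<open>arev\<close> are the initial vertex, the terminal vertex and the reversal. A loop
  contributes two directed edges to \<open>out_arcs G v\<close>, so \<open>out_degree\<close> is the degree of the
  undirected graph.
\<close>

locale schroedinger_graph = fin_digraph G + bidirected_digraph G arev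
  for G :: "('v, 'd::finite) pre_digraph" and arev :: "'d \<Rightarrow> 'd" +
  fixes L :: "'d \<Rightarrow> real" and w :: "'d \<Rightarrow> real \<Rightarrow> real"
  assumes arcs_UNIV: "arcs G = UNIV"
    and length_pos: "L d > 0"
    and length_arev: "L (arev d) = L d"
    and potential_continuous: "continuous_on {0..L d} (w d)"
    and potential_arev: "x \<in> {0..L d} \<Longrightarrow> w (arev d) (L d - x) = w d x"
    and potential_vertex: "tail G d = tail G d' \<Longrightarrow> w d 0 = w d' 0"

text \<open>
  \<open>has_H2_derivs l f f' g\<close>: on \<open>[0,l]\<close> the function \<open>f\<close> is in the Sobolev space \<open>H\<^sup>2\<close>, with
  derivative \<open>f'\<close> (absolutely continuous) and weak second derivative \<open>g\<close> in \<open>L\<^sup>2\<close>.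
\<close>

definition has_H2_derivs ::
    "real \<Rightarrow> (real \<Rightarrow> complex) \<Rightarrow> (real \<Rightarrow> complex) \<Rightarrow> (real \<Rightarrow> complex) \<Rightarrow> bool" where
  "has_H2_derivs l f f' g \<longleftrightarrow>
     (\<forall>x\<in>{0..l}. (f has_vector_derivative f' x) (at x within {0..l})) \<and>
     set_integrable lborel {0..l} g \<and>
     set_integrable lborel {0..l} (\<lambda>x. (cmod (g x))\<^sup>2) \<and>
     (\<forall>x\<in>{0..l}. f' x = f' 0 + (LINT t:{0..x}|lborel. g t))"

definition edge_fun_scale ::
    "complex \<Rightarrow> ('d \<Rightarrow> real \<Rightarrow> complex) \<Rightarrow> ('d \<Rightarrow> real \<Rightarrow> complex)" where
  "edge_fun_scale c \<psi> = (\<lambda>d x. c * \<psi> d x)"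

lemma vector_space_edge_fun: "vector_space edge_fun_scale"
  by unfold_locales (auto simp: edge_fun_scale_def fun_eq_iff algebra_simps)

context schroedinger_graph
begin

text \<open>
  The graph of \<open>\<Delta>\<^sub>w\<close> as a self-adjoint operator in \<open>L\<^sup>2\<close>. Functions in the domain are set to \<open>0\<close>
  outside the edges, so that two of them are equal as HOL functions iff they agree on the edges.
  Kirchhoff's condition uses the derivatives in the direction leaving the vertex.
\<close>

definition Delta_graph ::
    "('d \<Rightarrow> real \<Rightarrow> complex) \<Rightarrow> ('d \<Rightarrow> real \<Rightarrow> complex) \<Rightarrow> bool" where
  "Delta_graph \<psi> \<phi> \<longleftrightarrow>
     (\<forall>d x. x \<notin> {0..L d} \<longrightarrow> \<psi> d x = 0) \<and>
     (\<forall>d. \<forall>x\<in>{0..L d}. \<psi> d x = \<psi> (arev d) (L d - x)) \<and>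
     (\<forall>d d'. tail G d = tail G d' \<longrightarrow> \<psi> d 0 = \<psi> d' 0) \<and>
     (\<exists>\<psi>' \<psi>''. (\<forall>d. has_H2_derivs (L d) (\<psi> d) (\<psi>' d) (\<psi>'' d)) \<and>
        (\<forall>v\<in>verts G. (\<Sum>d\<in>out_arcs G v. \<psi>' d 0) = 0) \<and>
        (\<forall>d. AE x in lborel. x \<in> {0..L d} \<longrightarrow>
            \<phi> d x = - \<psi>'' d x + of_real (w d x) * \<psi> d x))"

definition eigenspace :: "complex \<Rightarrow> ('d \<Rightarrow> real \<Rightarrow> complex) set" where
  "eigenspace \<mu> = {\<psi>. Delta_graph \<psi> (edge_fun_scale \<mu> \<psi>)}"

definition is_eigenvalue :: "complex \<Rightarrow> bool" where
  "is_eigenvalue \<mu> \<longleftrightarrow> (\<exists>\<psi>\<in>eigenspace \<mu>. \<psi> \<noteq> 0)"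

definition eigenvalue_mult :: "complex \<Rightarrow> nat" where
  "eigenvalue_mult \<mu> = vector_space.dim edge_fun_scale (eigenspace \<mu>)"

text \<open>
  The solution of \<open>-f'' + w\<^sub>d f = k\<^sup>2 f\<close> on \<open>[0, L\<^sub>d]\<close> with \<open>f(0) = 1\<close> and \<open>f'(0) = c\<close>, set to \<open>0\<close>
  outside the interval to make it unique.
\<close>

definition edge_solution :: "complex \<Rightarrow> complex \<Rightarrow> 'd \<Rightarrow> real \<Rightarrow> complex" where
  "edge_solution k c d = (THE f.
     (\<forall>x. x \<notin> {0..L d} \<longrightarrow> f x = 0) \<and> f 0 = 1 \<and>
     (\<exists>f' f''. f' 0 = c \<and>
        (\<forall>x\<in>{0..L d}. (f has_vector_derivative f' x) (at x within {0..L d}) \<and>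
           (f' has_vector_derivative f'' x) (at x within {0..L d}) \<and>
           - f'' x + of_real (w d x) * f x = k\<^sup>2 * f x)))"

definition psi_plus :: "complex \<Rightarrow> 'd \<Rightarrow> real \<Rightarrow> complex" where
  "psi_plus k = edge_solution k (- \<i> * k)"

definition psi_minus :: "complex \<Rightarrow> 'd \<Rightarrow> real \<Rightarrow> complex" where
  "psi_minus k = edge_solution k (\<i> * k)"

text \<open>
  The edge equation may fail to determine \<open>a\<close> from \<open>b\<close>: for general complex \<open>k\<close> there can be
  nonzero solutions with \<open>b = 0\<close> (for \<open>w\<^sub>d = 0\<close> this happens only at \<open>k = 0\<close>). Then no matrix \<open>t\<close>
  exists, and \<open>k\<close> is a pole of the transition matrix.
\<close>

definition is_edge_transition :: "complex \<Rightarrow> 'd \<Rightarrow> complex^2^2 \<Rightarrow> bool" where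
  "is_edge_transition k d t \<longleftrightarrow>
     (\<forall>a b a' b'.
        (\<forall>x\<in>{0..L d}. a * psi_plus k d x + b * psi_minus k d x =
           a' * psi_plus k (arev d) (L d - x) + b' * psi_minus k (arev d) (L d - x)) \<longrightarrow>
        (vector [a, a'] :: complex^2) = t *v vector [b', b])"

definition edge_transition :: "complex \<Rightarrow> 'd \<Rightarrow> complex^2^2" where
  "edge_transition k d = (THE t. is_edge_transition k d t)"

text \<open>
  Row \<open>d\<close> of \<open>T\<close> yields the amplitude \<open>a\<close> of the reversed edge, i.e. the second row of
  \<open>edge_transition k d\<close>, whose columns belong to \<open>arev d\<close> and \<open>d\<close> in this order. Exchanging the
  orientations of an edge exchanges both the rows and the columns of its transition matrix, so
  this is independent of the orientation chosen.
\<close>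

definition transition_matrix :: "complex \<Rightarrow> complex^'d^'d" where
  "transition_matrix k = (\<chi> d d'.
     if d' = arev d then edge_transition k d $ 2 $ 1
     else if d' = d then edge_transition k d $ 2 $ 2
     else 0)"

definition vertex_scattering :: "complex^'d^'d" where
  "vertex_scattering = (\<chi> d d'.
     if head G d' = tail G d
     then (if arev d = d' then - 1 else 0) + 2 / of_nat (out_degree G (tail G d))
     else 0)"

definition graph_scattering :: "complex \<Rightarrow> complex^'d^'d" where
  "graph_scattering k = vertex_scattering ** transition_matrix k"

text \<open>The points where \<open>T\<close> is defined and \<open>(det S)\<close> has a (finite) inverse square root.\<close>

definition scattering_domain :: "complex set" where
  "scattering_domain =
     {k. (\<forall>d. \<exists>!t. is_edge_transition k d t) \<and> det (graph_scattering k) \<noteq> 0}"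

end

end

theory Submission
  imports Defs
begin

text \<open>On an edge with fundamental solutions \<open>cs\<close>, \<open>sn\<close>, the amplitudes of a wave are linear in its initial
  data, and \<open>b = S b\<close> is equivalent to the vertex conditions, so the eigenspace of \<open>k\<^sup>2\<close> is isomorphic to
  the kernel of \<open>1 - S(k)\<close>. The order of the zero of \<open>det (1 - S)\<close> is the dimension of this kernel unless
  there is a Jordan chain \<open>b(z) = b\<^sub>0 + (z - k) b\<^sub>1\<close> with \<open>(1 - S(z)) b(z) = O((z - k)\<^sup>2)\<close>. The waves with
  amplitudes \<open>b(z)\<close> violate the vertex conditions only by \<open>O((z - k)\<^sup>2)\<close>, so pairing them with the
  conjugate of the eigenfunction \<open>f\<close> in Green's identity gives \<open>(z\<^sup>2 - k\<^sup>2) (\<parallel>f\<parallel>\<^sup>2 + o(1)) = O((z - k)\<^sup>2)\<close>, which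
  is impossible for \<open>k \<noteq> 0\<close>. The same pairing shows that \<open>k\<^sup>2\<close> is real. An analytic square root of \<open>det S\<close>
  exists near the real half-lines because they have contractible neighbourhoods, and near the
  imaginary axis because \<open>det S\<close> is real there.\<close>

text \<open>Three obstacles shape the proof. The edge transition matrices have poles at complex
  \<open>k\<close>, whereas the end values of \<open>cs\<close> and \<open>sn\<close> are entire in
  \<open>k\<^sup>2\<close>. Hence waves are described by their values and outgoing derivatives at
  the tails of the directed edges; amplitudes are only coordinates on these data, valid away from
  the poles and from \<open>k = 0\<close>, where \<open>psi_plus\<close> and
  \<open>psi_minus\<close> coincide. Spectral theory enters only through Green's identity, and it
  must be applied to waves that solve the equation on the edges but violate the vertex conditions.
  This works because \<open>(1 - S) b\<close> measures the defect at the vertices for every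
  \<open>b\<close>, not only for kernel vectors. A square root of \<open>det S\<close> on its whole
  domain cannot be expected, since \<open>det S\<close> may wind around its zeros and poles. As the
  zeros of \<open>det (1 - S)\<close> have real \<open>k\<^sup>2\<close>, a root that is analytic
  near the punctured axes gives all orders; elsewhere any pointwise root will do. Orders are counted
  in \<open>k\<close> but multiplicities in \<open>k\<^sup>2\<close>, so the condition
  \<open>k \<noteq> 0\<close> also reflects that the derivative of \<open>k\<^sup>2\<close> must not
  vanish.\<close>

no_notation fps_nth (infixl \<open>$\<close> 75)

section \<open>The Schroedinger equation on an interval\<close>

locale potential_interval =
  fixes l :: real and w :: "real \<Rightarrow> real"
  assumes l_pos: "l > 0" and w_cont: "continuous_on {0..l} w"
begin

text \<open>The parameter \<open>\<mu>\<close> stands for \<open>k\<^sup>2\<close>. Carrying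
  \<open>f'\<close> as a second function makes this a first-order system, with one-sided derivatives
  at the ends.\<close>

definition sol :: "complex \<Rightarrow> (real \<Rightarrow> complex) \<Rightarrow> (real \<Rightarrow> complex) \<Rightarrow> bool" where
  "sol \<mu> f f' \<longleftrightarrow> (\<forall>x\<in>{0..l}. (f has_vector_derivative f' x) (at x within {0..l}) \<and>
     (f' has_vector_derivative (of_real (w x) - \<mu>) * f x) (at x within {0..l}))"

end

text \<open>These are the terms of the Picard series and not its partial sums: each term is the
  image of the previous one under the integral operator of the system, and the solution is the sum
  over all \<open>n\<close>.\<close>

primrec picard :: "(real \<Rightarrow> complex) \<Rightarrow> complex \<Rightarrow> complex \<Rightarrow> nat \<Rightarrow> real \<Rightarrow> complex \<times> complex" where
  "picard q \<alpha> \<beta> 0 = (\<lambda>x. (\<alpha>, \<beta>))"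
| "picard q \<alpha> \<beta> (Suc n) = (\<lambda>x. (integral {0..x} (\<lambda>t. snd (picard q \<alpha> \<beta> n t)),
     integral {0..x} (\<lambda>t. q t * fst (picard q \<alpha> \<beta> n t))))"

text \<open>Serves to differentiate the Picard series term by term on a closed interval, end points
  included.\<close>

lemma has_vector_derivative_series:
  fixes f :: "nat \<Rightarrow> real \<Rightarrow> 'b::banach"
  assumes "convex S" "x0 \<in> S" "summable (\<lambda>n. f n x0)"
    and der: "\<And>n x. x \<in> S \<Longrightarrow> (f n has_vector_derivative f' n x) (at x within S)"
    and unif: "uniform_limit S (\<lambda>n x. \<Sum>i<n. f' i x) g' sequentially"
  shows "\<And>x. x \<in> S \<Longrightarrow> ((\<lambda>x. \<Sum>n. f n x) has_vector_derivative g' x) (at x within S)"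
proof -
  have "\<exists>g. \<forall>x\<in>S. (\<lambda>n. f n x) sums (g x) \<and> (g has_derivative (\<lambda>h. h *\<^sub>R g' x)) (at x within S)"
  proof (rule has_derivative_series[OF assms(1)])
    show "(f n has_derivative (\<lambda>h. h *\<^sub>R f' n x)) (at x within S)" if "x \<in> S" for n x
      using der[OF that] by (simp add: has_vector_derivative_def)
    show "\<forall>\<^sub>F n in sequentially. \<forall>x\<in>S. \<forall>h. norm ((\<Sum>i<n. h *\<^sub>R f' i x) - h *\<^sub>R g' x) \<le> e * norm h"
      if "e > 0" for e :: real
    proof -
      have "\<forall>\<^sub>F n in sequentially. \<forall>x\<in>S. dist (\<Sum>i<n. f' i x) (g' x) < e"
        using unif that by (rule uniform_limitD)
      then show ?thesis
      proof eventually_elim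
        case (elim n)
        show ?case
        proof (intro ballI allI)
          fix x and h :: real assume "x \<in> S"
          have "norm ((\<Sum>i<n. h *\<^sub>R f' i x) - h *\<^sub>R g' x) = \<bar>h\<bar> * norm ((\<Sum>i<n. f' i x) - g' x)"
            by (simp flip: scaleR_sum_right scaleR_diff_right)
          also have "\<dots> \<le> \<bar>h\<bar> * e"
            using elim \<open>x \<in> S\<close> by (intro mult_left_mono) (auto simp: dist_norm less_imp_le)
          finally show "norm ((\<Sum>i<n. h *\<^sub>R f' i x) - h *\<^sub>R g' x) \<le> e * norm h"
            by (simp add: mult.commute)
        qed
      qed
    qed
    show "x0 \<in> S" "(\<lambda>n. f n x0) sums suminf (\<lambda>n. f n x0)"
      using assms by auto
  qed
  then obtain g where g: "\<And>x. x \<in> S \<Longrightarrow> (\<lambda>n. f n x) sums (g x)"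
    "\<And>x. x \<in> S \<Longrightarrow> (g has_vector_derivative g' x) (at x within S)"
    by (auto simp: has_vector_derivative_def)
  fix x assume "x \<in> S"
  then show "((\<lambda>x. \<Sum>n. f n x) has_vector_derivative g' x) (at x within S)"
    using sums_unique[OF g(1)] by (intro has_vector_derivative_transform[OF _ _ g(2)]) auto
qed

lemma picard_continuous:
  assumes "continuous_on {0..l} q"
  shows "continuous_on {0..l} (picard q \<alpha> \<beta> n)"
proof (induction n)
  case (Suc n)
  have "continuous_on {0..l} (\<lambda>t. snd (picard q \<alpha> \<beta> n t))"
    "continuous_on {0..l} (\<lambda>t. q t * fst (picard q \<alpha> \<beta> n t))"
    using Suc assms by (auto intro!: continuous_intros)
  then show ?case
    by (auto intro!: continuous_on_Pair indefinite_integral_continuous_1 integrable_continuous_real)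
qed auto

text \<open>Each integration turns \<open>t ^ n / fact n\<close> into
  \<open>x ^ Suc n / fact (Suc n)\<close>. With \<open>M \<ge> 1\<close> a factor \<open>M\<close>
  may also be inserted where the integrand carries no \<open>q\<close>, so both components share one
  bound.\<close>

lemma picard_bound:
  assumes q: "continuous_on {0..l} q" and M: "\<And>x. x \<in> {0..l} \<Longrightarrow> cmod (q x) \<le> M" and "M \<ge> 1"
    and "x \<in> {0..l}"
  shows "cmod (fst (picard q \<alpha> \<beta> n x)) \<le> (cmod \<alpha> + cmod \<beta>) * ((M * x) ^ n / fact n) \<and>
         cmod (snd (picard q \<alpha> \<beta> n x)) \<le> (cmod \<alpha> + cmod \<beta>) * ((M * x) ^ n / fact n)"
  using \<open>x \<in> {0..l}\<close>
proof (induction n arbitrary: x)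
  case (Suc n)
  define K where "K = cmod \<alpha> + cmod \<beta>"
  have K: "K \<ge> 0" by (simp add: K_def)
  have pow: "((\<lambda>t. K * M ^ Suc n / fact n * t ^ n) has_integral K * ((M * x) ^ Suc n / fact (Suc n))) {0..x}"
  proof -
    have "((\<lambda>t. K * M ^ Suc n / fact n * t ^ n) has_integral
        (K * ((M * x) ^ Suc n / fact (Suc n)) - K * ((M * 0) ^ Suc n / fact (Suc n)))) {0..x}"
    proof (rule fundamental_theorem_of_calculus)
      fix t assume "t \<in> {0..x}"
      have "((\<lambda>t. K * ((M * t) ^ Suc n / fact (Suc n))) has_real_derivative
          K * (real (Suc n) * (M * t) ^ n * M / fact (Suc n))) (at t within {0..x})"
        by (auto intro!: derivative_eq_intros simp del: power_Suc of_nat_Suc)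
      also have "K * (real (Suc n) * (M * t) ^ n * M / fact (Suc n)) = K * M ^ Suc n / fact n * t ^ n"
        by (simp add: power_mult_distrib field_simps del: of_nat_Suc)
      finally show "((\<lambda>t. K * ((M * t) ^ Suc n / fact (Suc n))) has_vector_derivative
          K * M ^ Suc n / fact n * t ^ n) (at t within {0..x})"
        by (simp add: has_real_derivative_iff_has_vector_derivative)
    qed (use Suc.prems in auto)
    then show ?thesis by simp
  qed
  have sub: "{0..x} \<subseteq> {0..l}" using Suc.prems by auto
  have cont: "continuous_on {0..x} (\<lambda>t. snd (picard q \<alpha> \<beta> n t))"
    "continuous_on {0..x} (\<lambda>t. q t * fst (picard q \<alpha> \<beta> n t))"
    using continuous_on_subset[OF picard_continuous[OF q] sub] continuous_on_subset[OF q sub]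
    by (auto intro!: continuous_intros)
  have b1: "cmod (snd (picard q \<alpha> \<beta> n t)) \<le> K * M ^ Suc n / fact n * t ^ n" if "t \<in> {0..x}" for t
  proof -
    have t: "t \<in> {0..l}" "t \<ge> 0" using that sub by auto
    have "cmod (snd (picard q \<alpha> \<beta> n t)) \<le> 1 * (K * ((M * t) ^ n / fact n))"
      using Suc.IH[OF t(1)] by (simp add: K_def)
    also have "\<dots> \<le> M * (K * ((M * t) ^ n / fact n))"
      using \<open>M \<ge> 1\<close> K t by (intro mult_right_mono) auto
    finally show ?thesis by (simp add: power_mult_distrib field_simps)
  qed
  have b2: "cmod (q t * fst (picard q \<alpha> \<beta> n t)) \<le> K * M ^ Suc n / fact n * t ^ n" if "t \<in> {0..x}" for t
  proof -
    have t: "t \<in> {0..l}" "t \<ge> 0" using that sub by auto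
    have "cmod (q t * fst (picard q \<alpha> \<beta> n t)) \<le> M * (K * ((M * t) ^ n / fact n))"
      unfolding norm_mult using Suc.IH[OF t(1)] M[OF t(1)] \<open>M \<ge> 1\<close> by (intro mult_mono) (auto simp: K_def)
    then show ?thesis by (simp add: power_mult_distrib field_simps)
  qed
  show ?case
    using integral_norm_bound_integral[OF integrable_continuous_real[OF cont(1)] has_integral_integrable[OF pow] b1]
      integral_norm_bound_integral[OF integrable_continuous_real[OF cont(2)] has_integral_integrable[OF pow] b2]
    unfolding integral_unique[OF pow] by (simp only: picard.simps fst_conv snd_conv K_def)
qed auto

context potential_interval
begin

lemma sol_exists: "\<exists>f f'. sol \<mu> f f' \<and> f 0 = \<alpha> \<and> f' 0 = \<beta>"
proof -
  define q where "q = (\<lambda>x. complex_of_real (w x) - \<mu>)"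
  have q: "continuous_on {0..l} q"
    unfolding q_def using w_cont by (intro continuous_intros)
  have "bounded (q ` {0..l})"
    using compact_continuous_image[OF q] by (simp add: compact_imp_bounded)
  then obtain M0 where M0: "\<forall>x\<in>{0..l}. cmod (q x) \<le> M0"
    by (auto simp: bounded_iff)
  define M where "M = max 1 M0"
  have M: "M \<ge> 1" "\<And>x. x \<in> {0..l} \<Longrightarrow> cmod (q x) \<le> M"
    using M0 by (force simp: M_def)+
  define K where "K = cmod \<alpha> + cmod \<beta>"
  define P where "P = picard q \<alpha> \<beta>"
  have K: "K \<ge> 0" by (simp add: K_def)
  have bound: "cmod (fst (P n x)) \<le> K * ((M * l) ^ n / fact n)"
    "cmod (snd (P n x)) \<le> K * ((M * l) ^ n / fact n)" if "x \<in> {0..l}" for n x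
  proof -
    have "K * ((M * x) ^ n / fact n) \<le> K * ((M * l) ^ n / fact n)"
      using that M(1) K by (intro mult_left_mono divide_right_mono power_mono) auto
    then show "cmod (fst (P n x)) \<le> K * ((M * l) ^ n / fact n)"
      "cmod (snd (P n x)) \<le> K * ((M * l) ^ n / fact n)"
      using picard_bound[OF q M(2) M(1) that, of \<alpha> \<beta> n] by (auto simp: P_def K_def)
  qed
  have summ: "summable (\<lambda>n. K * ((M * l) ^ n / fact n))"
    using summable_exp[of "M * l"] by (intro summable_mult) (simp add: divide_inverse mult.commute)
  have bound_q: "cmod (q x * fst (P n x)) \<le> M * (K * ((M * l) ^ n / fact n))" if "x \<in> {0..l}" for n x
    unfolding norm_mult using bound(1)[OF that] M that by (intro mult_mono) auto
  have U: "uniform_limit {0..l} (\<lambda>n x. \<Sum>i<n. snd (P i x)) (\<lambda>x. \<Sum>i. snd (P i x)) sequentially"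
    by (rule Weierstrass_m_test[OF bound(2) summ])
  have V: "uniform_limit {0..l} (\<lambda>n x. \<Sum>i<n. q x * fst (P i x)) (\<lambda>x. \<Sum>i. q x * fst (P i x)) sequentially"
    by (rule Weierstrass_m_test[OF bound_q summable_mult[OF summ]])
  have summ_fst: "summable (\<lambda>n. fst (P n x))" and summ_snd: "summable (\<lambda>n. snd (P n x))"
    if "x \<in> {0..l}" for x
    using bound[OF that] summ by (auto intro: summable_comparison_test')
  \<comment> \<open>The derivative of term \<open>Suc m\<close> comes from term \<open>m\<close>,
    and term 0 is constant. This offset in the index is removed by \<open>shift\<close>.\<close>
  define dU where "dU n x = (case n of 0 \<Rightarrow> 0 | Suc m \<Rightarrow> snd (P m x))" for n x
  define dV where "dV n x = (case n of 0 \<Rightarrow> 0 | Suc m \<Rightarrow> q x * fst (P m x))" for n x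
  have cont: "continuous_on {0..l} (P n)" for n
    unfolding P_def by (rule picard_continuous[OF q])
  have derU: "((\<lambda>x. fst (P n x)) has_vector_derivative dU n x) (at x within {0..l})"
    if "x \<in> {0..l}" for n x
  proof (cases n)
    case (Suc m)
    have "continuous_on {0..l} (\<lambda>t. snd (P m t))" using cont by (auto intro!: continuous_intros)
    from integral_has_vector_derivative[OF this that] show ?thesis
      by (simp add: Suc dU_def P_def)
  qed (simp add: dU_def P_def)
  have derV: "((\<lambda>x. snd (P n x)) has_vector_derivative dV n x) (at x within {0..l})"
    if "x \<in> {0..l}" for n x
  proof (cases n)
    case (Suc m)
    have "continuous_on {0..l} (\<lambda>t. q t * fst (P m t))" using cont q by (auto intro!: continuous_intros)
    from integral_has_vector_derivative[OF this that] show ?thesis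
      by (simp add: Suc dV_def P_def)
  qed (simp add: dV_def P_def)
  have shift: "(\<lambda>n x. \<Sum>i<Suc n. dU i x) = (\<lambda>n x. \<Sum>i<n. snd (P i x))"
      "(\<lambda>n x. \<Sum>i<Suc n. dV i x) = (\<lambda>n x. \<Sum>i<n. q x * fst (P i x))"
    by (simp_all add: fun_eq_iff sum.lessThan_Suc_shift dU_def dV_def del: sum.lessThan_Suc)
  have U': "uniform_limit {0..l} (\<lambda>n x. \<Sum>i<n. dU i x) (\<lambda>x. \<Sum>i. snd (P i x)) sequentially"
    using U by (subst filterlim_sequentially_Suc[symmetric]) (simp add: shift del: sum.lessThan_Suc)
  have V': "uniform_limit {0..l} (\<lambda>n x. \<Sum>i<n. dV i x) (\<lambda>x. \<Sum>i. q x * fst (P i x)) sequentially"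
    using V by (subst filterlim_sequentially_Suc[symmetric]) (simp add: shift del: sum.lessThan_Suc)
  have 0: "0 \<in> {0..l}" using l_pos by simp
  have "sol \<mu> (\<lambda>x. \<Sum>n. fst (P n x)) (\<lambda>x. \<Sum>n. snd (P n x))"
    unfolding sol_def
  proof (intro ballI conjI)
    fix x assume x: "x \<in> {0..l}"
    show "((\<lambda>x. \<Sum>n. fst (P n x)) has_vector_derivative (\<Sum>n. snd (P n x))) (at x within {0..l})"
      using has_vector_derivative_series[OF _ 0 summ_fst[OF 0] derU U' x] by simp
    have "((\<lambda>x. \<Sum>n. snd (P n x)) has_vector_derivative (\<Sum>n. q x * fst (P n x))) (at x within {0..l})"
      using has_vector_derivative_series[OF _ 0 summ_snd[OF 0] derV V' x] by simp
    then show "((\<lambda>x. \<Sum>n. snd (P n x)) has_vector_derivative (of_real (w x) - \<mu>) * (\<Sum>n. fst (P n x))) (at x within {0..l})"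
      using suminf_mult[OF summ_fst[OF x], of "q x"] by (simp add: q_def)
  qed
  \<comment> \<open>At the initial point all integrals vanish, so the constant term alone supplies
    the initial data.\<close>
  moreover have "fst (P n 0) = 0 \<and> snd (P n 0) = 0" if "n \<notin> {0}" for n
    using that by (cases n) (simp_all add: P_def)
  then have "(\<Sum>n. fst (P n 0)) = (\<Sum>n\<in>{0}. fst (P n 0))" "(\<Sum>n. snd (P n 0)) = (\<Sum>n\<in>{0}. snd (P n 0))"
    by (intro suminf_finite; auto)+
  ultimately show ?thesis
    by (auto simp: P_def)
qed

section \<open>Green's identity and the fundamental system\<close>

lemma sol_continuous:
  assumes "sol \<mu> f f'"
  shows "continuous_on {0..l} f" "continuous_on {0..l} f'"
  using assms unfolding sol_def
  by (auto intro!: continuous_on_vector_derivative)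

lemma sol_lincomb:
  assumes "sol \<mu> f f'" "sol \<mu> g g'"
  shows "sol \<mu> (\<lambda>x. a * f x + b * g x) (\<lambda>x. a * f' x + b * g' x)"
  using assms unfolding sol_def
  by (auto intro!: derivative_eq_intros simp: algebra_simps)

lemma sol_cnj:
  assumes "sol \<mu> f f'"
  shows "sol (cnj \<mu>) (\<lambda>x. cnj (f x)) (\<lambda>x. cnj (f' x))"
  unfolding sol_def
proof (intro ballI conjI)
  fix x assume "x \<in> {0..l}"
  then have d: "(f has_vector_derivative f' x) (at x within {0..l})"
    "(f' has_vector_derivative (of_real (w x) - \<mu>) * f x) (at x within {0..l})"
    using assms by (auto simp: sol_def)
  from has_vector_derivative_cnj[OF d(1)]
  show "((\<lambda>x. cnj (f x)) has_vector_derivative cnj (f' x)) (at x within {0..l})" .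
  from has_vector_derivative_cnj[OF d(2)]
  show "((\<lambda>x. cnj (f' x)) has_vector_derivative (of_real (w x) - cnj \<mu>) * cnj (f x)) (at x within {0..l})"
    by simp
qed

text \<open>The potential cancels in the derivative of \<open>f' g - f g'\<close>, leaving
  \<open>- (\<mu> - \<nu>) f g\<close>. The product is bilinear: the case
  \<open>\<mu> = \<nu>\<close> is the constancy of the Wronskian, and norms arise later by inserting
  a conjugate solution.\<close>

lemma green_identity:
  assumes f: "sol \<mu> f f'" and g: "sol \<nu> g g'" and x: "x \<in> {0..l}"
  shows "f' x * g x - f x * g' x = f' 0 * g 0 - f 0 * g' 0 - (\<mu> - \<nu>) * integral {0..x} (\<lambda>t. f t * g t)"
proof -
  have sub: "{0..x} \<subseteq> {0..l}" using x by auto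
  have "((\<lambda>t. - (\<mu> - \<nu>) * (f t * g t)) has_integral
      ((f' x * g x - f x * g' x) - (f' 0 * g 0 - f 0 * g' 0))) {0..x}"
  proof (rule fundamental_theorem_of_calculus)
    fix t assume "t \<in> {0..x}"
    then have t: "t \<in> {0..l}" using sub by auto
    have "((\<lambda>t. f' t * g t - f t * g' t) has_vector_derivative
        (f' t * g' t + ((of_real (w t) - \<mu>) * f t) * g t) - (f t * ((of_real (w t) - \<nu>) * g t) + f' t * g' t))
        (at t within {0..l})"
      using f g t unfolding sol_def
      by (intro has_vector_derivative_diff has_vector_derivative_mult) auto
    then show "((\<lambda>t. f' t * g t - f t * g' t) has_vector_derivative - (\<mu> - \<nu>) * (f t * g t)) (at t within {0..x})"
      by (intro has_vector_derivative_within_subset[OF _ sub]) (simp add: algebra_simps)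
  qed (use x in auto)
  then have "integral {0..x} (\<lambda>t. - (\<mu> - \<nu>) * (f t * g t)) = (f' x * g x - f x * g' x) - (f' 0 * g 0 - f 0 * g' 0)"
    by (rule integral_unique)
  then have "- (\<mu> - \<nu>) * integral {0..x} (\<lambda>t. f t * g t) = (f' x * g x - f x * g' x) - (f' 0 * g 0 - f 0 * g' 0)"
    by (simp only: integral_mult_right)
  then show ?thesis by (simp add: algebra_simps)
qed

text \<open>The pair is chosen separately for each \<open>\<mu>\<close> and is arbitrary outside the
  interval. Uniqueness on the interval, a case of \<open>sol_difference\<close>, is what gives the
  dependence on \<open>\<mu>\<close> a meaning.\<close>

definition fundamental_pair :: "complex \<Rightarrow> complex \<Rightarrow> complex \<Rightarrow> (real \<Rightarrow> complex) \<times> (real \<Rightarrow> complex)" where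
  "fundamental_pair \<mu> \<alpha> \<beta> = (SOME p. sol \<mu> (fst p) (snd p) \<and> fst p 0 = \<alpha> \<and> snd p 0 = \<beta>)"

definition cs where "cs \<mu> = fst (fundamental_pair \<mu> 1 0)"
definition cs' where "cs' \<mu> = snd (fundamental_pair \<mu> 1 0)"
definition sn where "sn \<mu> = fst (fundamental_pair \<mu> 0 1)"
definition sn' where "sn' \<mu> = snd (fundamental_pair \<mu> 0 1)"

lemma fundamental_pair:
  "sol \<mu> (fst (fundamental_pair \<mu> \<alpha> \<beta>)) (snd (fundamental_pair \<mu> \<alpha> \<beta>))"
  "fst (fundamental_pair \<mu> \<alpha> \<beta>) 0 = \<alpha>" "snd (fundamental_pair \<mu> \<alpha> \<beta>) 0 = \<beta>"
proof -
  have "\<exists>p. sol \<mu> (fst p) (snd p) \<and> fst p 0 = \<alpha> \<and> snd p 0 = \<beta>"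
    using sol_exists[of \<mu> \<alpha> \<beta>] by auto
  from someI_ex[OF this]
  show "sol \<mu> (fst (fundamental_pair \<mu> \<alpha> \<beta>)) (snd (fundamental_pair \<mu> \<alpha> \<beta>))"
    "fst (fundamental_pair \<mu> \<alpha> \<beta>) 0 = \<alpha>" "snd (fundamental_pair \<mu> \<alpha> \<beta>) 0 = \<beta>"
    by (simp_all add: fundamental_pair_def)
qed

lemma sol_cs: "sol \<mu> (cs \<mu>) (cs' \<mu>)" and sol_sn: "sol \<mu> (sn \<mu>) (sn' \<mu>)"
  unfolding cs_def cs'_def sn_def sn'_def by (rule fundamental_pair)+

lemma cs_sn_0 [simp]: "cs \<mu> 0 = 1" "cs' \<mu> 0 = 0" "sn \<mu> 0 = 0" "sn' \<mu> 0 = 1"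
  unfolding cs_def cs'_def sn_def sn'_def by (rule fundamental_pair)+

lemma wronskian:
  assumes "x \<in> {0..l}"
  shows "cs \<mu> x * sn' \<mu> x - cs' \<mu> x * sn \<mu> x = 1"
  using green_identity[OF sol_sn sol_cs assms, of \<mu> \<mu>] by (simp add: algebra_simps)

text \<open>Variation of constants: Green's identity against \<open>cs \<nu>\<close> and
  \<open>sn \<nu>\<close> yields two linear equations for \<open>f x\<close> and
  \<open>f' x\<close>, whose determinant is the Wronskian. The case \<open>\<mu> = \<nu>\<close> is
  uniqueness; the case \<open>\<mu> \<noteq> \<nu>\<close> controls the dependence on the spectral
  parameter.\<close>

lemma sol_difference:
  assumes f: "sol \<mu> f f'" and x: "x \<in> {0..l}"
  shows "f x = f 0 * cs \<nu> x + f' 0 * sn \<nu> x - (\<mu> - \<nu>) *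
      (sn \<nu> x * integral {0..x} (\<lambda>t. f t * cs \<nu> t) - cs \<nu> x * integral {0..x} (\<lambda>t. f t * sn \<nu> t))" (is ?A)
    and "f' x = f 0 * cs' \<nu> x + f' 0 * sn' \<nu> x - (\<mu> - \<nu>) *
      (sn' \<nu> x * integral {0..x} (\<lambda>t. f t * cs \<nu> t) - cs' \<nu> x * integral {0..x} (\<lambda>t. f t * sn \<nu> t))" (is ?B)
proof -
  note W = wronskian[OF x, of \<nu>]
  note c = green_identity[OF f sol_cs x, of \<nu>] and s = green_identity[OF f sol_sn x, of \<nu>]
  have "f x = f x * (cs \<nu> x * sn' \<nu> x - cs' \<nu> x * sn \<nu> x)"
    "f' x = f' x * (cs \<nu> x * sn' \<nu> x - cs' \<nu> x * sn \<nu> x)"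
    using W by simp_all
  then have "f x = sn \<nu> x * (f' x * cs \<nu> x - f x * cs' \<nu> x) - cs \<nu> x * (f' x * sn \<nu> x - f x * sn' \<nu> x)"
    "f' x = sn' \<nu> x * (f' x * cs \<nu> x - f x * cs' \<nu> x) - cs' \<nu> x * (f' x * sn \<nu> x - f x * sn' \<nu> x)"
    by (simp_all add: algebra_simps)
  then show ?A ?B
    unfolding c s by (simp_all add: algebra_simps)
qed

lemma sol_repr:
  assumes "sol \<mu> f f'" "x \<in> {0..l}"
  shows "f x = f 0 * cs \<mu> x + f' 0 * sn \<mu> x" "f' x = f 0 * cs' \<mu> x + f' 0 * sn' \<mu> x"
  using sol_difference[OF assms, of \<mu>] by simp_all

lemma sol_derivative_unique:
  assumes "sol \<mu> f f'" "sol \<nu> g g'" "\<And>x. x \<in> {0..l} \<Longrightarrow> f x = g x" "x \<in> {0..l}"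
  shows "f' x = g' x"
proof (rule vector_derivative_unique_within_closed_interval[of 0 l x f])
  show "(f has_vector_derivative f' x) (at x within cbox 0 l)"
    using assms(1,4) by (simp add: sol_def)
  show "(f has_vector_derivative g' x) (at x within cbox 0 l)"
    using assms(2-4) has_vector_derivative_transform[of x "{0..l}" f g "g' x"] by (simp add: sol_def)
qed (use l_pos assms(4) in auto)

text \<open>As \<open>w\<close> is real, conjugate solutions solve the equation for
  \<open>cnj \<mu>\<close>, and the initial data 0 and 1 do not change.\<close>

lemma cs_sn_cnj:
  assumes "x \<in> {0..l}"
  shows "cs (cnj \<mu>) x = cnj (cs \<mu> x)" "cs' (cnj \<mu>) x = cnj (cs' \<mu> x)"
    "sn (cnj \<mu>) x = cnj (sn \<mu> x)" "sn' (cnj \<mu>) x = cnj (sn' \<mu> x)"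
  using sol_repr[OF sol_cnj[OF sol_cs[of \<mu>]] assms] sol_repr[OF sol_cnj[OF sol_sn[of \<mu>]] assms]
  by simp_all

lemma cs_sn_real:
  assumes "x \<in> {0..l}" "\<mu> \<in> \<real>"
  shows "cs \<mu> x \<in> \<real>" "cs' \<mu> x \<in> \<real>" "sn \<mu> x \<in> \<real>" "sn' \<mu> x \<in> \<real>"
  using cs_sn_cnj[OF assms(1), of \<mu>] assms(2) by (auto simp: Reals_cnj_iff)

section \<open>Dependence of solutions on the spectral parameter\<close>

text \<open>No growth estimate is needed: for \<open>\<mu>\<close> near \<open>\<nu>\<close> the factor \<open>\<mu> - \<nu>\<close> in \<open>sol_difference\<close>
  makes the maximum of \<open>f\<close> on the right-hand side absorbable.\<close>

lemma sol_lipschitz: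
  "\<exists>\<delta>>0. \<exists>K\<ge>0. \<forall>\<mu> f f'. sol \<mu> f f' \<longrightarrow> f 0 = \<alpha> \<longrightarrow> f' 0 = \<beta> \<longrightarrow> cmod (\<mu> - \<nu>) < \<delta> \<longrightarrow>
     (\<forall>x\<in>{0..l}. cmod (f x - (\<alpha> * cs \<nu> x + \<beta> * sn \<nu> x)) \<le> K * cmod (\<mu> - \<nu>))"
proof -
  have "bounded (cs \<nu> ` {0..l} \<union> sn \<nu> ` {0..l})"
    using sol_continuous(1)[OF sol_cs] sol_continuous(1)[OF sol_sn]
    by (auto intro!: compact_imp_bounded compact_continuous_image)
  then obtain B where B: "B > 0" "\<forall>z\<in>cs \<nu> ` {0..l} \<union> sn \<nu> ` {0..l}. cmod z \<le> B"
    unfolding bounded_pos by auto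
  then have Bc: "cmod (cs \<nu> x) \<le> B" and Bs: "cmod (sn \<nu> x) \<le> B" if "x \<in> {0..l}" for x
    using that by auto
  \<comment> \<open>\<open>G\<close> bounds the solution at \<open>\<nu>\<close> with the same
    initial data. If \<open>F\<close> is the maximum of \<open>cmod f\<close>, the perturbation is
    at most \<open>cmod (\<mu> - \<nu>) * (2 * B\<^sup>2 * l * F)\<close>. The choice of
    \<open>\<delta>\<close> makes this at most \<open>F / 2\<close>, hence
    \<open>F \<le> 2 * G\<close>, and \<open>K\<close> results.\<close>
  define G where "G = (cmod \<alpha> + cmod \<beta>) * B"
  define \<delta> where "\<delta> = 1 / (4 * B\<^sup>2 * l)"
  define K where "K = 4 * B\<^sup>2 * l * G"
  show ?thesis
  proof (rule exI[of _ \<delta>], rule conjI, goal_cases)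
    case 2
    show ?case
    proof (rule exI[of _ K], intro conjI allI impI ballI)
      show "K \<ge> 0" using B(1) l_pos by (auto simp: \<delta>_def K_def G_def)
      fix \<mu> f f' x
      assume f: "sol \<mu> f f'" "f 0 = \<alpha>" "f' 0 = \<beta>" and \<mu>: "cmod (\<mu> - \<nu>) < \<delta>" and x: "x \<in> {0..l}"
      have cf: "continuous_on {0..l} (\<lambda>x. cmod (f x))"
        using sol_continuous(1)[OF f(1)] by (intro continuous_intros)
      obtain m where m: "m \<in> {0..l}" "\<And>y. y \<in> {0..l} \<Longrightarrow> cmod (f y) \<le> cmod (f m)"
        using continuous_attains_sup[OF _ _ cf] l_pos by auto
      define F where "F = cmod (f m)"
      have int: "cmod (integral {0..y} (\<lambda>t. f t * h t)) \<le> F * B * l"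
        if y: "y \<in> {0..l}" and h: "continuous_on {0..l} h" "\<And>t. t \<in> {0..l} \<Longrightarrow> cmod (h t) \<le> B" for y h
      proof -
        have sub: "{0..y} \<subseteq> {0..l}" using y by auto
        have "cmod (integral {0..y} (\<lambda>t. f t * h t)) \<le> F * B * (y - 0)"
        proof (rule integral_bound)
          show "continuous_on {0..y} (\<lambda>t. f t * h t)"
            using continuous_on_subset[OF sol_continuous(1)[OF f(1)] sub] continuous_on_subset[OF h(1) sub]
            by (intro continuous_intros)
          fix t assume "t \<in> {0..y}"
          then have "t \<in> {0..l}" using sub by auto
          then show "cmod (f t * h t) \<le> F * B"
            unfolding norm_mult F_def using h(2) m(2) B(1) by (intro mult_mono) auto
        qed (use y in auto)
        also have "\<dots> \<le> F * B * l"
          using y B(1) by (intro mult_left_mono) (auto simp: F_def)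
        finally show ?thesis .
      qed
      have diff: "cmod (f y - (\<alpha> * cs \<nu> y + \<beta> * sn \<nu> y)) \<le> cmod (\<mu> - \<nu>) * (2 * B\<^sup>2 * l * F)"
        if y: "y \<in> {0..l}" for y
      proof -
        have parts: "cmod (sn \<nu> y * integral {0..y} (\<lambda>t. f t * cs \<nu> t)) \<le> B * (F * B * l)"
          "cmod (cs \<nu> y * integral {0..y} (\<lambda>t. f t * sn \<nu> t)) \<le> B * (F * B * l)"
          unfolding norm_mult using B(1)
          by (intro mult_mono Bs[OF y] Bc[OF y] int[OF y sol_continuous(1)[OF sol_cs] Bc]
              int[OF y sol_continuous(1)[OF sol_sn] Bs]; simp)+
        have "f y - (\<alpha> * cs \<nu> y + \<beta> * sn \<nu> y) = - ((\<mu> - \<nu>) *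
          (sn \<nu> y * integral {0..y} (\<lambda>t. f t * cs \<nu> t) - cs \<nu> y * integral {0..y} (\<lambda>t. f t * sn \<nu> t)))"
          using sol_difference(1)[OF f(1) y, of \<nu>] by (simp add: f)
        then have "cmod (f y - (\<alpha> * cs \<nu> y + \<beta> * sn \<nu> y)) = cmod (\<mu> - \<nu>) * cmod
          (sn \<nu> y * integral {0..y} (\<lambda>t. f t * cs \<nu> t) - cs \<nu> y * integral {0..y} (\<lambda>t. f t * sn \<nu> t))"
          by (simp only: norm_minus_cancel norm_mult)
        also have "\<dots> \<le> cmod (\<mu> - \<nu>) * (B * (F * B * l) + B * (F * B * l))"
          by (rule mult_left_mono[OF order.trans[OF norm_triangle_ineq4 add_mono[OF parts]] norm_ge_zero])
        also have "B * (F * B * l) + B * (F * B * l) = 2 * B\<^sup>2 * l * F"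
          by (simp add: power2_eq_square)
        finally show ?thesis .
      qed
      have "F \<le> cmod (\<alpha> * cs \<nu> m + \<beta> * sn \<nu> m) + cmod (f m - (\<alpha> * cs \<nu> m + \<beta> * sn \<nu> m))"
        unfolding F_def by (metis add.commute diff_add_cancel norm_triangle_ineq)
      also have "cmod (\<alpha> * cs \<nu> m + \<beta> * sn \<nu> m) \<le> cmod \<alpha> * B + cmod \<beta> * B"
        by (intro order.trans[OF norm_triangle_ineq] add_mono)
          (auto simp: norm_mult intro!: mult_left_mono Bc Bs m)
      also have "cmod (f m - (\<alpha> * cs \<nu> m + \<beta> * sn \<nu> m)) \<le> \<delta> * (2 * B\<^sup>2 * l * F)"
        using B(1) l_pos \<mu> by (intro order.trans[OF diff[OF m(1)]] mult_right_mono) (auto simp: F_def)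
      also have "\<delta> * (2 * B\<^sup>2 * l * F) = F / 2"
        using B(1) l_pos by (simp add: \<delta>_def)
      also have "cmod \<alpha> * B + cmod \<beta> * B = G" by (simp add: G_def distrib_right)
      finally have "F \<le> 2 * G" by simp
      then have "2 * B\<^sup>2 * l * F \<le> K"
        using B(1) l_pos mult_left_mono[of F "2 * G" "2 * B\<^sup>2 * l"] by (simp add: K_def)
      then have "cmod (\<mu> - \<nu>) * (2 * B\<^sup>2 * l * F) \<le> cmod (\<mu> - \<nu>) * K"
        by (intro mult_left_mono) auto
      then show "cmod (f x - (\<alpha> * cs \<nu> x + \<beta> * sn \<nu> x)) \<le> K * cmod (\<mu> - \<nu>)"
        using diff[OF x] by (simp add: mult.commute)
    qed
  qed (use B(1) l_pos in \<open>auto simp: \<delta>_def\<close>)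
qed

text \<open>Used twice: for the difference quotients of the end values in \<open>\<mu>\<close>, and
  for the pairing of a varying wave with a fixed eigenfunction.\<close>

lemma isCont_integral_sol:
  assumes f: "\<And>\<mu>. sol \<mu> (f \<mu>) (f' \<mu>)" "\<And>\<mu>. f \<mu> 0 = \<alpha>" "\<And>\<mu>. f' \<mu> 0 = \<beta>"
    and h: "continuous_on {0..l} h"
  shows "isCont (\<lambda>\<mu>. integral {0..l} (\<lambda>t. f \<mu> t * h t)) \<nu>"
proof -
  obtain \<delta> K where \<delta>: "\<delta> > 0" "K \<ge> 0" and lip:
    "\<forall>\<mu> f f'. sol \<mu> f f' \<longrightarrow> f 0 = \<alpha> \<longrightarrow> f' 0 = \<beta> \<longrightarrow> cmod (\<mu> - \<nu>) < \<delta> \<longrightarrow>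
     (\<forall>x\<in>{0..l}. cmod (f x - (\<alpha> * cs \<nu> x + \<beta> * sn \<nu> x)) \<le> K * cmod (\<mu> - \<nu>))"
    by (rule exE[OF sol_lipschitz[of \<alpha> \<beta> \<nu>]], elim exE conjE) (rule that)
  have "bounded (h ` {0..l})"
    using h by (auto intro!: compact_imp_bounded compact_continuous_image)
  then obtain B where B: "B > 0" "\<forall>x\<in>{0..l}. cmod (h x) \<le> B"
    unfolding bounded_pos by auto
  have cont: "continuous_on {0..l} (f \<mu>)" for \<mu>
    by (rule sol_continuous(1)[OF f(1)])
  have bound: "cmod (integral {0..l} (\<lambda>t. f \<mu> t * h t) - integral {0..l} (\<lambda>t. f \<nu> t * h t)) \<le> K * cmod (\<mu> - \<nu>) * B * l"
    if \<mu>: "cmod (\<mu> - \<nu>) < \<delta>" for \<mu>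
  proof -
    have eq: "integral {0..l} (\<lambda>t. f \<mu> t * h t) - integral {0..l} (\<lambda>t. f \<nu> t * h t)
        = integral {0..l} (\<lambda>t. (f \<mu> t - f \<nu> t) * h t)"
      by (subst integral_diff[symmetric])
        (auto intro!: integrable_continuous_real continuous_intros cont h simp: left_diff_distrib)
    have "cmod (integral {0..l} (\<lambda>t. (f \<mu> t - f \<nu> t) * h t)) \<le> K * cmod (\<mu> - \<nu>) * B * (l - 0)"
    proof (rule integral_bound)
      fix t assume t: "t \<in> {0..l}"
      have "cmod (f \<mu> t - f \<nu> t) \<le> K * cmod (\<mu> - \<nu>)"
        using lip[rule_format, OF f \<mu> t] sol_repr(1)[OF f(1) t, of \<nu>] by (simp add: f)
      then show "cmod ((f \<mu> t - f \<nu> t) * h t) \<le> K * cmod (\<mu> - \<nu>) * B"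
        unfolding norm_mult using B t \<delta> by (intro mult_mono) auto
    qed (use l_pos in \<open>auto intro!: continuous_intros cont h\<close>)
    then show ?thesis unfolding eq by simp
  qed
  have "((\<lambda>\<mu>. K * cmod (\<mu> - \<nu>) * B * l) \<longlongrightarrow> K * cmod (\<nu> - \<nu>) * B * l) (at \<nu>)"
    by (intro tendsto_intros)
  then have lim: "((\<lambda>\<mu>. K * cmod (\<mu> - \<nu>) * B * l) \<longlongrightarrow> 0) (at \<nu>)"
    by simp
  have "\<forall>\<^sub>F \<mu> in at \<nu>. cmod (\<mu> - \<nu>) < \<delta>"
    using \<delta>(1) by (auto simp: eventually_at dist_norm)
  then have "\<forall>\<^sub>F \<mu> in at \<nu>. cmod (integral {0..l} (\<lambda>t. f \<mu> t * h t) - integral {0..l} (\<lambda>t. f \<nu> t * h t))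
      \<le> K * cmod (\<mu> - \<nu>) * B * l"
    by eventually_elim (rule bound)
  then have "((\<lambda>\<mu>. integral {0..l} (\<lambda>t. f \<mu> t * h t) - integral {0..l} (\<lambda>t. f \<nu> t * h t)) \<longlongrightarrow> 0) (at \<nu>)"
    by (rule Lim_null_comparison[OF _ lim])
  then show ?thesis
    by (simp add: isCont_def LIM_zero_iff)
qed

text \<open>Caratheodory's criterion: \<open>sol_difference\<close> writes the increment as
  \<open>\<mu> - \<nu>\<close> times a combination of integrals that are continuous at
  \<open>\<nu>\<close>. The Picard series need not be differentiated in
  \<open>\<mu>\<close>.\<close>

lemma sol_end_has_field_derivative:
  assumes f: "\<And>\<mu>. sol \<mu> (f \<mu>) (f' \<mu>)" "\<And>\<mu>. f \<mu> 0 = \<alpha>" "\<And>\<mu>. f' \<mu> 0 = \<beta>"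
  shows "\<exists>D. ((\<lambda>\<mu>. f \<mu> l) has_field_derivative D) (at \<nu>)"
    and "\<exists>D. ((\<lambda>\<mu>. f' \<mu> l) has_field_derivative D) (at \<nu>)"
proof -
  have l: "l \<in> {0..l}" using l_pos by simp
  note cont = isCont_integral_sol[OF f sol_continuous(1)[OF sol_cs[of \<nu>]], of \<nu>]
    isCont_integral_sol[OF f sol_continuous(1)[OF sol_sn[of \<nu>]], of \<nu>]
  note diff = sol_difference[OF f(1) l, of _ \<nu>, unfolded f]
  let ?h = "\<lambda>s c \<mu>. - (s * integral {0..l} (\<lambda>t. f \<mu> t * cs \<nu> t) - c * integral {0..l} (\<lambda>t. f \<mu> t * sn \<nu> t))"
  have alg: "x - y = - h * m" if "x = z - m * h" "y = z" for x y z m h :: complex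
    using that by (simp add: algebra_simps)
  have c: "isCont (?h s c) \<nu>" for s c
    by (intro continuous_intros cont)
  have h1: "\<forall>\<mu>. f \<mu> l - f \<nu> l = ?h (sn \<nu> l) (cs \<nu> l) \<mu> * (\<mu> - \<nu>)"
  proof
    fix \<mu>
    have "f \<nu> l = \<alpha> * cs \<nu> l + \<beta> * sn \<nu> l"
      using sol_repr(1)[OF f(1) l, of \<nu>] by (simp add: f)
    with diff(1)[of \<mu>] show "f \<mu> l - f \<nu> l = ?h (sn \<nu> l) (cs \<nu> l) \<mu> * (\<mu> - \<nu>)"
      by (rule alg)
  qed
  have h2: "\<forall>\<mu>. f' \<mu> l - f' \<nu> l = ?h (sn' \<nu> l) (cs' \<nu> l) \<mu> * (\<mu> - \<nu>)"
  proof
    fix \<mu>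
    have "f' \<nu> l = \<alpha> * cs' \<nu> l + \<beta> * sn' \<nu> l"
      using sol_repr(2)[OF f(1) l, of \<nu>] by (simp add: f)
    with diff(2)[of \<mu>] show "f' \<mu> l - f' \<nu> l = ?h (sn' \<nu> l) (cs' \<nu> l) \<mu> * (\<mu> - \<nu>)"
      by (rule alg)
  qed
  have "((\<lambda>\<mu>. f \<mu> l) has_field_derivative ?h (sn \<nu> l) (cs \<nu> l) \<nu>) (at \<nu>)"
    by (rule CARAT_DERIV[THEN iffD2], rule exI[of _ "?h (sn \<nu> l) (cs \<nu> l)"], intro conjI h1 c refl)
  then show "\<exists>D. ((\<lambda>\<mu>. f \<mu> l) has_field_derivative D) (at \<nu>)" ..
  have "((\<lambda>\<mu>. f' \<mu> l) has_field_derivative ?h (sn' \<nu> l) (cs' \<nu> l) \<nu>) (at \<nu>)"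
    by (rule CARAT_DERIV[THEN iffD2], rule exI[of _ "?h (sn' \<nu> l) (cs' \<nu> l)"], intro conjI h2 c refl)
  then show "\<exists>D. ((\<lambda>\<mu>. f' \<mu> l) has_field_derivative D) (at \<nu>)" ..
qed

lemma cs_sn_holomorphic:
  "(\<lambda>\<mu>. cs \<mu> l) holomorphic_on A" "(\<lambda>\<mu>. cs' \<mu> l) holomorphic_on A"
  "(\<lambda>\<mu>. sn \<mu> l) holomorphic_on A" "(\<lambda>\<mu>. sn' \<mu> l) holomorphic_on A"
proof -
  have "g holomorphic_on A" if "\<And>\<nu>. \<exists>D. (g has_field_derivative D) (at \<nu>)" for g :: "complex \<Rightarrow> complex"
    unfolding holomorphic_on_def field_differentiable_def
    using that by (meson has_field_derivative_at_within)
  note 1 = this[OF sol_end_has_field_derivative(1)] and 2 = this[OF sol_end_has_field_derivative(2)]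
  show "(\<lambda>\<mu>. cs \<mu> l) holomorphic_on A" "(\<lambda>\<mu>. cs' \<mu> l) holomorphic_on A"
    "(\<lambda>\<mu>. sn \<mu> l) holomorphic_on A" "(\<lambda>\<mu>. sn' \<mu> l) holomorphic_on A"
    by (rule 1[OF sol_cs] 2[OF sol_cs] 1[OF sol_sn] 2[OF sol_sn]; rule cs_sn_0)+
qed

end

section \<open>Zeros of determinants and analytic square roots\<close>

lemma det_eq_0_iff_kernel:
  fixes A :: "'a::field^'n^'n"
  shows "det A = 0 \<longleftrightarrow> (\<exists>x. x \<noteq> 0 \<and> A *v x = 0)"
  using matrix_left_invertible_ker[of A] invertible_left_inverse[of A] invertible_det_nz[of A] by auto

lemma holomorphic_on_det:
  fixes A :: "complex \<Rightarrow> complex^'n^'n"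
  assumes "\<And>i j. (\<lambda>z. A z $ i $ j) holomorphic_on S"
  shows "(\<lambda>z. det (A z)) holomorphic_on S"
  unfolding det_def using assms by (intro holomorphic_intros)

text \<open>The hypothesis \<open>crit\<close> excludes Jordan chains of length two at \<open>z0\<close>. Dividing \<open>z - z0\<close> out of the
  columns of \<open>A z\<close> that belong to a basis of the kernel then leaves an invertible matrix.\<close>

lemma det_zero_order:
  fixes A :: "complex \<Rightarrow> complex^'n^'n"
  assumes S: "open S" "z0 \<in> S" and hol: "\<And>i j. (\<lambda>z. A z $ i $ j) holomorphic_on S"
    and crit: "\<And>x y. A z0 *v x = 0 \<Longrightarrow>
      (\<And>i. ((\<lambda>z. (A z *v (x + (z - z0) *s y)) $ i) has_field_derivative 0) (at z0)) \<Longrightarrow> x = 0"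
  shows "\<exists>g. g holomorphic_on S \<and> g z0 \<noteq> 0 \<and>
    (\<forall>z\<in>S. det (A z) = g z * (z - z0) ^ vec.dim {x. A z0 *v x = 0})"
proof -
  define K where "K = {x. A z0 *v x = 0}"
  have subK: "vec.subspace K"
    unfolding K_def by (rule vec.subspaceI) (auto simp: matrix_vector_right_distrib vector_scalar_commute)
  obtain B where B: "B \<subseteq> K" "vec.independent B" "K \<subseteq> vec.span B" "card B = vec.dim K"
    by (rule vec.basis_exists)
  obtain B' where B': "B \<subseteq> B'" "vec.independent B'" "UNIV \<subseteq> vec.span B'"
    by (rule vec.maximal_independent_subset_extend[OF subset_UNIV B(2)])
  have fin: "finite B'" using B'(2) by (rule vec.finiteI_independent)
  have "vec.span B' = vec.span UNIV"
    using B'(3) by (simp add: top.extremum_unique)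
  from vec.dim_eq_card[OF this B'(2)] have "card B' = CARD('n)"
    by (metis vec_dim_card)
  then obtain \<beta> :: "'n \<Rightarrow> complex^'n" where \<beta>: "bij_betw \<beta> UNIV B'"
    using finite_same_card_bij[OF _ fin, of "UNIV :: 'n set"] by auto
  \<comment> \<open>\<open>J\<close> marks the columns of \<open>P\<close> that form a basis of the
    kernel; the other columns complete it to a basis of the whole space.\<close>
  define J where "J = {j. \<beta> j \<in> B}"
  have J: "bij_betw \<beta> J B"
    using \<beta> B'(1) unfolding J_def bij_betw_def by (auto intro: inj_on_subset)
  have cardJ: "card J = vec.dim K"
    using bij_betw_same_card[OF J] B(4) by simp
  define P :: "complex^'n^'n" where "P = (\<chi> i j. \<beta> j $ i)"
  have P: "P *v c = (\<Sum>j\<in>UNIV. c $ j *s \<beta> j)" for c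
    by (simp add: matrix_mult_sum P_def column_def)
  have P_inj: "c = 0" if "P *v c = 0" for c
  proof -
    have "(\<Sum>b\<in>B'. c $ (inv \<beta> b) *s b) = (\<Sum>j\<in>UNIV. c $ (inv \<beta> (\<beta> j)) *s \<beta> j)"
      by (rule sum.reindex_bij_betw[OF \<beta>, symmetric])
    also have "\<dots> = P *v c"
      using \<beta> by (simp add: P bij_betw_def)
    finally have "(\<Sum>b\<in>B'. c $ (inv \<beta> b) *s b) = 0" using that by simp
    then have "c $ (inv \<beta> b) = 0" if "b \<in> B'" for b
      using vec.independentD[OF B'(2) fin subset_refl, where u = "\<lambda>b. c $ (inv \<beta> b)"] that by simp
    then have "c $ j = 0" for j
      using \<beta> by (metis bij_betw_def inv_f_f rangeI)
    then show ?thesis by (simp add: vec_eq_iff)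
  qed
  then have detP: "det P \<noteq> 0"
    using det_eq_0_iff_kernel by blast
  define f where "f j i z = (A z *v \<beta> j) $ i" for j i z
  have f_hol: "f j i holomorphic_on S" for j i
    unfolding f_def matrix_vector_mult_def by (auto intro!: holomorphic_intros hol)
  have f_z0: "f j i z0 = 0" if "j \<in> J" for i j
    using that B(1) by (auto simp: f_def J_def K_def)
  \<comment> \<open>For \<open>j \<in> J\<close> the entry \<open>f j i\<close> vanishes at
    \<open>z0\<close>, so this is the quotient by \<open>z - z0\<close> with its removable
    singularity filled in.\<close>
  define F where "F j i = (\<lambda>z. if z = z0 then deriv (f j i) z0 else (f j i z - f j i z0) / (z - z0))" for j i
  have F_hol: "F j i holomorphic_on S" for j i
    unfolding F_def using f_hol S by (intro pole_lemma) (simp_all add: interior_open)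
  define C :: "complex \<Rightarrow> complex^'n^'n" where "C z = (\<chi> i j. if j \<in> J then F j i z else f j i z)" for z
  define D :: "complex \<Rightarrow> complex^'n^'n" where
    "D z = (\<chi> i j. if i = j then (if j \<in> J then z - z0 else 1) else 0)" for z
  have f_eq: "f j i z = (z - z0) * F j i z" if "j \<in> J" for i j z
    using that f_z0[OF that] by (simp add: F_def)
  \<comment> \<open>The determinant of \<open>D z\<close> carries the whole power of
    \<open>z - z0\<close>, so what remains is that \<open>C z0\<close> is invertible.\<close>
  have AP: "A z ** P = C z ** D z" for z
  proof -
    have "(A z ** P) $ i $ j = (C z ** D z) $ i $ j" for i j
    proof -
      have "(A z ** P) $ i $ j = f j i z"
        by (simp add: f_def P_def matrix_matrix_mult_def matrix_vector_mult_def)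
      also have "\<dots> = C z $ i $ j * (if j \<in> J then z - z0 else 1)"
        using f_eq by (simp add: C_def)
      also have "\<dots> = (\<Sum>k\<in>UNIV. C z $ i $ k * (if k = j then (if j \<in> J then z - z0 else 1) else 0))"
        by (simp add: if_distrib cong: if_cong)
      finally show ?thesis by (simp add: matrix_matrix_mult_def D_def)
    qed
    then show ?thesis by (simp add: vec_eq_iff)
  qed
  have detD: "det (D z) = (z - z0) ^ vec.dim K" for z
  proof -
    have "det (D z) = (\<Prod>i\<in>UNIV. D z $ i $ i)"
      by (rule det_diagonal) (simp add: D_def)
    also have "\<dots> = (\<Prod>i\<in>UNIV. if i \<in> J then z - z0 else 1)"
      by (simp add: D_def)
    also have "\<dots> = (z - z0) ^ card J"
      by (simp add: prod.If_cases)
    finally show ?thesis by (simp add: cardJ)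
  qed
  have "det (C z0) \<noteq> 0"
  proof
    assume "det (C z0) = 0"
    then obtain c where c: "c \<noteq> 0" "C z0 *v c = 0" by (auto simp: det_eq_0_iff_kernel)
    \<comment> \<open>A kernel vector \<open>c\<close> of \<open>C z0\<close> is split along
      \<open>J\<close>. The chain with \<open>x = P *v cx\<close> and \<open>y = P *v cy\<close> has
      derivative \<open>C z0 *v c = 0\<close> at \<open>z0\<close>, which makes \<open>crit\<close>
      applicable.\<close>
    define cx :: "complex^'n" where "cx = (\<chi> j. if j \<in> J then c $ j else 0)"
    define cy :: "complex^'n" where "cy = (\<chi> j. if j \<in> J then 0 else c $ j)"
    have A_P: "(A z *v (P *v a)) $ i = (\<Sum>j\<in>UNIV. a $ j * f j i z)" for a z i
    proof -
      have "A z *v (P *v a) = C z *v (D z *v a)"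
        by (simp only: matrix_vector_mul_assoc AP)
      moreover
      have *: "D z *v a = (\<chi> j. (if j \<in> J then z - z0 else 1) * a $ j)"
      proof -
        have "(\<Sum>k\<in>UNIV. D z $ i $ k * a $ k) = (\<Sum>k\<in>UNIV. if k = i then (if i \<in> J then z - z0 else 1) * a $ i else 0)" for i
          by (rule sum.cong) (auto simp: D_def)
        then show ?thesis by (simp add: vec_eq_iff matrix_vector_mult_def)
      qed
      have "(C z *v (D z *v a)) $ i = (\<Sum>j\<in>UNIV. a $ j * f j i z)"
        unfolding * unfolding matrix_vector_mult_def by (auto simp: C_def f_eq intro!: sum.cong)
      ultimately show ?thesis by simp
    qed
    have x0: "A z0 *v (P *v cx) = 0"
      by (auto simp: vec_eq_iff A_P cx_def f_z0 intro!: sum.neutral)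
    have "((\<lambda>z. (A z *v (P *v cx + (z - z0) *s (P *v cy))) $ i) has_field_derivative 0) (at z0)" for i
    proof -
      have eq: "(A z *v (P *v cx + (z - z0) *s (P *v cy))) $ i =
          (\<Sum>j\<in>UNIV. cx $ j * f j i z) + (z - z0) * (\<Sum>j\<in>UNIV. cy $ j * f j i z)" for z
        by (simp only: matrix_vector_right_distrib vector_scalar_commute A_P vector_add_component vector_smult_component)
      have d: "(f j i has_field_derivative deriv (f j i) z0) (at z0)" for j
        using f_hol S holomorphic_derivI by blast
      have "((\<lambda>z. (\<Sum>j\<in>UNIV. cx $ j * f j i z) + (z - z0) * (\<Sum>j\<in>UNIV. cy $ j * f j i z)) has_field_derivative
          ((\<Sum>j\<in>UNIV. cx $ j * deriv (f j i) z0) + (\<Sum>j\<in>UNIV. cy $ j * f j i z0))) (at z0)"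
        by (rule derivative_eq_intros d refl | simp | simp add: mult.commute)+
      also have "(\<Sum>j\<in>UNIV. cx $ j * deriv (f j i) z0) + (\<Sum>j\<in>UNIV. cy $ j * f j i z0) = (C z0 *v c) $ i"
        unfolding matrix_vector_mult_def sum.distrib[symmetric]
        by (auto simp: C_def F_def cx_def cy_def intro!: sum.cong)
      finally show ?thesis unfolding eq by (simp only: c(2) zero_index)
    qed
    then have "P *v cx = 0" by (rule crit[OF x0])
    then have "cx = 0" by (rule P_inj)
    then have cJ: "c $ j = 0" if "j \<in> J" for j
      using that by (auto simp: vec_eq_iff cx_def split: if_splits)
    \<comment> \<open>Now \<open>c\<close> lives outside \<open>J\<close>, where \<open>C z0\<close>
      and \<open>A z0 ** P\<close> have the same columns. So \<open>P *v cy\<close> lies in the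
      kernel and is spanned by the columns in \<open>J\<close>; independence of the columns of
      \<open>P\<close> then forces \<open>cy = 0\<close>.\<close>
    have "A z0 *v (P *v cy) = C z0 *v c"
    proof -
      have "(C z0 *v c) $ i = (\<Sum>j\<in>UNIV. cy $ j * f j i z0)" for i
        unfolding matrix_vector_mult_def using cJ by (auto simp: C_def cy_def intro!: sum.cong)
      then show ?thesis by (simp only: vec_eq_iff A_P simp_thms)
    qed
    then have "P *v cy \<in> vec.span B" using c(2) B(3) by (auto simp: K_def)
    then obtain u where u: "P *v cy = (\<Sum>b\<in>B. u b *s b)"
      using vec.span_finite[OF finite_subset[OF B'(1) fin]] by auto
    also have "\<dots> = (\<Sum>j\<in>J. u (\<beta> j) *s \<beta> j)"
      by (rule sum.reindex_bij_betw[OF J, symmetric])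
    also have "\<dots> = P *v (\<chi> j. if j \<in> J then u (\<beta> j) else 0)"
      unfolding P by (rule sum.mono_neutral_cong_left) auto
    finally have "P *v (cy - (\<chi> j. if j \<in> J then u (\<beta> j) else 0)) = 0"
      by (simp add: matrix_vector_mult_diff_distrib)
    then have cy_eq: "cy = (\<chi> j. if j \<in> J then u (\<beta> j) else 0)"
      using P_inj by fastforce
    then have "c $ j = 0" if "j \<notin> J" for j
    proof -
      have "cy $ j = 0" unfolding cy_eq using that by simp
      then show ?thesis using that by (simp add: cy_def)
    qed
    with cJ c(1) show False by (auto simp: vec_eq_iff)
  qed
  moreover have "(\<lambda>z. det (C z)) holomorphic_on S"
  proof (rule holomorphic_on_det)
    show "(\<lambda>z. C z $ i $ j) holomorphic_on S" for i j
      using F_hol[of j i] f_hol[of j i] by (cases "j \<in> J") (simp_all add: C_def)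
  qed
  moreover have "det (A z) * det P = det (C z) * (z - z0) ^ vec.dim K" for z
    using AP[of z] detD[of z] by (metis det_mul)
  ultimately show ?thesis
    using detP unfolding K_def
    by (intro exI[of _ "\<lambda>z. det (C z) / det P"]) (auto intro!: holomorphic_intros simp: field_simps)
qed

section \<open>Real determinants, zeros of entire functions and square roots\<close>

lemma det_Reals:
  fixes A :: "complex^'n^'n"
  assumes "\<And>i j. A $ i $ j \<in> \<real>"
  shows "det A \<in> \<real>"
  unfolding det_def using assms by (intro sum_in_Reals Reals_mult prod_in_Reals Reals_of_int)

lemma finite_zeros_of_entire:
  assumes "f holomorphic_on UNIV" "f c \<noteq> 0" "compact K"
  shows "finite {z\<in>K. f z = 0}"
proof (cases "f constant_on UNIV")
  case True
  then obtain y where y: "\<And>z. f z = y" by (auto simp: constant_on_def)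
  then have "{z\<in>K. f z = 0} = {}" using assms(2) by simp
  then show ?thesis by (simp only: finite.emptyI)
next
  case False
  then show ?thesis using holomorphic_compact_finite_zeros[OF assms(1) open_UNIV connected_UNIV assms(3)] by auto
qed

text \<open>The neighbourhood of the half-line is a union of vertical segments, so it retracts onto the
  half-line and is contractible.\<close>

lemma holomorphic_sqrt_near_half_line:
  assumes W: "open W" "0 \<notin> W" "\<And>x. x > 0 \<Longrightarrow> of_real x \<in> W"
    and h: "h holomorphic_on W" "\<And>z. z \<in> W \<Longrightarrow> h z \<noteq> 0"
  obtains U s where "open U" "\<And>x. x > 0 \<Longrightarrow> of_real x \<in> U" "U \<subseteq> W" "\<And>z. z \<in> U \<Longrightarrow> \<bar>Im z\<bar> < Re z"
    "s holomorphic_on U" "\<And>z. z \<in> U \<Longrightarrow> (s z)\<^sup>2 = h z"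
proof -
  have ne: "- W \<noteq> {}" and cl: "closed (- W)" using W by auto
  \<comment> \<open>The height over \<open>x\<close> is the distance from \<open>x\<close> to the
    complement of \<open>W\<close>, which keeps \<open>U\<close> inside \<open>W\<close>. As
    \<open>0 \<notin> W\<close>, this distance is at most \<open>x\<close>, so \<open>U\<close>
    stays in the sector \<open>\<bar>Im z\<bar> < Re z\<close>.\<close>
  define U where "U = {z. 0 < Re z \<and> \<bar>Im z\<bar> < infdist (of_real (Re z)) (- W)}"
  have "open U"
    unfolding U_def by (intro open_Collect_conj open_Collect_less continuous_intros)
  have real: "of_real x \<in> U" if "x > 0" for x
    using infdist_pos_not_in_closed[OF cl ne, of "of_real x"] W(3)[OF that] that by (simp add: U_def)
  have "U \<subseteq> W"
  proof
    fix z assume z: "z \<in> U"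
    show "z \<in> W"
    proof (rule ccontr)
      assume "z \<notin> W"
      then have "infdist (of_real (Re z)) (- W) \<le> dist (of_real (Re z)) z"
        by (intro infdist_le) auto
      also have "of_real (Re z) - z = - (\<i> * of_real (Im z))"
        by (simp add: complex_eq_iff)
      then have "dist (of_real (Re z)) z = \<bar>Im z\<bar>"
        by (simp add: dist_norm norm_mult)
      finally show False using z by (simp add: U_def)
    qed
  qed
  have sector: "\<bar>Im z\<bar> < Re z" if "z \<in> U" for z
    using infdist_le[of 0 "- W" "of_real (Re z)"] W(2) that by (auto simp: U_def)
  have "contractible U"
  proof -
    have "homotopic_with_canon (\<lambda>z. True) U U id (\<lambda>z. of_real (Re z))"
    proof (rule homotopic_with_linear)
      fix z assume z: "z \<in> U"
      show "closed_segment (id z) (of_real (Re z)) \<subseteq> U"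
      proof
        fix y assume "y \<in> closed_segment (id z) (of_real (Re z))"
        then obtain u where u: "0 \<le> u" "u \<le> 1" "y = (1 - u) *\<^sub>R z + u *\<^sub>R of_real (Re z)"
          by (auto simp: closed_segment_def)
        have "Re y = Re z" "Im y = (1 - u) * Im z" unfolding u(3) by (simp_all add: algebra_simps)
        moreover have "(1 - u) * \<bar>Im z\<bar> \<le> \<bar>Im z\<bar>" using u mult_left_le_one_le[of "\<bar>Im z\<bar>" "1 - u"] by simp
        ultimately show "y \<in> U" using z u by (simp add: U_def abs_mult)
      qed
    qed (auto intro!: continuous_intros simp: id_def)
    moreover have "homotopic_with_canon (\<lambda>z. True) U U (\<lambda>z. of_real (Re z)) (\<lambda>z. 1)"
    proof (rule homotopic_with_linear)
      fix z assume z: "z \<in> U"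
      show "closed_segment (of_real (Re z)) 1 \<subseteq> U"
      proof
        fix y :: complex assume "y \<in> closed_segment (of_real (Re z)) 1"
        then obtain u where u: "0 \<le> u" "u \<le> 1" "y = (1 - u) *\<^sub>R of_real (Re z) + u *\<^sub>R 1"
          by (auto simp: closed_segment_def)
        have y: "y = of_real ((1 - u) * Re z + u)" unfolding u(3) by (simp add: scaleR_conv_of_real)
        have "0 < (1 - u) * Re z + u"
          using z u by (cases "u = 1") (auto simp: U_def intro!: add_pos_nonneg)
        then show "y \<in> U" unfolding y by (rule real)
      qed
    qed (auto intro!: continuous_intros)
    ultimately show ?thesis
      unfolding contractible_def using homotopic_with_trans by blast
  qed
  then obtain s where "s holomorphic_on U" "\<And>z. z \<in> U \<Longrightarrow> h z = (s z)\<^sup>2"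
    using contractible_imp_holomorphic_sqrt[of h U] h \<open>U \<subseteq> W\<close> holomorphic_on_subset by (metis subsetD)
  with \<open>open U\<close> real \<open>U \<subseteq> W\<close> sector show ?thesis by (intro that) auto
qed

text \<open>No branches have to be matched: the neighbourhoods of the two real half-lines lie in
  opposite sectors, disjoint from the region \<open>\<bar>Re z\<bar> < \<bar>Im z\<bar>\<close> used
  for the imaginary axis. At an imaginary point \<open>h\<close> is real and nonzero, so the sign of
  \<open>Re h\<close> is constant nearby and selects a principal root away from its cut.\<close>

lemma sqrt_analytic_on_axes:
  assumes W: "open W" "0 \<notin> W" "\<real> - {0} \<subseteq> W"
    and h: "h holomorphic_on W" "\<And>z. z \<in> W \<Longrightarrow> h z \<noteq> 0"
    and h_real: "\<And>z. z \<in> W \<Longrightarrow> Re z = 0 \<Longrightarrow> h z \<in> \<real>"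
  shows "\<exists>s. (\<forall>z. (s z)\<^sup>2 = h z) \<and> s analytic_on {z \<in> W. z\<^sup>2 \<in> \<real>}"
proof -
  have pos: "of_real x \<in> W" "- of_real x \<in> W" if "x > 0" for x
    using W(3) that by (auto simp: subset_iff)
  obtain U1 s1 where 1: "open U1" "\<And>x. x > 0 \<Longrightarrow> of_real x \<in> U1" "U1 \<subseteq> W" "\<And>z. z \<in> U1 \<Longrightarrow> \<bar>Im z\<bar> < Re z"
    "s1 holomorphic_on U1" "\<And>z. z \<in> U1 \<Longrightarrow> (s1 z)\<^sup>2 = h z"
    using holomorphic_sqrt_near_half_line[OF W(1,2) pos(1) h] by blast
  \<comment> \<open>The negative half-line is treated by reflection
    \<open>z \<mapsto> - z\<close>.\<close>
  have neg: "open (uminus ` W)" "0 \<notin> uminus ` W" "\<And>x. x > 0 \<Longrightarrow> of_real x \<in> uminus ` W"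
    using W(1,2) pos(2) by (auto simp: open_negations image_iff) (metis minus_minus)
  have neg_h: "(\<lambda>z. h (- z)) holomorphic_on uminus ` W" "\<And>z. z \<in> uminus ` W \<Longrightarrow> h (- z) \<noteq> 0"
    using h by (auto intro!: holomorphic_on_compose_gen[of uminus _ h, unfolded o_def] holomorphic_intros)
  obtain U2 s2 where 2: "open U2" "\<And>x. x > 0 \<Longrightarrow> of_real x \<in> U2" "U2 \<subseteq> uminus ` W" "\<And>z. z \<in> U2 \<Longrightarrow> \<bar>Im z\<bar> < Re z"
    "s2 holomorphic_on U2" "\<And>z. z \<in> U2 \<Longrightarrow> (s2 z)\<^sup>2 = h (- z)"
    using holomorphic_sqrt_near_half_line[OF neg neg_h] by blast
  \<comment> \<open>The last two branches are needed near the imaginary axis; together they give a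
    square root at every remaining point, whether or not it is analytic there.\<close>
  define s where "s z = (if z \<in> U1 then s1 z else if - z \<in> U2 then s2 (- z)
    else if Re (h z) \<ge> 0 then csqrt (h z) else \<i> * csqrt (- h z))" for z
  have sq: "(s z)\<^sup>2 = h z" for z
    using 1(6)[of z] 2(6)[of "- z"] by (auto simp: s_def power_mult_distrib)
  have "s analytic_on {z}" if z: "z \<in> W" "z\<^sup>2 \<in> \<real>" for z
  proof -
    have "Re z = 0 \<or> Im z = 0" using z(2) by (auto simp: complex_is_Real_iff power2_eq_square)
    moreover have "z \<noteq> 0" using z(1) W(2) by auto
    ultimately consider "Re z > 0" "Im z = 0" | "Re z < 0" "Im z = 0" | "Re z = 0" "Im z \<noteq> 0"
      by (auto simp: complex_eq_iff) linarith
    then show ?thesis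
    proof cases
      case 1
      then have "z = of_real (Re z)" by (simp add: complex_eq_iff)
      then have "z \<in> U1" using \<open>\<And>x. x > 0 \<Longrightarrow> of_real x \<in> U1\<close> \<open>Re z > 0\<close> by metis
      moreover have "s holomorphic_on U1"
        using \<open>s1 holomorphic_on U1\<close> by (rule holomorphic_transform) (simp add: s_def)
      ultimately show ?thesis using \<open>open U1\<close> analytic_at by blast
    next
      case 2
      then have "- z = of_real (- Re z)" by (simp add: complex_eq_iff)
      moreover have "- Re z > 0" using 2 by simp
      ultimately have "- z \<in> U2" using \<open>\<And>x. x > 0 \<Longrightarrow> of_real x \<in> U2\<close> by metis
      then have "z \<in> uminus ` U2" by (metis image_eqI minus_minus)
      moreover have "s holomorphic_on uminus ` U2"
      proof (rule holomorphic_transform)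
        show "(\<lambda>z. s2 (- z)) holomorphic_on uminus ` U2"
          using \<open>s2 holomorphic_on U2\<close>
          by (intro holomorphic_on_compose_gen[of uminus _ s2, unfolded o_def]) (auto intro!: holomorphic_intros)
        fix y assume y: "y \<in> uminus ` U2"
        then have "- y \<in> U2" by auto
        moreover have "y \<notin> U1" using \<open>\<And>z. z \<in> U1 \<Longrightarrow> \<bar>Im z\<bar> < Re z\<close>[of y] \<open>\<And>z. z \<in> U2 \<Longrightarrow> \<bar>Im z\<bar> < Re z\<close>[of "- y"] \<open>- y \<in> U2\<close>
          by auto
        ultimately show "s2 (- y) = s y" by (simp add: s_def)
      qed
      ultimately show ?thesis using \<open>open U2\<close> analytic_at open_negations by blast
    next
      case 3
      have "h z \<in> \<real>" "h z \<noteq> 0" using h_real h(2) z(1) 3 by auto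
      then have Re_h: "Re (h z) \<noteq> 0" by (auto simp: complex_is_Real_iff complex_eq_iff)
      \<comment> \<open>On \<open>V\<close> both sector branches of \<open>s\<close> are switched
        off.\<close>
      define V where "V = {y \<in> W. \<bar>Re y\<bar> < \<bar>Im y\<bar>}"
      have "V = W \<inter> {y. \<bar>Re y\<bar> < \<bar>Im y\<bar>}" by (auto simp: V_def)
      then have "open V" using W(1) by (simp add: open_Int open_Collect_less continuous_intros)
      have disj: "y \<notin> U1" "- y \<notin> U2" if "y \<in> V" for y
        using that 1(4)[of y] 2(4)[of "- y"] by (auto simp: V_def)
      have hV: "h holomorphic_on V" using h(1) by (rule holomorphic_on_subset) (auto simp: V_def)
      have contV: "continuous_on V (\<lambda>y. Re (h y))"
        using hV by (intro continuous_intros holomorphic_on_imp_continuous_on)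
      have zV: "z \<in> V" using z 3 by (simp add: V_def)
      show ?thesis
      proof (cases "Re (h z) > 0")
        case True
        define V' where "V' = V \<inter> (\<lambda>y. Re (h y)) -` {0<..}"
        have "open V'" unfolding V'_def using continuous_open_preimage[OF contV \<open>open V\<close>] by simp
        moreover have "z \<in> V'" using zV True by (simp add: V'_def)
        moreover have "s holomorphic_on V'"
        proof (rule holomorphic_transform)
          show "(\<lambda>y. csqrt (h y)) holomorphic_on V'"
            using hV by (intro holomorphic_intros) (auto simp: V'_def complex_nonpos_Reals_iff elim: holomorphic_on_subset)
        qed (use disj in \<open>auto simp: V'_def s_def\<close>)
        ultimately show ?thesis using analytic_at by blast
      next
        case False
        define V' where "V' = V \<inter> (\<lambda>y. Re (h y)) -` {..<0}"
        have "open V'" unfolding V'_def using continuous_open_preimage[OF contV \<open>open V\<close>] by simp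
        moreover have "z \<in> V'" using zV False Re_h by (simp add: V'_def)
        moreover have "s holomorphic_on V'"
        proof (rule holomorphic_transform)
          show "(\<lambda>y. \<i> * csqrt (- h y)) holomorphic_on V'"
            using hV by (intro holomorphic_intros) (auto simp: V'_def complex_nonpos_Reals_iff elim: holomorphic_on_subset)
        qed (use disj in \<open>auto simp: V'_def s_def\<close>)
        ultimately show ?thesis using analytic_at by blast
      qed
    qed
  qed
  then have "s analytic_on {z \<in> W. z\<^sup>2 \<in> \<real>}"
    by (subst analytic_on_analytic_at) auto
  then show ?thesis using sq by blast
qed

section \<open>Waves on the edges\<close>

lemma vector_2_mult_iff:
  fixes t :: "complex^2^2"
  shows "(vector [a, a'] :: complex^2) = t *v vector [b', b] \<longleftrightarrow>
    a = t $ 1 $ 1 * b' + t $ 1 $ 2 * b \<and> a' = t $ 2 $ 1 * b' + t $ 2 $ 2 * b"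
  by (simp add: vec_eq_iff forall_2 matrix_vector_mult_def sum_2)

context schroedinger_graph
begin

sublocale edge: potential_interval "L d" "w d" for d
  by unfold_locales (rule length_pos potential_continuous)+

lemma arev_ne [simp]: "arev d \<noteq> d"
  using arev_neq[of d] by (simp add: arcs_UNIV)

lemma tail_arev_eq [simp]: "tail G (arev d) = head G d" and head_arev_eq [simp]: "head G (arev d) = tail G d"
  by (simp_all add: arcs_UNIV)

lemma edge_end: "L d \<in> {0..L d}" and edge_start: "0 \<in> {0..L d}"
  using length_pos[of d] by auto

lemma sol_reverse:
  assumes "edge.sol d \<mu> f f'"
  shows "edge.sol (arev d) \<mu> (\<lambda>x. f (L d - x)) (\<lambda>x. - f' (L d - x))"
  unfolding edge.sol_def unfolding length_arev
proof (intro ballI conjI)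
  fix x assume x: "x \<in> {0..L d}"
  have lin: "((\<lambda>x. L d - x) has_vector_derivative - 1) (at x within {0..L d})"
    by (auto intro!: derivative_eq_intros)
  have img: "(\<lambda>x. L d - x) ` {0..L d} = {0..L d}"
    using image_diff_atLeastAtMost[of "L d" 0 "L d"] by simp
  have y: "L d - x \<in> {0..L d}" using x by auto
  have d1: "(f has_vector_derivative f' (L d - x)) (at (L d - x) within {0..L d})"
    and d2: "(f' has_vector_derivative (of_real (w d (L d - x)) - \<mu>) * f (L d - x)) (at (L d - x) within {0..L d})"
    using assms y by (auto simp: edge.sol_def)
  show "((\<lambda>x. f (L d - x)) has_vector_derivative - f' (L d - x)) (at x within {0..L d})"
    using vector_diff_chain_within[OF lin, unfolded img, OF d1] by (simp add: o_def)
  have "w (arev d) x = w d (L d - x)"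
    using potential_arev[OF y] by simp
  then show "((\<lambda>x. - f' (L d - x)) has_vector_derivative (of_real (w (arev d) x) - \<mu>) * f (L d - x)) (at x within {0..L d})"
    using has_vector_derivative_minus[OF vector_diff_chain_within[OF lin, unfolded img, OF d2]] by (simp add: o_def)
qed

section \<open>End values of the fundamental system and reversal of edges\<close>

definition cs_end where "cs_end d \<mu> = edge.cs d \<mu> (L d)"
definition cs'_end where "cs'_end d \<mu> = edge.cs' d \<mu> (L d)"
definition sn_end where "sn_end d \<mu> = edge.sn d \<mu> (L d)"
definition sn'_end where "sn'_end d \<mu> = edge.sn' d \<mu> (L d)"

lemma wronskian_end: "cs_end d \<mu> * sn'_end d \<mu> - cs'_end d \<mu> * sn_end d \<mu> = 1"
  using edge.wronskian[OF edge_end] by (simp add: cs_end_def cs'_end_def sn_end_def sn'_end_def)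

lemma end_holomorphic:
  "cs_end d holomorphic_on A" "cs'_end d holomorphic_on A" "sn_end d holomorphic_on A" "sn'_end d holomorphic_on A"
  using edge.cs_sn_holomorphic by (simp_all add: cs_end_def[abs_def] cs'_end_def[abs_def] sn_end_def[abs_def] sn'_end_def[abs_def])

lemma end_real:
  assumes "\<mu> \<in> \<real>"
  shows "cs_end d \<mu> \<in> \<real>" "cs'_end d \<mu> \<in> \<real>" "sn_end d \<mu> \<in> \<real>" "sn'_end d \<mu> \<in> \<real>"
  using edge.cs_sn_real[OF edge_end assms] by (simp_all add: cs_end_def cs'_end_def sn_end_def sn'_end_def)

lemma end_cnj:
  "cs_end d (cnj \<mu>) = cnj (cs_end d \<mu>)" "cs'_end d (cnj \<mu>) = cnj (cs'_end d \<mu>)"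
  "sn_end d (cnj \<mu>) = cnj (sn_end d \<mu>)" "sn'_end d (cnj \<mu>) = cnj (sn'_end d \<mu>)"
  using edge.cs_sn_cnj[OF edge_end] by (simp_all add: cs_end_def cs'_end_def sn_end_def sn'_end_def)

lemma sol_end:
  assumes "edge.sol d \<mu> f f'"
  shows "f (L d) = cs_end d \<mu> * f 0 + sn_end d \<mu> * f' 0" "f' (L d) = cs'_end d \<mu> * f 0 + sn'_end d \<mu> * f' 0"
  using edge.sol_repr[OF assms edge_end] by (simp_all add: cs_end_def cs'_end_def sn_end_def sn'_end_def mult.commute)

text \<open>Reversal replaces the transfer matrix by its inverse, conjugated with the sign change of
  the derivative. Because the determinant is 1, this only exchanges the diagonal entries. The four
  equations come from reading \<open>cs\<close> and \<open>sn\<close> backwards.\<close>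

lemma end_arev:
  "cs_end (arev d) \<mu> = sn'_end d \<mu>" "cs'_end (arev d) \<mu> = cs'_end d \<mu>"
  "sn_end (arev d) \<mu> = sn_end d \<mu>" "sn'_end (arev d) \<mu> = cs_end d \<mu>"
proof -
  note [simp] = length_arev cs_end_def[symmetric] cs'_end_def[symmetric] sn_end_def[symmetric] sn'_end_def[symmetric]
  have eqs: "1 = cs_end (arev d) \<mu> * cs_end d \<mu> - sn_end (arev d) \<mu> * cs'_end d \<mu>"
    "0 = cs'_end (arev d) \<mu> * cs_end d \<mu> - sn'_end (arev d) \<mu> * cs'_end d \<mu>"
    "0 = cs_end (arev d) \<mu> * sn_end d \<mu> - sn_end (arev d) \<mu> * sn'_end d \<mu>"
    "- 1 = cs'_end (arev d) \<mu> * sn_end d \<mu> - sn'_end (arev d) \<mu> * sn'_end d \<mu>"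
    using sol_end[OF sol_reverse[OF edge.sol_cs[of d \<mu>]]] sol_end[OF sol_reverse[OF edge.sol_sn[of d \<mu>]]]
    by simp_all
  note W = wronskian_end[of d \<mu>]
  show "cs_end (arev d) \<mu> = sn'_end d \<mu>" "cs'_end (arev d) \<mu> = cs'_end d \<mu>"
    "sn_end (arev d) \<mu> = sn_end d \<mu>" "sn'_end (arev d) \<mu> = cs_end d \<mu>"
    using W eqs by algebra+
qed

text \<open>\<open>p d\<close> and \<open>q d\<close> are the value and the outgoing derivative at
  the tail of \<open>d\<close>. The condition says that the solutions with these data on
  \<open>d\<close> and \<open>arev d\<close> are one function read from both ends; the sign comes
  from the opposite orientation.\<close>

definition edge_compat :: "complex \<Rightarrow> ('d \<Rightarrow> complex) \<Rightarrow> ('d \<Rightarrow> complex) \<Rightarrow> bool" where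
  "edge_compat \<mu> p q \<longleftrightarrow> (\<forall>d. p (arev d) = cs_end d \<mu> * p d + sn_end d \<mu> * q d \<and>
     - q (arev d) = cs'_end d \<mu> * p d + sn'_end d \<mu> * q d)"

text \<open>By uniqueness for the initial value problem, two solutions agree on the edge as soon as
  their values and derivatives agree at the end where the reversed edge begins.\<close>

lemma sol_matches_reverse_iff:
  assumes f: "edge.sol d \<mu> f f'" and g: "edge.sol (arev d) \<mu> g g'"
  shows "(\<forall>x\<in>{0..L d}. f x = g (L d - x)) \<longleftrightarrow>
    g 0 = cs_end d \<mu> * f 0 + sn_end d \<mu> * f' 0 \<and> - g' 0 = cs'_end d \<mu> * f 0 + sn'_end d \<mu> * f' 0"
proof
  assume eq: "\<forall>x\<in>{0..L d}. f x = g (L d - x)"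
  have r: "edge.sol d \<mu> (\<lambda>x. g (L d - x)) (\<lambda>x. - g' (L d - x))"
    using sol_reverse[OF g] by (simp add: length_arev)
  have "f (L d) = g 0" using eq edge_end by auto
  moreover have "f' (L d) = - g' 0"
    using edge.sol_derivative_unique[OF f r _ edge_end] eq by auto
  ultimately show "g 0 = cs_end d \<mu> * f 0 + sn_end d \<mu> * f' 0 \<and> - g' 0 = cs'_end d \<mu> * f 0 + sn'_end d \<mu> * f' 0"
    using sol_end[OF f] by simp
next
  assume "g 0 = cs_end d \<mu> * f 0 + sn_end d \<mu> * f' 0 \<and> - g' 0 = cs'_end d \<mu> * f 0 + sn'_end d \<mu> * f' 0"
  then have init: "g 0 = f (L d)" "- g' 0 = f' (L d)"
    using sol_end[OF f] by simp_all
  show "\<forall>x\<in>{0..L d}. f x = g (L d - x)"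
  proof
    fix x assume "x \<in> {0..L d}"
    then have y: "L d - x \<in> {0..L (arev d)}" by (simp add: length_arev)
    have "g (L d - x) = g 0 * edge.cs (arev d) \<mu> (L d - x) + g' 0 * edge.sn (arev d) \<mu> (L d - x)"
      by (rule edge.sol_repr(1)[OF g y])
    moreover have "f (L d - (L d - x)) =
        f (L d - 0) * edge.cs (arev d) \<mu> (L d - x) + - f' (L d - 0) * edge.sn (arev d) \<mu> (L d - x)"
      by (rule edge.sol_repr(1)[OF sol_reverse[OF f] y])
    moreover have "g' 0 = - f' (L d)" using init(2) by (metis minus_minus)
    ultimately have "g (L d - x) = f (L d - (L d - x))" using init(1) by simp
    then show "f x = g (L d - x)" by simp
  qed
qed

text \<open>Shows that the definite description is well defined: existence comes from the
  fundamental system, uniqueness from \<open>sol_repr\<close>.\<close>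

lemma edge_solution_eq:
  "edge_solution k c d = (\<lambda>x. if x \<in> {0..L d} then edge.cs d (k\<^sup>2) x + c * edge.sn d (k\<^sup>2) x else 0)" (is "_ = ?F")
  unfolding edge_solution_def
proof (rule the_equality)
  let ?F' = "\<lambda>x. edge.cs' d (k\<^sup>2) x + c * edge.sn' d (k\<^sup>2) x"
  have s: "edge.sol d (k\<^sup>2) (\<lambda>x. edge.cs d (k\<^sup>2) x + c * edge.sn d (k\<^sup>2) x) ?F'"
    using edge.sol_lincomb[OF edge.sol_cs edge.sol_sn, of d "k\<^sup>2" 1 c] by simp
  have "(?F has_vector_derivative ?F' x) (at x within {0..L d}) \<and>
      (?F' has_vector_derivative (of_real (w d x) - k\<^sup>2) * ?F x) (at x within {0..L d})" if x: "x \<in> {0..L d}" for x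
  proof
    have d: "((\<lambda>x. edge.cs d (k\<^sup>2) x + c * edge.sn d (k\<^sup>2) x) has_vector_derivative ?F' x) (at x within {0..L d})"
      "(?F' has_vector_derivative (of_real (w d x) - k\<^sup>2) * (edge.cs d (k\<^sup>2) x + c * edge.sn d (k\<^sup>2) x)) (at x within {0..L d})"
      using s x unfolding edge.sol_def by blast+
    show "(?F has_vector_derivative ?F' x) (at x within {0..L d})"
      by (rule has_vector_derivative_transform[OF x _ d(1)]) simp
    show "(?F' has_vector_derivative (of_real (w d x) - k\<^sup>2) * ?F x) (at x within {0..L d})"
      using d(2) x by simp
  qed
  moreover have "?F 0 = 1" "?F' 0 = c" using length_pos[of d] by simp_all
  ultimately show "(\<forall>x. x \<notin> {0..L d} \<longrightarrow> ?F x = 0) \<and> ?F 0 = 1 \<and>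
     (\<exists>f' f''. f' 0 = c \<and> (\<forall>x\<in>{0..L d}. (?F has_vector_derivative f' x) (at x within {0..L d}) \<and>
        (f' has_vector_derivative f'' x) (at x within {0..L d}) \<and>
        - f'' x + of_real (w d x) * ?F x = k\<^sup>2 * ?F x))"
    by (intro conjI exI[of _ ?F'] exI[of _ "\<lambda>x. (of_real (w d x) - k\<^sup>2) * ?F x"]) (auto simp: algebra_simps)
next
  fix f
  assume f: "(\<forall>x. x \<notin> {0..L d} \<longrightarrow> f x = 0) \<and> f 0 = 1 \<and>
     (\<exists>f' f''. f' 0 = c \<and> (\<forall>x\<in>{0..L d}. (f has_vector_derivative f' x) (at x within {0..L d}) \<and>
        (f' has_vector_derivative f'' x) (at x within {0..L d}) \<and>
        - f'' x + of_real (w d x) * f x = k\<^sup>2 * f x))"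
  then obtain f' f'' where f': "f' 0 = c"
    and der: "\<And>x. x \<in> {0..L d} \<Longrightarrow> (f has_vector_derivative f' x) (at x within {0..L d}) \<and>
        (f' has_vector_derivative f'' x) (at x within {0..L d}) \<and>
        - f'' x + of_real (w d x) * f x = k\<^sup>2 * f x" by blast
  have "edge.sol d (k\<^sup>2) f f'"
    unfolding edge.sol_def
  proof (intro ballI conjI)
    fix x assume x: "x \<in> {0..L d}"
    have "f'' x = (of_real (w d x) - k\<^sup>2) * f x"
      using der[OF x] by (simp add: algebra_simps)
    then show "(f has_vector_derivative f' x) (at x within {0..L d})"
      "(f' has_vector_derivative (of_real (w d x) - k\<^sup>2) * f x) (at x within {0..L d})"
      using der[OF x] by simp_all
  qed
  from edge.sol_repr(1)[OF this] show "f = ?F"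
    using f f' by (auto simp: fun_eq_iff)
qed

section \<open>Amplitudes and poles of the edge transition matrix\<close>

text \<open>These coefficients come from solving the edge equation for \<open>b\<close> and \<open>a\<close> at the far end, see
  \<open>amplitudes_iff\<close>. A zero of \<open>edge_den\<close> is a pole of the edge transition matrix.\<close>

definition edge_den :: "'d \<Rightarrow> complex \<Rightarrow> complex" where
  "edge_den d k = cs_end d (k\<^sup>2) + sn'_end d (k\<^sup>2) - \<i> * k * sn_end d (k\<^sup>2) - cs'_end d (k\<^sup>2) / (\<i> * k)"

definition edge_num :: "'d \<Rightarrow> complex \<Rightarrow> complex" where
  "edge_num d k = cs_end d (k\<^sup>2) - sn'_end d (k\<^sup>2) - \<i> * k * sn_end d (k\<^sup>2) + cs'_end d (k\<^sup>2) / (\<i> * k)"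

lemma edge_den_arev: "edge_den (arev d) k = edge_den d k"
  by (simp add: edge_den_def end_arev)

text \<open>The Wronskian relation in amplitude coordinates. In view of
  \<open>is_edge_transition_iff\<close> it says that the edge transition matrix has determinant
  \<open>edge_den d (- k) / edge_den d k\<close>, so zeros of this determinant are reflected
  poles.\<close>

lemma edge_den_num:
  assumes "k \<noteq> 0"
  shows "edge_den d k * edge_den d (- k) + edge_num d k * edge_num (arev d) k = 4"
proof -
  define \<beta> where "\<beta> = cs'_end d (k\<^sup>2) / (\<i> * k)"
  have "\<beta> * (\<i> * k) = cs'_end d (k\<^sup>2)" using assms by (simp add: \<beta>_def)
  moreover note wronskian_end[of d "k\<^sup>2"]
  moreover have "edge_den d k * edge_den d (- k) + edge_num d k * edge_num (arev d) k =
      4 * (cs_end d (k\<^sup>2) * sn'_end d (k\<^sup>2) - (\<beta> * (\<i> * k)) * sn_end d (k\<^sup>2))"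
  proof -
    have e: "edge_den d k = cs_end d (k\<^sup>2) + sn'_end d (k\<^sup>2) - \<i> * k * sn_end d (k\<^sup>2) - \<beta>"
    "edge_den d (- k) = cs_end d (k\<^sup>2) + sn'_end d (k\<^sup>2) + \<i> * k * sn_end d (k\<^sup>2) + \<beta>"
    "edge_num d k = cs_end d (k\<^sup>2) - sn'_end d (k\<^sup>2) - \<i> * k * sn_end d (k\<^sup>2) + \<beta>"
    "edge_num (arev d) k = sn'_end d (k\<^sup>2) - cs_end d (k\<^sup>2) - \<i> * k * sn_end d (k\<^sup>2) + \<beta>"
    by (simp_all add: edge_den_def edge_num_def end_arev \<beta>_def)
    show ?thesis unfolding e by (simp add: algebra_simps)
  qed
  ultimately show ?thesis by simp
qed

text \<open>The amplitudes \<open>a\<close>, \<open>b\<close> mean the value \<open>a + b\<close>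
  and the slope \<open>\<i> * k * (b - a)\<close>, since \<open>psi_plus\<close> has the slope
  \<open>- \<i> * k\<close>. Dividing the derivative equation by \<open>\<i> * k\<close>, then
  adding and subtracting, isolates \<open>a'\<close> and \<open>b'\<close>.\<close>

lemma amplitudes_iff:
  assumes "k \<noteq> 0"
  shows "(a' + b' = cs_end d (k\<^sup>2) * (a + b) + sn_end d (k\<^sup>2) * (\<i> * k * (b - a)) \<and>
      - (\<i> * k * (b' - a')) = cs'_end d (k\<^sup>2) * (a + b) + sn'_end d (k\<^sup>2) * (\<i> * k * (b - a))) \<longleftrightarrow>
    (2 * b' = edge_den d k * a - edge_num (arev d) k * b \<and> 2 * a' = edge_num d k * a + edge_den d (- k) * b)"
proof -
  define \<beta> where "\<beta> = cs'_end d (k\<^sup>2) / (\<i> * k)"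
  have \<beta>: "cs'_end d (k\<^sup>2) = \<beta> * (\<i> * k)" using assms by (simp add: \<beta>_def)
  have e: "edge_den d k = cs_end d (k\<^sup>2) + sn'_end d (k\<^sup>2) - \<i> * k * sn_end d (k\<^sup>2) - \<beta>"
    "edge_den d (- k) = cs_end d (k\<^sup>2) + sn'_end d (k\<^sup>2) + \<i> * k * sn_end d (k\<^sup>2) + \<beta>"
    "edge_num d k = cs_end d (k\<^sup>2) - sn'_end d (k\<^sup>2) - \<i> * k * sn_end d (k\<^sup>2) + \<beta>"
    "edge_num (arev d) k = sn'_end d (k\<^sup>2) - cs_end d (k\<^sup>2) - \<i> * k * sn_end d (k\<^sup>2) + \<beta>"
    by (simp_all add: edge_den_def edge_num_def end_arev \<beta>_def)
  have "- (\<i> * k * (b' - a')) = cs'_end d (k\<^sup>2) * (a + b) + sn'_end d (k\<^sup>2) * (\<i> * k * (b - a)) \<longleftrightarrow>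
      \<i> * k * (a' - b') = \<i> * k * (\<beta> * (a + b) + sn'_end d (k\<^sup>2) * (b - a))"
    unfolding \<beta> by (simp add: algebra_simps)
  also have "\<dots> \<longleftrightarrow> a' - b' = \<beta> * (a + b) + sn'_end d (k\<^sup>2) * (b - a)"
    using assms by simp
  finally have 1: "- (\<i> * k * (b' - a')) = cs'_end d (k\<^sup>2) * (a + b) + sn'_end d (k\<^sup>2) * (\<i> * k * (b - a)) \<longleftrightarrow>
      a' - b' = \<beta> * (a + b) + sn'_end d (k\<^sup>2) * (b - a)" .
  have lin: "x + y = s \<and> x - y = t \<longleftrightarrow> 2 * y = s - t \<and> 2 * x = s + t" for x y s t :: complex
  proof
    assume "x + y = s \<and> x - y = t"
    then have "s = x + y" "t = x - y" by auto
    then show "2 * y = s - t \<and> 2 * x = s + t" by simp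
  next
    assume "2 * y = s - t \<and> 2 * x = s + t"
    then have "2 * (x + y) = 2 * s" "2 * (x - y) = 2 * t" by algebra+
    then show "x + y = s \<and> x - y = t" by (simp only: mult_cancel_left) simp
  qed
  show ?thesis
    unfolding 1 lin e by (simp add: algebra_simps)
qed

lemma edge_equation_iff:
  assumes "k \<noteq> 0"
  shows "(\<forall>x\<in>{0..L d}. a * psi_plus k d x + b * psi_minus k d x =
      a' * psi_plus k (arev d) (L d - x) + b' * psi_minus k (arev d) (L d - x)) \<longleftrightarrow>
    2 * b' = edge_den d k * a - edge_num (arev d) k * b \<and> 2 * a' = edge_num d k * a + edge_den d (- k) * b"
proof -
  define F where "F d a b = (\<lambda>x. (a + b) * edge.cs d (k\<^sup>2) x + \<i> * k * (b - a) * edge.sn d (k\<^sup>2) x)" for d and a b :: complex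
  define F' where "F' d a b = (\<lambda>x. (a + b) * edge.cs' d (k\<^sup>2) x + \<i> * k * (b - a) * edge.sn' d (k\<^sup>2) x)" for d and a b :: complex
  have sol: "edge.sol d (k\<^sup>2) (F d a b) (F' d a b)" for d a b
    unfolding F_def F'_def by (rule edge.sol_lincomb[OF edge.sol_cs edge.sol_sn])
  have init: "F d a b 0 = a + b" "F' d a b 0 = \<i> * k * (b - a)" for d a b
    by (simp_all add: F_def F'_def)
  have psi: "a * psi_plus k d x + b * psi_minus k d x = F d a b x" if "x \<in> {0..L d}" for d a b x
    using that by (simp add: psi_plus_def psi_minus_def edge_solution_eq F_def algebra_simps)
  have "(\<forall>x\<in>{0..L d}. a * psi_plus k d x + b * psi_minus k d x =
      a' * psi_plus k (arev d) (L d - x) + b' * psi_minus k (arev d) (L d - x)) \<longleftrightarrow>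
    (\<forall>x\<in>{0..L d}. F d a b x = F (arev d) a' b' (L d - x))"
  proof (rule ball_cong[OF refl])
    fix x assume "x \<in> {0..L d}"
    then have "x \<in> {0..L d}" "L d - x \<in> {0..L (arev d)}" by (auto simp: length_arev)
    then show "(a * psi_plus k d x + b * psi_minus k d x =
      a' * psi_plus k (arev d) (L d - x) + b' * psi_minus k (arev d) (L d - x)) \<longleftrightarrow>
      F d a b x = F (arev d) a' b' (L d - x)"
      using psi by simp
  qed
  also have "\<dots> \<longleftrightarrow> a' + b' = cs_end d (k\<^sup>2) * (a + b) + sn_end d (k\<^sup>2) * (\<i> * k * (b - a)) \<and>
      - (\<i> * k * (b' - a')) = cs'_end d (k\<^sup>2) * (a + b) + sn'_end d (k\<^sup>2) * (\<i> * k * (b - a))"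
    using sol_matches_reverse_iff[OF sol sol, of d a b a' b'] unfolding init .
  also note amplitudes_iff[OF assms]
  finally show ?thesis .
qed

lemma is_edge_transition_iff:
  assumes "k \<noteq> 0" "edge_den d k \<noteq> 0"
  shows "is_edge_transition k d t \<longleftrightarrow> t $ 1 $ 1 = 2 / edge_den d k \<and> t $ 1 $ 2 = edge_num (arev d) k / edge_den d k \<and>
    t $ 2 $ 1 = edge_num d k / edge_den d k \<and> t $ 2 $ 2 = 2 / edge_den d k"
proof
  assume t: "is_edge_transition k d t"
  have eq: "a = t $ 1 $ 1 * b' + t $ 1 $ 2 * b \<and> a' = t $ 2 $ 1 * b' + t $ 2 $ 2 * b"
    if "2 * b' = edge_den d k * a - edge_num (arev d) k * b" "2 * a' = edge_num d k * a + edge_den d (- k) * b" for a b a' b'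
    using t that unfolding is_edge_transition_def edge_equation_iff[OF assms(1)] vector_2_mult_iff by blast
  \<comment> \<open>The columns of \<open>t\<close> are read off from the waves with
    \<open>(b', b)\<close> equal to \<open>(0, 1)\<close> and \<open>(1, 0)\<close>. That the first
    of these solves the edge equation is \<open>edge_den_num\<close>.\<close>
  have "2 * (2 / edge_den d k) = edge_num d k * (edge_num (arev d) k / edge_den d k) + edge_den d (- k) * 1"
    using edge_den_num[OF assms(1), of d] assms(2) by (simp add: field_simps)
  then have e2: "edge_num (arev d) k / edge_den d k = t $ 1 $ 1 * 0 + t $ 1 $ 2 * 1 \<and> 2 / edge_den d k = t $ 2 $ 1 * 0 + t $ 2 $ 2 * 1"
    using assms(2) by (intro eq) simp_all
  have e1: "2 / edge_den d k = t $ 1 $ 1 * 1 + t $ 1 $ 2 * 0 \<and> edge_num d k / edge_den d k = t $ 2 $ 1 * 1 + t $ 2 $ 2 * 0"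
    using assms(2) by (intro eq) simp_all
  show "t $ 1 $ 1 = 2 / edge_den d k \<and> t $ 1 $ 2 = edge_num (arev d) k / edge_den d k \<and>
    t $ 2 $ 1 = edge_num d k / edge_den d k \<and> t $ 2 $ 2 = 2 / edge_den d k"
    using e1 e2 by simp
next
  assume t: "t $ 1 $ 1 = 2 / edge_den d k \<and> t $ 1 $ 2 = edge_num (arev d) k / edge_den d k \<and>
    t $ 2 $ 1 = edge_num d k / edge_den d k \<and> t $ 2 $ 2 = 2 / edge_den d k"
  show "is_edge_transition k d t"
    unfolding is_edge_transition_def edge_equation_iff[OF assms(1)] vector_2_mult_iff
  proof (intro allI impI)
    fix a b a' b'
    assume h: "2 * b' = edge_den d k * a - edge_num (arev d) k * b \<and> 2 * a' = edge_num d k * a + edge_den d (- k) * b"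
    have a: "edge_den d k * a = 2 * b' + edge_num (arev d) k * b" using h by simp
    have a2: "2 * a' = edge_num d k * a + edge_den d (- k) * b" using h by blast
    have "2 * (edge_den d k * a') = edge_den d k * (2 * a')"
      by (rule mult.left_commute)
    also have "\<dots> = edge_num d k * (edge_den d k * a) + edge_den d k * edge_den d (- k) * b"
      unfolding a2 by (simp add: algebra_simps)
    also have "\<dots> = 2 * (edge_num d k * b') + (edge_den d k * edge_den d (- k) + edge_num d k * edge_num (arev d) k) * b"
      unfolding a by (simp add: algebra_simps)
    finally have "2 * (edge_den d k * a') = 2 * (edge_num d k * b' + 2 * b)"
      unfolding edge_den_num[OF assms(1)] by simp
    then have "edge_den d k * a' = edge_num d k * b' + 2 * b"
      by (simp only: mult_cancel_left) simp
    then have "a' = (edge_num d k * b' + 2 * b) / edge_den d k"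
      using assms(2) by (simp add: nonzero_eq_divide_eq mult.commute)
    moreover have "a = (2 * b' + edge_num (arev d) k * b) / edge_den d k"
      using a assms(2) by (simp add: nonzero_eq_divide_eq mult.commute)
    ultimately show "a = t $ 1 $ 1 * b' + t $ 1 $ 2 * b \<and> a' = t $ 2 $ 1 * b' + t $ 2 $ 2 * b"
      using t by (simp add: add_divide_distrib)
  qed
qed

lemma ex1_edge_transition_iff:
  assumes "k \<noteq> 0"
  shows "(\<exists>!t. is_edge_transition k d t) \<longleftrightarrow> edge_den d k \<noteq> 0"
proof
  assume "\<exists>!t. is_edge_transition k d t"
  then obtain t where t: "is_edge_transition k d t" by blast
  show "edge_den d k \<noteq> 0"
  proof
    assume "edge_den d k = 0"
    \<comment> \<open>At a zero of \<open>edge_den\<close> the wave with \<open>a = 1\<close> and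
      \<open>b = 0\<close> also has \<open>b' = 0\<close>, so no matrix can produce
      \<open>a\<close>.\<close>
    then have "2 * 0 = edge_den d k * 1 - edge_num (arev d) k * 0 \<and>
        2 * (edge_num d k / 2) = edge_num d k * 1 + edge_den d (- k) * 0" by simp
    then have "(1::complex) = t $ 1 $ 1 * 0 + t $ 1 $ 2 * 0"
      using t unfolding is_edge_transition_def edge_equation_iff[OF assms] vector_2_mult_iff by blast
    then show False by simp
  qed
next
  assume D: "edge_den d k \<noteq> 0"
  show "\<exists>!t. is_edge_transition k d t"
  proof
    show "is_edge_transition k d (vector [vector [2 / edge_den d k, edge_num (arev d) k / edge_den d k],
        vector [edge_num d k / edge_den d k, 2 / edge_den d k]])"
      unfolding is_edge_transition_iff[OF assms D] by simp
  qed (auto simp: is_edge_transition_iff[OF assms D] vec_eq_iff forall_2)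
qed

lemma edge_transition_row:
  assumes "k \<noteq> 0" "edge_den d k \<noteq> 0"
  shows "edge_transition k d $ 2 $ 1 = edge_num d k / edge_den d k" "edge_transition k d $ 2 $ 2 = 2 / edge_den d k"
proof -
  have "is_edge_transition k d (edge_transition k d)"
    unfolding edge_transition_def by (rule theI'[OF ex1_edge_transition_iff[OF assms(1), THEN iffD2, OF assms(2)]])
  then show "edge_transition k d $ 2 $ 1 = edge_num d k / edge_den d k" "edge_transition k d $ 2 $ 2 = 2 / edge_den d k"
    unfolding is_edge_transition_iff[OF assms] by auto
qed

section \<open>Transition and scattering matrices away from the poles\<close>

definition regular_points :: "complex set" where
  "regular_points = {k. k \<noteq> 0 \<and> (\<forall>d. edge_den d k \<noteq> 0)}"

lemma scattering_domain_eq: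
  "scattering_domain - {0} = {k \<in> regular_points. det (graph_scattering k) \<noteq> 0}"
proof (rule set_eqI)
  fix k
  show "k \<in> scattering_domain - {0} \<longleftrightarrow> k \<in> {k \<in> regular_points. det (graph_scattering k) \<noteq> 0}"
    by (cases "k = 0") (simp_all add: scattering_domain_def regular_points_def ex1_edge_transition_iff)
qed

lemma transition_matrix_regular:
  assumes "k \<in> regular_points"
  shows "transition_matrix k $ d $ d' =
    (if d' = arev d then edge_num d k / edge_den d k else if d' = d then 2 / edge_den d k else 0)"
  using assms by (simp add: transition_matrix_def edge_transition_row regular_points_def)

lemma transition_matrix_apply:
  assumes "k \<in> regular_points"
  shows "(transition_matrix k *v b) $ d = (edge_num d k * b $ arev d + 2 * b $ d) / edge_den d k"
proof -
  have "(transition_matrix k *v b) $ d = (\<Sum>d'\<in>UNIV. (if d' = arev d then edge_num d k / edge_den d k * b $ arev d else 0) +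
      (if d' = d then 2 / edge_den d k * b $ d else 0))"
    unfolding matrix_vector_mult_def by (auto simp: transition_matrix_regular[OF assms] intro!: sum.cong)
  also have "\<dots> = edge_num d k / edge_den d k * b $ arev d + 2 / edge_den d k * b $ d"
    by (simp add: sum.distrib)
  finally show ?thesis by (simp add: add_divide_distrib)
qed

lemma edge_den_holomorphic:
  assumes "0 \<notin> A"
  shows "edge_den d holomorphic_on A" "edge_num d holomorphic_on A"
proof -
  have "(\<lambda>k. g (k\<^sup>2)) holomorphic_on A" if "g holomorphic_on UNIV" for g :: "complex \<Rightarrow> complex"
    using that by (intro holomorphic_on_compose_gen[of "\<lambda>k. k\<^sup>2" A g UNIV, unfolded o_def] holomorphic_intros) auto
  note h = this[OF end_holomorphic(1)] this[OF end_holomorphic(2)] this[OF end_holomorphic(3)] this[OF end_holomorphic(4)]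
  show "edge_den d holomorphic_on A" "edge_num d holomorphic_on A"
    unfolding edge_den_def[abs_def] edge_num_def[abs_def] using assms
    by (auto intro!: holomorphic_intros h)
qed

lemma open_regular_points: "open regular_points"
proof -
  have "open (- {0} \<inter> (edge_den d) -` (- {0}))" for d
    by (intro continuous_open_preimage holomorphic_on_imp_continuous_on edge_den_holomorphic) auto
  then have "open (- {0} \<inter> (\<Inter>d. - {0} \<inter> (edge_den d) -` (- {0})))"
    by (intro open_Int open_INT) auto
  also have "- {0} \<inter> (\<Inter>d. - {0} \<inter> (edge_den d) -` (- {0})) = regular_points"
    by (auto simp: regular_points_def)
  finally show ?thesis .
qed

lemma transition_matrix_holomorphic:
  "(\<lambda>k. transition_matrix k $ d $ d') holomorphic_on regular_points"
proof -
  have 0: "0 \<notin> regular_points" by (simp add: regular_points_def)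
  have "(\<lambda>k. if d' = arev d then edge_num d k / edge_den d k else if d' = d then 2 / edge_den d k else 0) holomorphic_on regular_points"
    using edge_den_holomorphic[OF 0, of d]
    by (cases "d' = arev d"; cases "d' = d") (auto intro!: holomorphic_intros simp: regular_points_def)
  then show ?thesis
    by (rule holomorphic_transform) (simp add: transition_matrix_regular)
qed

lemma graph_scattering_holomorphic:
  "(\<lambda>k. graph_scattering k $ i $ j) holomorphic_on regular_points"
  unfolding graph_scattering_def matrix_matrix_mult_def
  by (auto intro!: holomorphic_intros transition_matrix_holomorphic)

text \<open>For a vector \<open>b\<close> of amplitudes \<open>b\<^sub>d\<close>, \<open>in_amp k b d\<close> is the amplitude \<open>a\<^sub>d\<close>; the wave with these amplitudes
  takes the value \<open>wave_val k b d\<close> and has the derivative \<open>wave_slope k b d\<close> at the initial vertex of \<open>d\<close>.\<close>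

definition in_amp :: "complex \<Rightarrow> complex^'d \<Rightarrow> 'd \<Rightarrow> complex" where
  "in_amp k b d = (transition_matrix k *v b) $ arev d"

definition wave_val :: "complex \<Rightarrow> complex^'d \<Rightarrow> 'd \<Rightarrow> complex" where
  "wave_val k b d = in_amp k b d + b $ d"

definition wave_slope :: "complex \<Rightarrow> complex^'d \<Rightarrow> 'd \<Rightarrow> complex" where
  "wave_slope k b d = \<i> * k * (b $ d - in_amp k b d)"

lemma in_amp_eq:
  assumes "k \<in> regular_points"
  shows "edge_den d k * in_amp k b d = edge_num (arev d) k * b $ d + 2 * b $ arev d"
proof -
  have "edge_den d k \<noteq> 0" using assms by (simp add: regular_points_def)
  then show ?thesis
    by (simp add: in_amp_def transition_matrix_apply[OF assms] edge_den_arev)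
qed

text \<open>\<open>in_amp\<close> is made so that the equation for the amplitude \<open>b\<close> on
  the reversed edge holds; the equation for \<open>a\<close> then follows from
  \<open>edge_den_num\<close>. Thus every vector \<open>b\<close> gives a genuine wave on each edge,
  and only the vertex conditions remain.\<close>

lemma edge_compat_wave:
  assumes "k \<in> regular_points"
  shows "edge_compat (k\<^sup>2) (wave_val k b) (wave_slope k b)"
proof -
  have k: "k \<noteq> 0" and D: "\<And>d. edge_den d k \<noteq> 0" using assms by (auto simp: regular_points_def)
  have "wave_val k b (arev d) = cs_end d (k\<^sup>2) * wave_val k b d + sn_end d (k\<^sup>2) * wave_slope k b d \<and>
     - wave_slope k b (arev d) = cs'_end d (k\<^sup>2) * wave_val k b d + sn'_end d (k\<^sup>2) * wave_slope k b d" for d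
    unfolding wave_val_def wave_slope_def amplitudes_iff[OF k]
  proof
    have a: "edge_den d k * in_amp k b d = edge_num (arev d) k * b $ d + 2 * b $ arev d"
      and a': "edge_den d k * in_amp k b (arev d) = edge_num d k * b $ arev d + 2 * b $ d"
      using in_amp_eq[OF assms, of d b] in_amp_eq[OF assms, of "arev d" b] by (simp_all add: edge_den_arev)
    show "2 * b $ arev d = edge_den d k * in_amp k b d - edge_num (arev d) k * b $ d"
      using a by simp
    have "edge_den d k * (edge_num d k * in_amp k b d + edge_den d (- k) * b $ d) =
        edge_num d k * (edge_den d k * in_amp k b d) + edge_den d k * edge_den d (- k) * b $ d"
      by (simp add: algebra_simps)
    also have "\<dots> = 2 * (edge_num d k * b $ arev d) + (edge_den d k * edge_den d (- k) + edge_num d k * edge_num (arev d) k) * b $ d"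
      unfolding a by (simp add: algebra_simps)
    also have "\<dots> = edge_den d k * (2 * in_amp k b (arev d))"
      unfolding edge_den_num[OF k] using a' by (simp add: algebra_simps)
    finally show "2 * in_amp k b (arev d) = edge_num d k * in_amp k b d + edge_den d (- k) * b $ d"
      using D by simp
  qed
  then show ?thesis by (simp add: edge_compat_def)
qed

text \<open>The formula for \<open>b\<close> inverts \<open>p = a + b\<close>,
  \<open>q = \<i> * k * (b - a)\<close>. The remaining amplitude \<open>a\<close> must be
  \<open>in_amp\<close>, because \<open>edge_den\<close> does not vanish.\<close>

lemma edge_compat_imp_wave:
  assumes k: "k \<in> regular_points" and pq: "edge_compat (k\<^sup>2) p q"
  defines "b \<equiv> \<chi> d. (p d + q d / (\<i> * k)) / 2"
  shows "p = wave_val k b" "q = wave_slope k b"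
proof -
  have k0: "k \<noteq> 0" and D: "\<And>d. edge_den d k \<noteq> 0" using k by (auto simp: regular_points_def)
  define a where "a d = (p d - q d / (\<i> * k)) / 2" for d
  have p: "p d = a d + b $ d" for d by (simp add: a_def b_def field_simps)
  have q: "q d = \<i> * k * (b $ d - a d)" for d using k0 by (simp add: a_def b_def field_simps)
  have "in_amp k b d = a d" for d
  proof -
    have "a (arev d) + b $ arev d = cs_end d (k\<^sup>2) * (a d + b $ d) + sn_end d (k\<^sup>2) * (\<i> * k * (b $ d - a d)) \<and>
      - (\<i> * k * (b $ arev d - a (arev d))) = cs'_end d (k\<^sup>2) * (a d + b $ d) + sn'_end d (k\<^sup>2) * (\<i> * k * (b $ d - a d))"
      using pq unfolding edge_compat_def p q by blast
    then have "2 * b $ arev d = edge_den d k * a d - edge_num (arev d) k * b $ d"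
      unfolding amplitudes_iff[OF k0] by blast
    then have "edge_den d k * a d = edge_den d k * in_amp k b d"
      unfolding in_amp_eq[OF k] by simp
    then show ?thesis using D by simp
  qed
  then show "p = wave_val k b" "q = wave_slope k b"
    using p q by (auto simp: fun_eq_iff wave_val_def wave_slope_def)
qed

section \<open>The vertex scattering matrix and the vertex conditions\<close>

definition vertex_cond :: "('d \<Rightarrow> complex) \<Rightarrow> ('d \<Rightarrow> complex) \<Rightarrow> bool" where
  "vertex_cond p q \<longleftrightarrow> (\<forall>d d'. tail G d = tail G d' \<longrightarrow> p d = p d') \<and>
     (\<forall>v\<in>verts G. (\<Sum>d\<in>out_arcs G v. q d) = 0)"

lemma out_arcs_eq: "out_arcs G v = {d. tail G d = v}"
  by (auto simp: out_arcs_def arcs_UNIV)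

lemma out_degree_pos: "out_degree G (tail G d) > 0"
  unfolding out_degree_def out_arcs_eq by (auto simp: card_gt_0_iff)

lemma vertex_scattering_apply:
  "(vertex_scattering *v y) $ d = 2 / of_nat (out_degree G (tail G d)) * (\<Sum>e\<in>out_arcs G (tail G d). y $ arev e) - y $ arev d"
proof -
  define c :: complex where "c = 2 / of_nat (out_degree G (tail G d))"
  have "(vertex_scattering *v y) $ d = (\<Sum>d'\<in>UNIV. (if head G d' = tail G d then (if arev d = d' then - 1 else 0) + c else 0) * y $ d')"
    by (simp only: matrix_vector_mult_def vertex_scattering_def vec_lambda_beta c_def)
  \<comment> \<open>The arcs arriving at a vertex are the reversals of the arcs leaving it.\<close>
  also have "\<dots> = (\<Sum>e\<in>UNIV. (if head G (arev e) = tail G d then (if arev d = arev e then - 1 else 0) + c else 0) * y $ arev e)"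
    by (rule sum.reindex_bij_betw[OF bij_arev, symmetric])
  also have "\<dots> = (\<Sum>e\<in>UNIV. (if e \<in> out_arcs G (tail G d) then c * y $ arev e else 0) + (if e = d then - y $ arev d else 0))"
  proof (rule sum.cong)
    fix e
    have "arev d = arev e \<longleftrightarrow> e = d" by (metis arev_arev)
    then show "(if head G (arev e) = tail G d then (if arev d = arev e then - 1 else 0) + c else 0) * y $ arev e =
        (if e \<in> out_arcs G (tail G d) then c * y $ arev e else 0) + (if e = d then - y $ arev d else 0)"
      by (auto simp: out_arcs_eq algebra_simps)
  qed simp
  also have "\<dots> = (\<Sum>e\<in>out_arcs G (tail G d). c * y $ arev e) - y $ arev d"
    by (subst sum.distrib) (simp add: sum.If_cases out_arcs_eq arcs_UNIV)
  finally show ?thesis by (simp only: sum_distrib_left c_def)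
qed

text \<open>Entry \<open>arev d\<close> of \<open>T b\<close> is \<open>in_amp k b d\<close>, so the
  reflection part of the scattering matrix completes \<open>b $ d\<close> to the full value of the
  wave. What is subtracted depends on the vertex only. Since \<open>b\<close> is arbitrary, the
  formula also measures how far a wave is from satisfying the vertex conditions.\<close>

lemma residual:
  "((mat 1 - graph_scattering k) *v b) $ d =
    wave_val k b d - 2 / of_nat (out_degree G (tail G d)) * (\<Sum>e\<in>out_arcs G (tail G d). in_amp k b e)"
proof -
  have "(mat 1 - graph_scattering k) *v b = b - vertex_scattering *v (transition_matrix k *v b)"
    by (simp add: graph_scattering_def matrix_vector_mult_diff_rdistrib matrix_vector_mul_assoc)
  then show ?thesis
    by (simp add: vertex_scattering_apply wave_val_def in_amp_def)
qed

section \<open>Vertex conditions and Green's identity\<close>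

lemma sum_out_arcs:
  "(\<Sum>e\<in>out_arcs G v. wave_val k b e) = (\<Sum>e\<in>out_arcs G v. in_amp k b e) + (\<Sum>e\<in>out_arcs G v. b $ e)"
  "(\<Sum>e\<in>out_arcs G v. wave_slope k b e) = \<i> * k * ((\<Sum>e\<in>out_arcs G v. b $ e) - (\<Sum>e\<in>out_arcs G v. in_amp k b e))"
  by (simp_all only: wave_val_def wave_slope_def sum.distrib sum_subtractf sum_distrib_left[symmetric])

lemma vertex_condD:
  assumes "vertex_cond p q"
  shows "tail G d = tail G d' \<Longrightarrow> p d = p d'" and "v \<in> verts G \<Longrightarrow> (\<Sum>d\<in>out_arcs G v. q d) = 0"
  using assms unfolding vertex_cond_def by blast+

text \<open>Vanishing residual means that all values at a vertex equal twice the mean of the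
  amplitudes \<open>a\<close>. This is continuity, and summing it over the vertex gives equal sums
  of the \<open>a\<close> and the \<open>b\<close>, which is Kirchhoff's condition.\<close>

lemma kernel_iff_vertex_cond:
  assumes "k \<noteq> 0"
  shows "(mat 1 - graph_scattering k) *v b = 0 \<longleftrightarrow> vertex_cond (wave_val k b) (wave_slope k b)"
proof
  assume "(mat 1 - graph_scattering k) *v b = 0"
  then have res: "wave_val k b d = 2 / of_nat (out_degree G (tail G d)) * (\<Sum>e\<in>out_arcs G (tail G d). in_amp k b e)" for d
    using residual[of k b d] by simp
  have "(\<Sum>e\<in>out_arcs G v. wave_slope k b e) = 0" for v
  proof (cases "out_arcs G v = {}")
    case False
    then obtain d where d: "v = tail G d" by (auto simp: out_arcs_eq)
    have "(\<Sum>e\<in>out_arcs G v. wave_val k b e) =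
        (\<Sum>e\<in>out_arcs G v. 2 / of_nat (out_degree G v) * (\<Sum>e\<in>out_arcs G v. in_amp k b e))"
    proof (rule sum.cong[OF refl])
      fix e assume "e \<in> out_arcs G v"
      then have "tail G e = v" by (simp add: out_arcs_eq)
      then show "wave_val k b e = 2 / of_nat (out_degree G v) * (\<Sum>e\<in>out_arcs G v. in_amp k b e)"
        using res[of e] by simp
    qed
    also have "\<dots> = 2 * (\<Sum>e\<in>out_arcs G v. in_amp k b e)"
      using out_degree_pos[of d] unfolding d by (simp add: out_degree_def)
    finally have "(\<Sum>e\<in>out_arcs G v. b $ e) = (\<Sum>e\<in>out_arcs G v. in_amp k b e)"
      unfolding sum_out_arcs by simp
    then show ?thesis by (simp add: sum_out_arcs(2))
  qed simp
  moreover have "wave_val k b d = wave_val k b d'" if "tail G d = tail G d'" for d d'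
    using res[of d] res[of d'] that by simp
  ultimately show "vertex_cond (wave_val k b) (wave_slope k b)"
    unfolding vertex_cond_def by blast
next
  assume vc: "vertex_cond (wave_val k b) (wave_slope k b)"
  have "((mat 1 - graph_scattering k) *v b) $ d = 0" for d
  proof -
    let ?v = "tail G d"
    have "?v \<in> verts G" by (simp add: arcs_UNIV)
    then have "(\<Sum>e\<in>out_arcs G ?v. wave_slope k b e) = 0" by (rule vertex_condD(2)[OF vc])
    then have "(\<Sum>e\<in>out_arcs G ?v. b $ e) = (\<Sum>e\<in>out_arcs G ?v. in_amp k b e)"
      using assms by (simp add: sum_out_arcs(2))
    then have "2 * (\<Sum>e\<in>out_arcs G ?v. in_amp k b e) = (\<Sum>e\<in>out_arcs G ?v. wave_val k b e)"
      by (simp add: sum_out_arcs(1))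
    also have "\<dots> = (\<Sum>e\<in>out_arcs G ?v. wave_val k b d)"
      by (intro sum.cong refl vertex_condD(1)[OF vc]) (simp add: out_arcs_eq)
    also have "\<dots> = of_nat (out_degree G ?v) * wave_val k b d"
      by (simp add: out_degree_def)
    finally show ?thesis
      using out_degree_pos[of d] unfolding residual by (simp add: field_simps)
  qed
  then show "(mat 1 - graph_scattering k) *v b = 0" by (simp add: vec_eq_iff)
qed

lemma sum_by_vertices: "(\<Sum>d\<in>UNIV. F d) = (\<Sum>v\<in>verts G. \<Sum>d\<in>out_arcs G v. F d)" for F :: "'d \<Rightarrow> complex"
proof -
  have "(\<Sum>v\<in>verts G. sum F {d \<in> UNIV. tail G d = v}) = sum F UNIV"
    by (rule sum.group) (auto simp: arcs_UNIV finite_verts)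
  then show ?thesis by (simp add: out_arcs_eq)
qed

text \<open>The boundary terms of Green's identity are linear in the residual. At a vertex,
  \<open>wave_val\<close> is the residual plus a constant that disappears because the
  \<open>h d\<close> sum to 0, and the slopes sum to \<open>\<i> * k\<close> times the sum of the
  residuals. Hence a small residual makes the boundary terms equally small.\<close>

lemma residual_pairing:
  assumes vc: "vertex_cond g h"
  shows "(\<Sum>d\<in>UNIV. wave_slope k b d * g d - wave_val k b d * h d) =
    (\<Sum>d\<in>UNIV. ((mat 1 - graph_scattering k) *v b) $ d * (\<i> * k * g d - h d))"
  unfolding sum_by_vertices
proof (rule sum.cong[OF refl])
  fix v assume v: "v \<in> verts G"
  define \<rho> where "\<rho> d = ((mat 1 - graph_scattering k) *v b) $ d" for d
  define A where "A = out_arcs G v"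
  show "(\<Sum>d\<in>out_arcs G v. wave_slope k b d * g d - wave_val k b d * h d) =
    (\<Sum>d\<in>out_arcs G v. ((mat 1 - graph_scattering k) *v b) $ d * (\<i> * k * g d - h d))"
    unfolding \<rho>_def[symmetric] A_def[symmetric]
  proof (cases "A = {}")
    case False
    then obtain d0 where d0: "tail G d0 = v" by (auto simp: A_def out_arcs_eq)
    define m where "m = 2 / of_nat (out_degree G v) * (\<Sum>e\<in>A. in_amp k b e)"
    have g: "g d = g d0" if "d \<in> A" for d
      using that d0 by (intro vertex_condD(1)[OF vc]) (simp add: A_def out_arcs_eq)
    have \<rho>: "\<rho> d = wave_val k b d - m" if "d \<in> A" for d
      using residual[of k b d] that by (simp add: \<rho>_def m_def A_def out_arcs_eq)
    have h: "sum h A = 0" unfolding A_def by (rule vertex_condD(2)[OF vc v])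
    have "of_nat (card A) * m = 2 * (\<Sum>e\<in>A. in_amp k b e)"
      using out_degree_pos[of d0] by (simp add: m_def A_def d0 out_degree_def)
    then have sum_\<rho>: "sum \<rho> A = (\<Sum>e\<in>A. b $ e) - (\<Sum>e\<in>A. in_amp k b e)"
      using sum_out_arcs(1)[of k b v] by (simp add: \<rho> sum_subtractf A_def[symmetric])
    have "(\<Sum>d\<in>A. wave_slope k b d * g d - wave_val k b d * h d) =
        (\<Sum>d\<in>A. wave_slope k b d * g d0 - (\<rho> d + m) * h d)"
      by (intro sum.cong refl) (simp only: g \<rho> diff_add_cancel)
    also have "\<dots> = (\<Sum>d\<in>A. wave_slope k b d) * g d0 - (\<Sum>d\<in>A. \<rho> d * h d) - m * sum h A"
      by (simp add: sum_subtractf sum.distrib distrib_right sum_distrib_left sum_distrib_right)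
    also have "\<dots> = sum \<rho> A * (\<i> * k * g d0) - (\<Sum>d\<in>A. \<rho> d * h d)"
      using sum_out_arcs(2)[of k b v] by (simp add: h sum_\<rho> A_def[symmetric])
    also have "\<dots> = (\<Sum>d\<in>A. \<rho> d * (\<i> * k * g d0 - h d))"
      by (simp only: sum_subtractf right_diff_distrib sum_distrib_right)
    also have "\<dots> = (\<Sum>d\<in>A. \<rho> d * (\<i> * k * g d - h d))"
      by (intro sum.cong refl) (simp only: g)
    finally show "(\<Sum>d\<in>A. wave_slope k b d * g d - wave_val k b d * h d) = (\<Sum>d\<in>A. \<rho> d * (\<i> * k * g d - h d))" .
  qed simp
qed

section \<open>Waves with given initial data and Green's identity on the graph\<close>

definition wave :: "complex \<Rightarrow> ('d \<Rightarrow> complex) \<Rightarrow> ('d \<Rightarrow> complex) \<Rightarrow> 'd \<Rightarrow> real \<Rightarrow> complex" where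
  "wave \<mu> p q d x = p d * edge.cs d \<mu> x + q d * edge.sn d \<mu> x"

definition wave' :: "complex \<Rightarrow> ('d \<Rightarrow> complex) \<Rightarrow> ('d \<Rightarrow> complex) \<Rightarrow> 'd \<Rightarrow> real \<Rightarrow> complex" where
  "wave' \<mu> p q d x = p d * edge.cs' d \<mu> x + q d * edge.sn' d \<mu> x"

lemma sol_wave: "edge.sol d \<mu> (wave \<mu> p q d) (wave' \<mu> p q d)"
  unfolding wave_def[abs_def] wave'_def[abs_def] by (rule edge.sol_lincomb[OF edge.sol_cs edge.sol_sn])

lemma wave_0 [simp]: "wave \<mu> p q d 0 = p d" "wave' \<mu> p q d 0 = q d"
  by (simp_all add: wave_def wave'_def)

lemma wave_end:
  assumes "edge_compat \<mu> p q"
  shows "wave \<mu> p q d (L d) = p (arev d)" "wave' \<mu> p q d (L d) = - q (arev d)"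
  using sol_end[OF sol_wave[of d \<mu> p q]] assms by (auto simp: edge_compat_def)

lemma wave_cnj:
  assumes "x \<in> {0..L d}"
  shows "cnj (wave \<mu> p q d x) = wave (cnj \<mu>) (\<lambda>d. cnj (p d)) (\<lambda>d. cnj (q d)) d x"
  using edge.cs_sn_cnj[OF assms] by (simp add: wave_def)

lemma edge_compat_cnj:
  assumes "edge_compat \<mu> p q"
  shows "edge_compat (cnj \<mu>) (\<lambda>d. cnj (p d)) (\<lambda>d. cnj (q d))"
  unfolding edge_compat_def end_cnj
proof
  fix d
  have "p (arev d) = cs_end d \<mu> * p d + sn_end d \<mu> * q d" "- q (arev d) = cs'_end d \<mu> * p d + sn'_end d \<mu> * q d"
    using assms by (auto simp: edge_compat_def)
  from arg_cong[OF this(1), of cnj] arg_cong[OF this(2), of cnj]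
  show "cnj (p (arev d)) = cnj (cs_end d \<mu>) * cnj (p d) + cnj (sn_end d \<mu>) * cnj (q d) \<and>
      - cnj (q (arev d)) = cnj (cs'_end d \<mu>) * cnj (p d) + cnj (sn'_end d \<mu>) * cnj (q d)"
    by simp
qed

lemma vertex_cond_cnj:
  assumes "vertex_cond p q"
  shows "vertex_cond (\<lambda>d. cnj (p d)) (\<lambda>d. cnj (q d))"
  unfolding vertex_cond_def
proof (intro conjI allI impI ballI)
  show "cnj (p d) = cnj (p d')" if "tail G d = tail G d'" for d d'
    using vertex_condD(1)[OF assms that] by simp
  show "(\<Sum>d\<in>out_arcs G v. cnj (q d)) = 0" if "v \<in> verts G" for v
    unfolding cnj_sum[symmetric] by (simp only: vertex_condD(2)[OF assms that] complex_cnj_zero)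
qed

text \<open>The boundary term at the head of \<open>d\<close> is the one at the tail of
  \<open>arev d\<close>. Summing over all directed edges therefore meets every tail twice, whence
  the factor 2.\<close>

lemma graph_green_identity:
  assumes pq: "edge_compat \<mu> p q" and gh: "edge_compat \<nu> g h"
  shows "(\<mu> - \<nu>) * (\<Sum>d\<in>UNIV. integral {0..L d} (\<lambda>t. wave \<mu> p q d t * wave \<nu> g h d t)) =
    2 * (\<Sum>d\<in>UNIV. q d * g d - p d * h d)"
proof -
  have "(\<mu> - \<nu>) * integral {0..L d} (\<lambda>t. wave \<mu> p q d t * wave \<nu> g h d t) =
      (q d * g d - p d * h d) + (q (arev d) * g (arev d) - p (arev d) * h (arev d))" for d
    using edge.green_identity[OF sol_wave[of d \<mu> p q] sol_wave[of d \<nu> g h] edge_end]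
    by (simp add: wave_end[OF pq] wave_end[OF gh] algebra_simps)
  then have "(\<mu> - \<nu>) * (\<Sum>d\<in>UNIV. integral {0..L d} (\<lambda>t. wave \<mu> p q d t * wave \<nu> g h d t)) =
      (\<Sum>d\<in>UNIV. q d * g d - p d * h d) + (\<Sum>d\<in>UNIV. q (arev d) * g (arev d) - p (arev d) * h (arev d))"
    unfolding sum_distrib_left by (simp only: sum.distrib)
  also have "(\<Sum>d\<in>UNIV. q (arev d) * g (arev d) - p (arev d) * h (arev d)) = (\<Sum>d\<in>UNIV. q d * g d - p d * h d)"
    by (rule sum.reindex_bij_betw[OF bij_arev])
  finally show ?thesis by simp
qed

lemma wave_continuous: "continuous_on {0..L d} (wave \<mu> p q d)"
  by (rule edge.sol_continuous(1)[OF sol_wave])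

text \<open>The second factor is the conjugate of the first, so the sum consists of squared norms; a
  vanishing wave has vanishing initial data.\<close>

lemma wave_norm_zero:
  assumes "(\<Sum>d\<in>UNIV. integral {0..L d} (\<lambda>t. wave \<mu> p q d t *
      wave (cnj \<mu>) (\<lambda>d. cnj (p d)) (\<lambda>d. cnj (q d)) d t)) = 0"
  shows "p d = 0 \<and> q d = 0"
proof -
  define N where "N d = integral {0..L d} (\<lambda>t. (cmod (wave \<mu> p q d t))\<^sup>2)" for d
  have cont: "continuous_on {0..L d} (\<lambda>t. (cmod (wave \<mu> p q d t))\<^sup>2)" for d
    using wave_continuous by (intro continuous_intros)
  have "integral {0..L d} (\<lambda>t. wave \<mu> p q d t * wave (cnj \<mu>) (\<lambda>d. cnj (p d)) (\<lambda>d. cnj (q d)) d t) = of_real (N d)" for d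
  proof -
    have "integral {0..L d} (\<lambda>t. wave \<mu> p q d t * wave (cnj \<mu>) (\<lambda>d. cnj (p d)) (\<lambda>d. cnj (q d)) d t) =
        integral {0..L d} (\<lambda>t. of_real ((cmod (wave \<mu> p q d t))\<^sup>2))"
    proof (rule integral_cong)
      fix t assume "t \<in> {0..L d}"
      from wave_cnj[OF this, of \<mu> p q, symmetric]
      show "wave \<mu> p q d t * wave (cnj \<mu>) (\<lambda>d. cnj (p d)) (\<lambda>d. cnj (q d)) d t = of_real ((cmod (wave \<mu> p q d t))\<^sup>2)"
        by (simp only: complex_norm_square)
    qed
    also have "\<dots> = of_real (N d)"
      unfolding N_def by (rule integral_unique[OF has_integral_of_real[OF integrable_integral[OF integrable_continuous_real[OF cont]]]])
    finally show ?thesis .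
  qed
  with assms have "(\<Sum>d\<in>UNIV. complex_of_real (N d)) = 0" by (simp only:)
  then have "sum N UNIV = 0" by (simp only: of_real_sum[symmetric] of_real_eq_0_iff)
  moreover have "N d \<ge> 0" for d unfolding N_def by (rule Henstock_Kurzweil_Integration.integral_nonneg[OF integrable_continuous_real[OF cont]]) simp
  ultimately have "N d = 0" by (simp add: sum_nonneg_eq_0_iff)
  then have zero: "wave \<mu> p q d t = 0" if "t \<in> {0..L d}" for t
    using integral_eq_0_iff[OF cont, of d] length_pos[of d] that by (simp add: N_def)
  have "edge.sol d 0 (\<lambda>_. 0) (\<lambda>_. 0)" by (simp add: edge.sol_def)
  from edge.sol_derivative_unique[OF sol_wave this zero edge_start] zero[OF edge_start]
  show ?thesis by simp
qed

section \<open>Kernel vectors: real spectral parameter and no Jordan chains\<close>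

lemma wave_zero_imp_amplitude_zero:
  assumes "k \<noteq> 0" "wave_val k b d = 0" "wave_slope k b d = 0"
  shows "b $ d = 0"
proof -
  have "in_amp k b d + b $ d = 0" "b $ d - in_amp k b d = 0"
    using assms by (simp_all add: wave_val_def wave_slope_def)
  then have "2 * b $ d = 0" by algebra
  then show ?thesis by simp
qed

text \<open>The conjugate wave solves the equation for \<open>cnj (k\<^sup>2)\<close> and satisfies
  the vertex conditions, so the boundary terms vanish and the norm is multiplied by
  \<open>k\<^sup>2 - cnj (k\<^sup>2)\<close>.\<close>

lemma kernel_imp_real:
  assumes k: "k \<in> regular_points" and b: "(mat 1 - graph_scattering k) *v b = 0" "b \<noteq> 0"
  shows "k\<^sup>2 \<in> \<real>"
proof (rule ccontr)
  assume nr: "k\<^sup>2 \<notin> \<real>"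
  let ?p = "wave_val k b" and ?q = "wave_slope k b"
  have k0: "k \<noteq> 0" using k by (simp add: regular_points_def)
  have vc: "vertex_cond ?p ?q" using kernel_iff_vertex_cond[OF k0] b by simp
  have "(\<Sum>d\<in>UNIV. ?q d * cnj (?p d) - ?p d * cnj (?q d)) = 0"
    unfolding residual_pairing[OF vertex_cond_cnj[OF vc]] b(1) by simp
  then have "(k\<^sup>2 - cnj (k\<^sup>2)) * (\<Sum>d\<in>UNIV. integral {0..L d} (\<lambda>t. wave (k\<^sup>2) ?p ?q d t *
      wave (cnj (k\<^sup>2)) (\<lambda>d. cnj (?p d)) (\<lambda>d. cnj (?q d)) d t)) = 0"
    unfolding graph_green_identity[OF edge_compat_wave[OF k] edge_compat_cnj[OF edge_compat_wave[OF k]]] by simp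
  moreover have "k\<^sup>2 - cnj (k\<^sup>2) \<noteq> 0" using nr by (simp add: Reals_cnj_iff)
  ultimately have "?p d = 0 \<and> ?q d = 0" for d
    by (intro wave_norm_zero[of "k\<^sup>2"]) (simp only: mult_eq_0_iff simp_thms)
  then have "b $ d = 0" for d
    using wave_zero_imp_amplitude_zero[OF k0] by blast
  with b(2) show False by (simp add: vec_eq_iff)
qed

lemma kernel_no_jordan_chain:
  assumes k: "k \<in> regular_points" "k\<^sup>2 \<in> \<real>" and x: "(mat 1 - graph_scattering k) *v x = 0"
    and der: "\<And>d. ((\<lambda>z. ((mat 1 - graph_scattering z) *v (x + (z - k) *s y)) $ d) has_field_derivative 0) (at k)"
  shows "x = 0"
proof -
  define b where "b z = x + (z - k) *s y" for z
  have bk: "b k = x" by (simp add: b_def)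
  have k0: "k \<noteq> 0" using k by (simp add: regular_points_def)
  define p where "p z = wave_val z (b z)" for z
  define q where "q z = wave_slope z (b z)" for z
  \<comment> \<open>These are the conjugate data of the eigenfunction. As \<open>k\<^sup>2\<close>
    is real, they belong to the same spectral parameter.\<close>
  define g where "g d = cnj (p k d)" for d
  define h where "h d = cnj (q k d)" for d
  have vc: "vertex_cond g h"
    unfolding g_def h_def p_def q_def bk using kernel_iff_vertex_cond[OF k0] x by (intro vertex_cond_cnj) simp
  have compat: "edge_compat (k\<^sup>2) g h"
    using edge_compat_cnj[OF edge_compat_wave[OF k(1), of x]] k(2)
    unfolding g_def h_def p_def q_def bk by (simp add: Reals_cnj_iff)
  define \<rho> where "\<rho> z d = ((mat 1 - graph_scattering z) *v b z) $ d" for z d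
  define R where "R z = 2 * (\<Sum>d\<in>UNIV. \<rho> z d * (\<i> * z * g d - h d))" for z
  define I where "I z = (\<Sum>d\<in>UNIV. integral {0..L d} (\<lambda>t. wave (z\<^sup>2) (p z) (q z) d t * wave (k\<^sup>2) g h d t))" for z
  have IR: "(z\<^sup>2 - k\<^sup>2) * I z = R z" if "z \<in> regular_points" for z
    unfolding I_def R_def p_def q_def \<rho>_def residual_pairing[OF vc, symmetric]
    by (rule graph_green_identity[OF edge_compat_wave[OF that] compat])
  have \<rho>k: "\<rho> k d = 0" for d by (simp add: \<rho>_def bk x)
  have \<rho>': "((\<lambda>z. \<rho> z d) has_field_derivative 0) (at k)" for d
    using der[of d] by (simp add: \<rho>_def b_def)
  have "(R has_field_derivative 0) (at k)"
    unfolding R_def[abs_def] by (rule derivative_eq_intros \<rho>' refl | simp add: \<rho>k)+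
  moreover have "R k = 0" by (simp add: R_def \<rho>k)
  ultimately have "((\<lambda>z. R z / (z - k)) \<longlongrightarrow> 0) (at k)"
    by (simp add: has_field_derivative_iff)
  \<comment> \<open>Cancelling \<open>z - k\<close> leaves the factor \<open>z + k\<close> with the
    nonzero limit \<open>2 * k\<close>, so \<open>I k\<close>, a sum of squared norms, will have to
    vanish.\<close>
  moreover have "\<forall>\<^sub>F z in at k. R z / (z - k) = (z + k) * I z"
  proof -
    have "\<forall>\<^sub>F z in at k. z \<in> regular_points - {k}"
      using eventually_at_in_open[OF open_regular_points k(1)] .
    then show ?thesis
    proof eventually_elim
      case (elim z)
      have "R z = (z\<^sup>2 - k\<^sup>2) * I z" using IR elim by simp
      also have "\<dots> = (z - k) * ((z + k) * I z)" by (simp add: power2_eq_square algebra_simps)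
      finally show ?case using elim by simp
    qed
  qed
  ultimately have "((\<lambda>z. (z + k) * I z) \<longlongrightarrow> 0) (at k)"
    by (rule Lim_transform_eventually)
  moreover have "isCont I k"
  proof -
    have int: "isCont (\<lambda>z. integral {0..L d} (\<lambda>t. edge.cs d (z\<^sup>2) t * wave (k\<^sup>2) g h d t)) k"
      "isCont (\<lambda>z. integral {0..L d} (\<lambda>t. edge.sn d (z\<^sup>2) t * wave (k\<^sup>2) g h d t)) k" for d
    proof -
      have 1: "isCont (\<lambda>\<mu>. integral {0..L d} (\<lambda>t. edge.cs d \<mu> t * wave (k\<^sup>2) g h d t)) (k\<^sup>2)"
        by (rule edge.isCont_integral_sol[OF edge.sol_cs _ _ wave_continuous]) (rule edge.cs_sn_0)+
      have 2: "isCont (\<lambda>\<mu>. integral {0..L d} (\<lambda>t. edge.sn d \<mu> t * wave (k\<^sup>2) g h d t)) (k\<^sup>2)"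
        by (rule edge.isCont_integral_sol[OF edge.sol_sn _ _ wave_continuous]) (rule edge.cs_sn_0)+
      have sq: "isCont (\<lambda>z. z\<^sup>2) k" by (intro continuous_intros)
      show "isCont (\<lambda>z. integral {0..L d} (\<lambda>t. edge.cs d (z\<^sup>2) t * wave (k\<^sup>2) g h d t)) k"
        by (rule isCont_o2[OF sq 1])
      show "isCont (\<lambda>z. integral {0..L d} (\<lambda>t. edge.sn d (z\<^sup>2) t * wave (k\<^sup>2) g h d t)) k"
        by (rule isCont_o2[OF sq 2])
    qed
    have amp: "isCont (\<lambda>z. in_amp z (b z) d) k" for d
    proof -
      have "(\<lambda>z. in_amp z (b z) d) holomorphic_on regular_points"
        unfolding in_amp_def matrix_vector_mult_def b_def
        by (auto intro!: holomorphic_intros transition_matrix_holomorphic)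
      from holomorphic_on_imp_continuous_on[OF this] k(1) show ?thesis
        unfolding continuous_on_eq_continuous_at[OF open_regular_points] by (rule bspec)
    qed
    have comp: "isCont (\<lambda>z. b z $ d) k" for d
      unfolding b_def vector_add_component vector_smult_component by (intro continuous_intros)
    have val: "isCont (\<lambda>z. p z d) k" and slope: "isCont (\<lambda>z. q z d) k" for d
      unfolding p_def q_def wave_val_def wave_slope_def by (intro continuous_intros amp comp)+
    \<comment> \<open>The initial data of the wave vary with \<open>z\<close>, whereas
      \<open>isCont_integral_sol\<close> needs fixed ones; splitting into \<open>cs\<close> and
      \<open>sn\<close> moves the variation into the coefficients.\<close>
    have "I = (\<lambda>z. \<Sum>d\<in>UNIV. p z d * integral {0..L d} (\<lambda>t. edge.cs d (z\<^sup>2) t * wave (k\<^sup>2) g h d t) +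
        q z d * integral {0..L d} (\<lambda>t. edge.sn d (z\<^sup>2) t * wave (k\<^sup>2) g h d t))"
      unfolding I_def[abs_def]
    proof (intro ext sum.cong refl)
      fix z d
      have c: "(\<lambda>t. edge.cs d (z\<^sup>2) t * wave (k\<^sup>2) g h d t) integrable_on {0..L d}"
        "(\<lambda>t. edge.sn d (z\<^sup>2) t * wave (k\<^sup>2) g h d t) integrable_on {0..L d}"
        by (intro integrable_continuous_real continuous_on_mult wave_continuous
            edge.sol_continuous(1)[OF edge.sol_cs] edge.sol_continuous(1)[OF edge.sol_sn])+
      have "integral {0..L d} (\<lambda>t. wave (z\<^sup>2) (p z) (q z) d t * wave (k\<^sup>2) g h d t) =
        integral {0..L d} (\<lambda>t. p z d * (edge.cs d (z\<^sup>2) t * wave (k\<^sup>2) g h d t) +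
          q z d * (edge.sn d (z\<^sup>2) t * wave (k\<^sup>2) g h d t))"
        by (rule arg_cong[of _ _ "integral _"]) (simp add: fun_eq_iff wave_def[of "z\<^sup>2"] distrib_right mult.assoc)
      also have "\<dots> = p z d * integral {0..L d} (\<lambda>t. edge.cs d (z\<^sup>2) t * wave (k\<^sup>2) g h d t) +
        q z d * integral {0..L d} (\<lambda>t. edge.sn d (z\<^sup>2) t * wave (k\<^sup>2) g h d t)"
        by (subst integral_add) (auto intro!: integrable_on_mult_right c)
      finally show "integral {0..L d} (\<lambda>t. wave (z\<^sup>2) (p z) (q z) d t * wave (k\<^sup>2) g h d t) =
        p z d * integral {0..L d} (\<lambda>t. edge.cs d (z\<^sup>2) t * wave (k\<^sup>2) g h d t) +
        q z d * integral {0..L d} (\<lambda>t. edge.sn d (z\<^sup>2) t * wave (k\<^sup>2) g h d t)" .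
    qed
    then show ?thesis by (auto intro!: continuous_intros val slope int)
  qed
  then have "((\<lambda>z. (z + k) * I z) \<longlongrightarrow> (k + k) * I k) (at k)"
    unfolding isCont_def by (intro tendsto_intros)
  ultimately have "(k + k) * I k = 0"
    using tendsto_unique[OF trivial_limit_at] by blast
  then have "I k = 0" using k0 by simp
  moreover have "k\<^sup>2 = cnj (k\<^sup>2)" using k(2) by (simp add: Reals_cnj_iff)
  ultimately have "p k d = 0 \<and> q k d = 0" for d
    unfolding I_def g_def[abs_def] h_def[abs_def] by (intro wave_norm_zero[of "k\<^sup>2"]) (simp only:)
  then have "x $ d = 0" for d
    using wave_zero_imp_amplitude_zero[OF k0] unfolding p_def q_def bk by blast
  then show ?thesis by (simp add: vec_eq_iff)
qed

section \<open>Eigenspaces and the secular function\<close>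

lemma potential_term_continuous:
  assumes "continuous_on {0..L d} f"
  shows "continuous_on {0..L d} (\<lambda>t. (of_real (w d t) - \<mu>) * f t :: complex)"
  using potential_continuous[of d] assms by (intro continuous_intros)

text \<open>Regularity: the weak second derivative agrees almost everywhere with the continuous
  function \<open>(w - \<mu>) f\<close>, so the integral formula for \<open>f'\<close> makes
  \<open>f'\<close> classically differentiable up to the ends.\<close>

lemma has_H2_derivs_imp_sol:
  assumes H2: "has_H2_derivs (L d) f f' f''"
    and ae: "AE x in lborel. x \<in> {0..L d} \<longrightarrow> \<mu> * f x = - f'' x + of_real (w d x) * f x"
  shows "edge.sol d \<mu> f f'"
proof -
  define g where "g x = (of_real (w d x) - \<mu>) * f x" for x
  have der: "\<And>x. x \<in> {0..L d} \<Longrightarrow> (f has_vector_derivative f' x) (at x within {0..L d})"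
    and int: "set_integrable lborel {0..L d} f''"
    and f'_eq: "\<And>x. x \<in> {0..L d} \<Longrightarrow> f' x = f' 0 + (LINT t:{0..x}|lborel. f'' t)"
    using H2 unfolding has_H2_derivs_def by blast+
  have "continuous_on {0..L d} f"
    by (rule continuous_on_vector_derivative[OF der])
  then have g: "continuous_on {0..L d} g"
    unfolding g_def by (rule potential_term_continuous)
  have f': "f' x = f' 0 + integral {0..x} g" if x: "x \<in> {0..L d}" for x
  proof -
    have sub: "{0..x} \<subseteq> {0..L d}" using x by auto
    have i1: "set_integrable lborel {0..x} f''"
      by (rule set_integrable_subset[OF int]) (use sub in auto)
    have i2: "set_integrable lborel {0..x} g"
      by (rule borel_integrable_atLeastAtMost'[OF continuous_on_subset[OF g sub]])
    have "(LINT t:{0..x}|lborel. f'' t) = (LINT t:{0..x}|lborel. g t)"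
      unfolding set_lebesgue_integral_def
    proof (rule integral_cong_AE)
      show "(\<lambda>t. indicator {0..x} t *\<^sub>R f'' t) \<in> borel_measurable lborel"
        "(\<lambda>t. indicator {0..x} t *\<^sub>R g t) \<in> borel_measurable lborel"
        using i1 i2 by (auto simp: set_integrable_def)
      show "AE t in lborel. indicator {0..x} t *\<^sub>R f'' t = indicator {0..x} t *\<^sub>R g t"
        using ae
      proof eventually_elim
        case (elim t)
        show ?case
        proof (cases "t \<in> {0..x}")
          case True
          then have "\<mu> * f t = - f'' t + of_real (w d t) * f t" using elim sub by blast
          then have "f'' t = g t" by (simp add: g_def algebra_simps)
          then show ?thesis by simp
        qed simp
      qed
    qed
    also have "\<dots> = integral {0..x} g"
      by (rule set_borel_integral_eq_integral(2)[OF i2])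
    finally show ?thesis using f'_eq[OF x] by (simp only:)
  qed
  show ?thesis
    unfolding edge.sol_def
  proof (intro ballI conjI der)
    fix x assume x: "x \<in> {0..L d}"
    have "((\<lambda>x. f' 0 + integral {0..x} g) has_vector_derivative 0 + g x) (at x within {0..L d})"
      by (intro has_vector_derivative_add has_vector_derivative_const integral_has_vector_derivative[OF g x])
    from has_vector_derivative_transform[OF x f' this]
    show "(f' has_vector_derivative (of_real (w d x) - \<mu>) * f x) (at x within {0..L d})"
      by (simp add: g_def)
  qed
qed

lemma sol_imp_has_H2_derivs:
  assumes s: "edge.sol d \<mu> f f'"
  shows "has_H2_derivs (L d) f f' (\<lambda>x. (of_real (w d x) - \<mu>) * f x)"
  unfolding has_H2_derivs_def
proof (intro conjI ballI)
  define g where "g x = (of_real (w d x) - \<mu>) * f x" for x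
  have g: "continuous_on {0..L d} g"
    unfolding g_def by (rule potential_term_continuous[OF edge.sol_continuous(1)[OF s]])
  show "(f has_vector_derivative f' x) (at x within {0..L d})" if "x \<in> {0..L d}" for x
    using s that by (simp add: edge.sol_def)
  show "set_integrable lborel {0..L d} g"
    by (rule borel_integrable_atLeastAtMost'[OF g])
  show "set_integrable lborel {0..L d} (\<lambda>x. (cmod (g x))\<^sup>2)"
    by (intro borel_integrable_atLeastAtMost' continuous_intros g)
  show "f' x = f' 0 + (LINT t:{0..x}|lborel. g t)" if x: "x \<in> {0..L d}" for x
  proof -
    have sub: "{0..x} \<subseteq> {0..L d}" using x by auto
    have "(LINT t:{0..x}|lborel. g t) = integral {0..x} g"
      by (rule set_borel_integral_eq_integral(2)[OF borel_integrable_atLeastAtMost'[OF continuous_on_subset[OF g sub]]])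
    also have "(g has_integral f' x - f' 0) {0..x}"
    proof (rule fundamental_theorem_of_calculus)
      fix t assume "t \<in> {0..x}"
      then have "t \<in> {0..L d}" using sub by blast
      then have "(f' has_vector_derivative g t) (at t within {0..L d})"
        using s by (simp add: edge.sol_def g_def)
      then show "(f' has_vector_derivative g t) (at t within {0..x})"
        by (rule has_vector_derivative_within_subset[OF _ sub])
    qed (use x in auto)
    then have "integral {0..x} g = f' x - f' 0" by (rule integral_unique)
    finally show ?thesis by simp
  qed
qed

text \<open>\<open>wave\<close> is uncontrolled off the edge; the cut matches the normalisation of
  functions in \<open>Delta_graph\<close>.\<close>

definition cut_wave :: "complex \<Rightarrow> ('d \<Rightarrow> complex) \<Rightarrow> ('d \<Rightarrow> complex) \<Rightarrow> 'd \<Rightarrow> real \<Rightarrow> complex" where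
  "cut_wave \<mu> p q = (\<lambda>d x. if x \<in> {0..L d} then wave \<mu> p q d x else 0)"

lemma sol_cut_wave: "edge.sol d \<mu> (cut_wave \<mu> p q d) (wave' \<mu> p q d)"
  unfolding edge.sol_def
proof (intro ballI conjI)
  fix x assume x: "x \<in> {0..L d}"
  have d: "(wave \<mu> p q d has_vector_derivative wave' \<mu> p q d x) (at x within {0..L d})"
    "(wave' \<mu> p q d has_vector_derivative (of_real (w d x) - \<mu>) * wave \<mu> p q d x) (at x within {0..L d})"
    using sol_wave[of d \<mu> p q] x unfolding edge.sol_def by blast+
  show "(cut_wave \<mu> p q d has_vector_derivative wave' \<mu> p q d x) (at x within {0..L d})"
    by (rule has_vector_derivative_transform[OF x _ d(1)]) (simp add: cut_wave_def)
  show "(wave' \<mu> p q d has_vector_derivative (of_real (w d x) - \<mu>) * cut_wave \<mu> p q d x) (at x within {0..L d})"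
    using d(2) x by (simp add: cut_wave_def)
qed

lemma cut_wave_0: "cut_wave \<mu> p q d 0 = p d"
  using edge_start[of d] by (simp add: cut_wave_def)

lemma cut_wave_reverse:
  assumes "edge_compat \<mu> p q" "x \<in> {0..L d}"
  shows "cut_wave \<mu> p q d x = cut_wave \<mu> p q (arev d) (L d - x)"
proof -
  have "\<forall>x\<in>{0..L d}. cut_wave \<mu> p q d x = cut_wave \<mu> p q (arev d) (L d - x)"
    unfolding sol_matches_reverse_iff[OF sol_cut_wave sol_cut_wave] cut_wave_0 wave_0
    using assms(1) unfolding edge_compat_def by blast
  then show ?thesis using assms(2) by blast
qed

text \<open>By regularity and uniqueness an eigenfunction is determined by its data at the tails, so
  the differential problem becomes finite linear algebra. No condition on \<open>\<mu>\<close> is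
  needed before amplitudes are introduced.\<close>

lemma eigenspace_iff:
  "\<psi> \<in> eigenspace \<mu> \<longleftrightarrow> (\<exists>p q. edge_compat \<mu> p q \<and> vertex_cond p q \<and> \<psi> = cut_wave \<mu> p q)"
proof
  assume "\<psi> \<in> eigenspace \<mu>"
  then have "Delta_graph \<psi> (edge_fun_scale \<mu> \<psi>)" by (simp add: eigenspace_def)
  then obtain \<psi>' \<psi>'' where off: "\<forall>d x. x \<notin> {0..L d} \<longrightarrow> \<psi> d x = 0"
    and rev: "\<forall>d. \<forall>x\<in>{0..L d}. \<psi> d x = \<psi> (arev d) (L d - x)"
    and cont: "\<forall>d d'. tail G d = tail G d' \<longrightarrow> \<psi> d 0 = \<psi> d' 0"
    and H2: "\<forall>d. has_H2_derivs (L d) (\<psi> d) (\<psi>' d) (\<psi>'' d)"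
    and kirchhoff: "\<forall>v\<in>verts G. (\<Sum>d\<in>out_arcs G v. \<psi>' d 0) = 0"
    and ae: "\<forall>d. AE x in lborel. x \<in> {0..L d} \<longrightarrow> edge_fun_scale \<mu> \<psi> d x = - \<psi>'' d x + of_real (w d x) * \<psi> d x"
    unfolding Delta_graph_def by blast
  have sol: "edge.sol d \<mu> (\<psi> d) (\<psi>' d)" for d
    by (rule has_H2_derivs_imp_sol[OF H2[rule_format] ae[rule_format, unfolded edge_fun_scale_def]])
  define p where "p d = \<psi> d 0" for d
  define q where "q d = \<psi>' d 0" for d
  have "edge_compat \<mu> p q"
    unfolding edge_compat_def p_def q_def
  proof
    fix d
    show "\<psi> (arev d) 0 = cs_end d \<mu> * \<psi> d 0 + sn_end d \<mu> * \<psi>' d 0 \<and>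
        - \<psi>' (arev d) 0 = cs'_end d \<mu> * \<psi> d 0 + sn'_end d \<mu> * \<psi>' d 0"
      using sol_matches_reverse_iff[OF sol sol] rev by blast
  qed
  moreover have "vertex_cond p q"
    unfolding vertex_cond_def p_def q_def using cont kirchhoff by blast
  moreover have "\<psi> = cut_wave \<mu> p q"
  proof (intro ext)
    fix d x
    show "\<psi> d x = cut_wave \<mu> p q d x"
    proof (cases "x \<in> {0..L d}")
      case True
      then show ?thesis
        using edge.sol_repr(1)[OF sol True] by (simp add: cut_wave_def wave_def p_def q_def)
    next
      case False
      then have "\<psi> d x = 0" using off by blast
      with False show ?thesis by (simp only: cut_wave_def if_False)
    qed
  qed
  ultimately show "\<exists>p q. edge_compat \<mu> p q \<and> vertex_cond p q \<and> \<psi> = cut_wave \<mu> p q" by blast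
next
  assume "\<exists>p q. edge_compat \<mu> p q \<and> vertex_cond p q \<and> \<psi> = cut_wave \<mu> p q"
  then obtain p q where pq: "edge_compat \<mu> p q" and vc: "vertex_cond p q" and \<psi>: "\<psi> = cut_wave \<mu> p q" by blast
  have "Delta_graph \<psi> (edge_fun_scale \<mu> \<psi>)"
    unfolding Delta_graph_def
  proof (intro conjI allI impI ballI)
    show "\<psi> d x = 0" if "x \<notin> {0..L d}" for d x
      using that by (simp only: \<psi> cut_wave_def if_False)
    show "\<psi> d x = \<psi> (arev d) (L d - x)" if "x \<in> {0..L d}" for d x
      unfolding \<psi> by (rule cut_wave_reverse[OF pq that])
    show "\<psi> d 0 = \<psi> d' 0" if "tail G d = tail G d'" for d d'
      unfolding \<psi> cut_wave_0 by (rule vertex_condD(1)[OF vc that])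
    show "\<exists>\<psi>' \<psi>''. (\<forall>d. has_H2_derivs (L d) (\<psi> d) (\<psi>' d) (\<psi>'' d)) \<and>
        (\<forall>v\<in>verts G. (\<Sum>d\<in>out_arcs G v. \<psi>' d 0) = 0) \<and>
        (\<forall>d. AE x in lborel. x \<in> {0..L d} \<longrightarrow>
            edge_fun_scale \<mu> \<psi> d x = - \<psi>'' d x + of_real (w d x) * \<psi> d x)"
    proof (intro exI conjI allI ballI)
      show "has_H2_derivs (L d) (\<psi> d) (wave' \<mu> p q d) ((\<lambda>d x. (of_real (w d x) - \<mu>) * \<psi> d x) d)" for d
        unfolding \<psi> by (rule sol_imp_has_H2_derivs[OF sol_cut_wave])
      show "(\<Sum>d\<in>out_arcs G v. wave' \<mu> p q d 0) = 0" if "v \<in> verts G" for v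
        unfolding wave_0 by (rule vertex_condD(2)[OF vc that])
      show "AE x in lborel. x \<in> {0..L d} \<longrightarrow>
            edge_fun_scale \<mu> \<psi> d x = - ((of_real (w d x) - \<mu>) * \<psi> d x) + of_real (w d x) * \<psi> d x" for d
        by (simp add: edge_fun_scale_def algebra_simps)
    qed
  qed
  then show "\<psi> \<in> eigenspace \<mu>" by (simp add: eigenspace_def)
qed

section \<open>The isomorphism between the kernel of \<open>1 - S\<close> and the eigenspace\<close>

definition amplitude_wave :: "complex \<Rightarrow> complex^'d \<Rightarrow> 'd \<Rightarrow> real \<Rightarrow> complex" where
  "amplitude_wave k b = cut_wave (k\<^sup>2) (wave_val k b) (wave_slope k b)"

lemma eigenspace_eq_image:
  assumes k: "k \<in> regular_points"
  shows "eigenspace (k\<^sup>2) = amplitude_wave k ` {b. (mat 1 - graph_scattering k) *v b = 0}"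
proof -
  have k0: "k \<noteq> 0" using k by (simp add: regular_points_def)
  show ?thesis
  proof (intro set_eqI iffI)
    fix \<psi> assume "\<psi> \<in> eigenspace (k\<^sup>2)"
    then obtain p q where pq: "edge_compat (k\<^sup>2) p q" "vertex_cond p q" "\<psi> = cut_wave (k\<^sup>2) p q"
      unfolding eigenspace_iff by blast
    define b where "b = (\<chi> d. (p d + q d / (\<i> * k)) / 2)"
    have "p = wave_val k b" "q = wave_slope k b"
      using edge_compat_imp_wave[OF k pq(1)] by (simp_all add: b_def)
    then have "\<psi> = amplitude_wave k b" "(mat 1 - graph_scattering k) *v b = 0"
      using pq kernel_iff_vertex_cond[OF k0] by (simp_all add: amplitude_wave_def)
    then show "\<psi> \<in> amplitude_wave k ` {b. (mat 1 - graph_scattering k) *v b = 0}" by blast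
  next
    fix \<psi> assume "\<psi> \<in> amplitude_wave k ` {b. (mat 1 - graph_scattering k) *v b = 0}"
    then obtain b where "(mat 1 - graph_scattering k) *v b = 0" "\<psi> = amplitude_wave k b" by blast
    then show "\<psi> \<in> eigenspace (k\<^sup>2)"
      unfolding eigenspace_iff amplitude_wave_def kernel_iff_vertex_cond[OF k0]
      using edge_compat_wave[OF k] by blast
  qed
qed

lemma linear_amplitude_wave: "Vector_Spaces.linear (*s) edge_fun_scale (amplitude_wave k)"
proof -
  have amp: "in_amp k (x + y) d = in_amp k x d + in_amp k y d" "in_amp k (c *s x) d = c * in_amp k x d" for x y c d
    by (simp_all add: in_amp_def matrix_vector_right_distrib vector_scalar_commute)
  have "amplitude_wave k (x + y) = amplitude_wave k x + amplitude_wave k y" for x y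
    by (simp add: fun_eq_iff amplitude_wave_def cut_wave_def wave_def wave_val_def wave_slope_def amp algebra_simps)
  moreover have "amplitude_wave k (c *s x) = edge_fun_scale c (amplitude_wave k x)" for c x
    by (simp add: fun_eq_iff amplitude_wave_def cut_wave_def wave_def wave_val_def wave_slope_def amp
        edge_fun_scale_def algebra_simps)
  ultimately show ?thesis
    unfolding Vector_Spaces.linear_iff using vector_space_edge_fun vec.vector_space_axioms by blast
qed

lemma amplitude_wave_inj:
  assumes "k \<noteq> 0"
  shows "inj (amplitude_wave k)"
proof (rule injI)
  fix x y assume eq: "amplitude_wave k x = amplitude_wave k y"
  have "wave_val k x d = wave_val k y d \<and> wave_slope k x d = wave_slope k y d" for d
  proof -
    have "cut_wave (k\<^sup>2) (wave_val k x) (wave_slope k x) d = cut_wave (k\<^sup>2) (wave_val k y) (wave_slope k y) d"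
      using eq unfolding amplitude_wave_def by (rule fun_cong)
    from edge.sol_derivative_unique[OF sol_cut_wave sol_cut_wave fun_cong[OF this] edge_start] fun_cong[OF this, of 0]
    show ?thesis by (simp add: cut_wave_0)
  qed
  moreover have "2 * z $ d = wave_val k z d + wave_slope k z d / (\<i> * k)" for z d
    using assms by (simp add: wave_val_def wave_slope_def)
  ultimately have "2 * x $ d = 2 * y $ d" for d by metis
  then show "x = y" by (simp add: vec_eq_iff)
qed

lemma eigenvalue_mult_eq:
  assumes k: "k \<in> regular_points"
  shows "eigenvalue_mult (k\<^sup>2) = vec.dim {b. (mat 1 - graph_scattering k) *v b = 0}"
proof -
  interpret E: vector_space "edge_fun_scale :: complex \<Rightarrow> ('d \<Rightarrow> real \<Rightarrow> complex) \<Rightarrow> _"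
    by (rule vector_space_edge_fun)
  \<comment> \<open>Only the source, the space of amplitudes, is finite-dimensional.\<close>
  interpret P: finite_dimensional_vector_space_pair_1 "(*s) :: complex \<Rightarrow> complex^'d \<Rightarrow> _" cart_basis
    "edge_fun_scale :: complex \<Rightarrow> ('d \<Rightarrow> real \<Rightarrow> complex) \<Rightarrow> _" ..
  have "k \<noteq> 0" using k by (simp add: regular_points_def)
  then have "inj_on (amplitude_wave k) X" for X
    using amplitude_wave_inj by (auto intro: inj_on_subset)
  from P.dim_image_eq[OF linear_amplitude_wave this] show ?thesis
    unfolding eigenvalue_mult_def eigenspace_eq_image[OF k] .
qed

lemma is_eigenvalue_iff:
  assumes k: "k \<in> regular_points"
  shows "is_eigenvalue (k\<^sup>2) \<longleftrightarrow> det (mat 1 - graph_scattering k) = 0"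
proof -
  have k0: "k \<noteq> 0" using k by (simp add: regular_points_def)
  interpret lin: Vector_Spaces.linear "(*s) :: complex \<Rightarrow> complex^'d \<Rightarrow> _" edge_fun_scale "amplitude_wave k"
    by (rule linear_amplitude_wave)
  have "amplitude_wave k b = 0 \<longleftrightarrow> b = 0" for b
    using injD[OF amplitude_wave_inj[OF k0], of b 0] lin.zero by auto
  then show ?thesis
    unfolding is_eigenvalue_def eigenspace_eq_image[OF k] det_eq_0_iff_kernel by auto
qed

section \<open>Size of the domain of the scattering matrix\<close>

lemma edge_den_nonzero_real:
  assumes "k \<in> \<real>" "k \<noteq> 0"
  shows "edge_den d k \<noteq> 0"
proof
  assume D: "edge_den d k = 0"
  obtain x where x: "k = of_real x" using assms(1) by (auto elim: Reals_cases)
  have "k\<^sup>2 \<in> \<real>" using assms(1) by simp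
  from end_real[OF this, of d] obtain c c' s s' where
    e: "cs_end d (k\<^sup>2) = of_real c" "cs'_end d (k\<^sup>2) = of_real c'" "sn_end d (k\<^sup>2) = of_real s" "sn'_end d (k\<^sup>2) = of_real s'"
    by (auto elim!: Reals_cases)
  have x0: "x \<noteq> 0" using assms(2) x by auto
  have "complex_of_real (c * s' - c' * s) = 1" using wronskian_end[of d "k\<^sup>2"] by (simp add: e)
  then have W: "c * s' - c' * s = 1" by (simp only: of_real_eq_1_iff)
  \<comment> \<open>If both parts vanish, the Wronskian equals minus a sum of two squares, which
    cannot be 1.\<close>
  have "edge_den d k = Complex (c + s') (c' / x - x * s)"
    unfolding edge_den_def e unfolding x using x0
    by (simp add: complex_eq_iff Re_divide Im_divide power2_eq_square)
  then have "c + s' = 0" "c' / x - x * s = 0" using D by (simp_all add: complex_eq_iff)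
  then have "s' = - c" "c' = x\<^sup>2 * s" using x0 by (simp_all add: field_simps power2_eq_square)
  then have "- (c\<^sup>2) - (x * s)\<^sup>2 = 1" using W by (simp add: power2_eq_square algebra_simps)
  moreover have "c\<^sup>2 \<ge> 0" "(x * s)\<^sup>2 \<ge> 0" by simp_all
  ultimately show False by linarith
qed

lemma real_regular:
  assumes "k \<in> \<real>" "k \<noteq> 0"
  shows "k \<in> regular_points"
  unfolding regular_points_def using edge_den_nonzero_real[OF assms] assms(2) by blast

text \<open>At each vertex the matrix is twice the averaging projection minus the identity. A kernel
  vector would equal twice its own mean, so the mean and then the vector vanish.\<close>

lemma det_vertex_scattering: "det vertex_scattering \<noteq> 0"
proof
  assume "det vertex_scattering = 0"
  then obtain y where y: "y \<noteq> 0" "vertex_scattering *v y = 0" by (auto simp: det_eq_0_iff_kernel)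
  have eq: "y $ arev d = 2 / of_nat (out_degree G (tail G d)) * (\<Sum>e\<in>out_arcs G (tail G d). y $ arev e)" for d
    using vertex_scattering_apply[of y d] y(2) by simp
  have "y $ arev d = 0" for d
  proof -
    let ?v = "tail G d"
    have "(\<Sum>e\<in>out_arcs G ?v. y $ arev e) =
        (\<Sum>e\<in>out_arcs G ?v. 2 / of_nat (out_degree G ?v) * (\<Sum>e\<in>out_arcs G ?v. y $ arev e))"
    proof (rule sum.cong[OF refl])
      fix e assume "e \<in> out_arcs G ?v"
      then have "tail G e = ?v" by (simp add: out_arcs_eq)
      then show "y $ arev e = 2 / of_nat (out_degree G ?v) * (\<Sum>e\<in>out_arcs G ?v. y $ arev e)"
        using eq[of e] by (simp only:)
    qed
    also have "\<dots> = 2 * (\<Sum>e\<in>out_arcs G ?v. y $ arev e)"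
      using out_degree_pos[of d] by (simp add: out_degree_def)
    finally have "(\<Sum>e\<in>out_arcs G ?v. y $ arev e) = 0" by simp
    then show ?thesis using eq[of d] by (simp only: mult_zero_right)
  qed
  then have "y $ d = 0" for d by (metis arev_arev)
  then show False using y(1) by (simp add: vec_eq_iff)
qed

text \<open>Regularity of \<open>- k\<close> enters because the determinant on an edge has
  \<open>edge_den d (- k)\<close> as its numerator.\<close>

lemma det_transition_matrix:
  assumes "k \<in> regular_points" "- k \<in> regular_points"
  shows "det (transition_matrix k) \<noteq> 0"
proof
  assume "det (transition_matrix k) = 0"
  then obtain b where b: "b \<noteq> 0" "transition_matrix k *v b = 0" by (auto simp: det_eq_0_iff_kernel)
  have k0: "k \<noteq> 0" using assms by (simp add: regular_points_def)
  have "b $ d = 0" for d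
  proof -
    have "in_amp k b d = 0" for d by (simp add: in_amp_def b(2))
    then have "edge_num (arev d) k * b $ d + 2 * b $ arev d = 0"
      "edge_num d k * b $ arev d + 2 * b $ d = 0"
      using in_amp_eq[OF assms(1), of d b] in_amp_eq[OF assms(1), of "arev d" b] by simp_all
    then have "(4 - edge_num d k * edge_num (arev d) k) * b $ d = 0" by algebra
    moreover have "4 - edge_num d k * edge_num (arev d) k = edge_den d k * edge_den d (- k)"
      using edge_den_num[OF k0, of d] by (simp add: algebra_simps)
    ultimately show ?thesis using assms by (simp add: regular_points_def)
  qed
  then show False using b(1) by (simp add: vec_eq_iff)
qed

lemma symmetric_regular_in_domain:
  assumes "k \<in> regular_points" "- k \<in> regular_points"
  shows "k \<in> scattering_domain - {0}"
  unfolding scattering_domain_eq graph_scattering_def det_mul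
  using det_transition_matrix[OF assms] det_vertex_scattering assms(1) by simp

lemma real_in_domain: "\<real> - {0} \<subseteq> scattering_domain - {0}"
proof
  fix k :: complex assume "k \<in> \<real> - {0}"
  then have "k \<in> \<real>" "k \<noteq> 0" "- k \<in> \<real>" "- k \<noteq> 0" by auto
  then show "k \<in> scattering_domain - {0}"
    by (intro symmetric_regular_in_domain real_regular)
qed

lemma finite_outside_domain:
  assumes "bounded B"
  shows "finite (B - scattering_domain)"
proof -
  obtain R where "\<forall>k\<in>B. cmod k \<le> R" using assms unfolding bounded_iff by blast
  then have R: "B \<subseteq> cball 0 R" by auto
  \<comment> \<open>Multiplying \<open>edge_den\<close> by \<open>\<i> * k\<close> removes its
    singularity at 0 and makes it entire.\<close>
  define P where "P d k = \<i> * k * (cs_end d (k\<^sup>2) + sn'_end d (k\<^sup>2)) + k\<^sup>2 * sn_end d (k\<^sup>2) - cs'_end d (k\<^sup>2)" for d k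
  have P: "P d k = \<i> * k * edge_den d k" if "k \<noteq> 0" for d k
    using that by (simp add: P_def edge_den_def algebra_simps power2_eq_square)
  have "(\<lambda>k. g (k\<^sup>2)) holomorphic_on UNIV" if "g holomorphic_on UNIV" for g :: "complex \<Rightarrow> complex"
    using that by (intro holomorphic_on_compose_gen[of "\<lambda>k. k\<^sup>2" UNIV g UNIV, unfolded o_def] holomorphic_intros) auto
  note h = this[OF end_holomorphic(1)] this[OF end_holomorphic(2)] this[OF end_holomorphic(3)] this[OF end_holomorphic(4)]
  have P_hol: "P d holomorphic_on UNIV" for d
    unfolding P_def[abs_def] by (intro holomorphic_intros h)
  have P_hol': "(\<lambda>k. P d (- k)) holomorphic_on UNIV" for d
    using P_hol[of d] by (intro holomorphic_on_compose_gen[of uminus UNIV "P d" UNIV, unfolded o_def] holomorphic_intros) auto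
  \<comment> \<open>The real point 1 is not a pole, so neither function is identically zero; for
    \<open>\<lambda>k. P d (- k)\<close> the witness is \<open>- 1\<close>.\<close>
  have ne: "P d 1 \<noteq> 0" "P d (- (- 1)) \<noteq> 0" for d
    using P[of 1 d] edge_den_nonzero_real[of 1 d] by simp_all
  have "B - scattering_domain \<subseteq> {0} \<union> (\<Union>d. {k \<in> cball 0 R. P d k = 0} \<union> {k \<in> cball 0 R. P d (- k) = 0})"
  proof
    fix k assume k: "k \<in> B - scattering_domain"
    show "k \<in> {0} \<union> (\<Union>d. {k \<in> cball 0 R. P d k = 0} \<union> {k \<in> cball 0 R. P d (- k) = 0})"
    proof (cases "k = 0")
      case False
      have "k \<notin> regular_points \<or> - k \<notin> regular_points"
        using symmetric_regular_in_domain[of k] k by blast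
      then obtain d where "edge_den d k = 0 \<or> edge_den d (- k) = 0"
        using False by (auto simp: regular_points_def)
      then have "P d k = 0 \<or> P d (- k) = 0" using P False by auto
      then show ?thesis using k R by blast
    qed simp
  qed
  moreover have "finite {k \<in> cball 0 R. P d k = 0}" for d
    by (rule finite_zeros_of_entire[OF P_hol ne(1) compact_cball])
  moreover have "finite {k \<in> cball 0 R. P d (- k) = 0}" for d
    by (rule finite_zeros_of_entire[OF P_hol' ne(2) compact_cball])
  ultimately show ?thesis
    by (elim finite_subset) (intro finite_UnI finite_UN_I finite.intros finite_class.finite_UNIV)
qed

text \<open>On the imaginary axis \<open>\<i> * k\<close> and \<open>k\<^sup>2\<close> are real,
  hence so are all entries of \<open>S\<close>. This is what the choice of the square root there
  relies on.\<close>

lemma det_graph_scattering_real: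
  assumes "k \<in> regular_points" "Re k = 0"
  shows "det (graph_scattering k) \<in> \<real>"
proof (rule det_Reals)
  have ik: "\<i> * k \<in> \<real>" using assms(2) by (simp add: complex_is_Real_iff)
  have "k\<^sup>2 \<in> \<real>" using assms(2) by (simp add: complex_is_Real_iff power2_eq_square)
  note r = end_real[OF this]
  have "edge_den d k \<in> \<real>" "edge_num d k \<in> \<real>" for d
    unfolding edge_den_def edge_num_def by (intro Reals_add Reals_diff Reals_mult Reals_divide r ik)+
  then have "transition_matrix k $ d $ d' \<in> \<real>" for d d'
    by (simp add: transition_matrix_regular[OF assms(1)])
  moreover have "vertex_scattering $ d $ d' \<in> \<real>" for d d'
    by (simp add: vertex_scattering_def)
  ultimately show "graph_scattering k $ i $ j \<in> \<real>" for i j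
    unfolding graph_scattering_def matrix_matrix_mult_def by (auto intro!: sum_in_Reals Reals_mult)
qed

section \<open>Orders of zeros and the secular function\<close>

lemma open_scattering_domain: "open (scattering_domain - {0})"
proof -
  have "continuous_on regular_points (\<lambda>k. det (graph_scattering k))"
    by (intro holomorphic_on_imp_continuous_on holomorphic_on_det graph_scattering_holomorphic)
  moreover have "open (- {0::complex})" by auto
  ultimately have "open (regular_points \<inter> (\<lambda>k. det (graph_scattering k)) -` (- {0}))"
    by (rule continuous_open_preimage[OF _ open_regular_points])
  also have "regular_points \<inter> (\<lambda>k. det (graph_scattering k)) -` (- {0}) = scattering_domain - {0}"
    by (auto simp: scattering_domain_eq)
  finally show ?thesis .
qed

text \<open>Reality of \<open>k\<^sup>2\<close> comes first because excluding Jordan chains depends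
  on it; the exponent is the dimension of the kernel, which is the multiplicity.\<close>

lemma det_secular_zero_order:
  assumes k: "k \<in> scattering_domain - {0}" and zero: "det (mat 1 - graph_scattering k) = 0"
  shows "k\<^sup>2 \<in> \<real>" and
    "\<exists>g. g holomorphic_on (scattering_domain - {0}) \<and> g k \<noteq> 0 \<and>
      (\<forall>z\<in>scattering_domain - {0}. det (mat 1 - graph_scattering z) = g z * (z - k) ^ eigenvalue_mult (k\<^sup>2))"
proof -
  have reg: "k \<in> regular_points" using k by (simp add: scattering_domain_eq)
  show real: "k\<^sup>2 \<in> \<real>"
    using zero kernel_imp_real[OF reg] by (auto simp: det_eq_0_iff_kernel)
  have sub: "scattering_domain - {0} \<subseteq> regular_points" by (auto simp: scattering_domain_eq)
  have hol: "(\<lambda>z. (mat 1 - graph_scattering z) $ i $ j) holomorphic_on (scattering_domain - {0})" for i j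
    unfolding vector_minus_component
    by (intro holomorphic_intros holomorphic_on_subset[OF graph_scattering_holomorphic sub])
  show "\<exists>g. g holomorphic_on (scattering_domain - {0}) \<and> g k \<noteq> 0 \<and>
      (\<forall>z\<in>scattering_domain - {0}. det (mat 1 - graph_scattering z) = g z * (z - k) ^ eigenvalue_mult (k\<^sup>2))"
    unfolding eigenvalue_mult_eq[OF reg]
    by (rule det_zero_order[OF open_scattering_domain k hol kernel_no_jordan_chain[OF reg real]])
qed

lemma secular_function:
  "\<real> - {0} \<subseteq> scattering_domain \<and> (\<forall>B. bounded B \<longrightarrow> finite (B - scattering_domain)) \<and>
    (\<exists>(\<zeta> :: complex \<Rightarrow> complex) (r :: complex \<Rightarrow> complex).
      (\<forall>k\<in>scattering_domain. (r k)\<^sup>2 * det (graph_scattering k) = 1 \<and> \<zeta> k = r k * det (mat 1 - graph_scattering k)) \<and>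
      r analytic_on {k \<in> scattering_domain - {0}. k\<^sup>2 \<in> \<real>} \<and>
      \<zeta> analytic_on {k \<in> scattering_domain - {0}. k\<^sup>2 \<in> \<real>} \<and>
      (\<forall>k\<in>scattering_domain - {0}. \<zeta> k = 0 \<longleftrightarrow> is_eigenvalue (k\<^sup>2)) \<and>
      (\<forall>k\<in>scattering_domain - {0}. \<zeta> k = 0 \<longrightarrow>
         \<zeta> analytic_on {k} \<and> isolated_zero \<zeta> k \<and> zorder \<zeta> k = int (eigenvalue_mult (k\<^sup>2))))"
proof -
  define W where "W = scattering_domain - {0}"
  have sub: "W \<subseteq> regular_points" by (auto simp: W_def scattering_domain_eq)
  have openW: "open W" unfolding W_def by (rule open_scattering_domain)
  have hol: "(\<lambda>z. det (graph_scattering z)) holomorphic_on W"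
    by (intro holomorphic_on_det holomorphic_on_subset[OF graph_scattering_holomorphic sub])
  have hol1: "(\<lambda>z. det (mat 1 - graph_scattering z)) holomorphic_on W"
    unfolding vector_minus_component
    by (intro holomorphic_on_det, unfold vector_minus_component)
      (intro holomorphic_intros holomorphic_on_subset[OF graph_scattering_holomorphic sub])
  have "\<exists>s. (\<forall>z. (s z)\<^sup>2 = det (graph_scattering z)) \<and> s analytic_on {z \<in> W. z\<^sup>2 \<in> \<real>}"
  proof (rule sqrt_analytic_on_axes[OF openW _ _ hol])
    show "0 \<notin> W" "\<real> - {0} \<subseteq> W" using real_in_domain by (auto simp: W_def)
    show "det (graph_scattering z) \<noteq> 0" if "z \<in> W" for z
      using that by (simp add: W_def scattering_domain_eq)
    show "det (graph_scattering z) \<in> \<real>" if "z \<in> W" "Re z = 0" for z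
      using det_graph_scattering_real sub that by blast
  qed
  then obtain s where s: "\<And>z. (s z)\<^sup>2 = det (graph_scattering z)" "s analytic_on {z \<in> W. z\<^sup>2 \<in> \<real>}"
    by blast
  have s0: "s z \<noteq> 0" if "z \<in> scattering_domain" for z
    using s(1)[of z] that by (auto simp: scattering_domain_def)
  \<comment> \<open>On the domain \<open>s\<close> has no zeros, so multiplying by \<open>r\<close>
    changes neither the zeros of \<open>det (1 - S)\<close> nor, where \<open>r\<close> is analytic,
    their orders.\<close>
  define r where "r z = inverse (s z)" for z
  define \<zeta> where "\<zeta> z = r z * det (mat 1 - graph_scattering z)" for z
  have r0: "r z \<noteq> 0" if "z \<in> W" for z
    using s0[of z] that by (simp add: r_def W_def)
  have r_an: "r analytic_on {z \<in> W. z\<^sup>2 \<in> \<real>}"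
    unfolding r_def[abs_def] using s(2) s0 by (intro analytic_on_inverse) (auto simp: W_def)
  have "(\<lambda>z. det (mat 1 - graph_scattering z)) analytic_on {z \<in> W. z\<^sup>2 \<in> \<real>}"
    using hol1 analytic_on_open[OF openW] by (rule_tac analytic_on_subset) auto
  then have \<zeta>_an: "\<zeta> analytic_on {z \<in> W. z\<^sup>2 \<in> \<real>}"
    unfolding \<zeta>_def[abs_def] by (intro analytic_on_mult r_an)
  have \<zeta>_zero: "\<zeta> k = 0 \<longleftrightarrow> det (mat 1 - graph_scattering k) = 0" if "k \<in> W" for k
    using r0[OF that] by (simp add: \<zeta>_def)
  have "\<zeta> analytic_on {k} \<and> isolated_zero \<zeta> k \<and> zorder \<zeta> k = int (eigenvalue_mult (k\<^sup>2))"
    if k: "k \<in> W" and zero: "\<zeta> k = 0" for k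
  proof -
    have det0: "det (mat 1 - graph_scattering k) = 0" using \<zeta>_zero[OF k] zero by blast
    have real: "k\<^sup>2 \<in> \<real>" by (rule det_secular_zero_order(1)[OF k[unfolded W_def] det0])
    obtain g where g: "g holomorphic_on W" "g k \<noteq> 0"
      "\<And>z. z \<in> W \<Longrightarrow> det (mat 1 - graph_scattering z) = g z * (z - k) ^ eigenvalue_mult (k\<^sup>2)"
      using det_secular_zero_order(2)[OF k[unfolded W_def] det0] unfolding W_def[symmetric] by blast
    \<comment> \<open>Zeros have real \<open>k\<^sup>2\<close>, so they lie on the set where
      \<open>r\<close> is known to be analytic.\<close>
    have an: "\<zeta> analytic_on {k}" "r analytic_on {k}"
      using \<zeta>_an r_an k real by (auto elim: analytic_on_subset)
    obtain V where V: "open V" "k \<in> V" "r holomorphic_on V"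
      using an(2) by (auto simp: analytic_at)
    have eq: "\<zeta> z = (r z * g z) * (z - k) ^ eigenvalue_mult (k\<^sup>2)" if "z \<in> W" for z
      using g(3)[OF that] by (simp add: \<zeta>_def)
    have "zorder \<zeta> k = int (eigenvalue_mult (k\<^sup>2))"
    proof (rule zorder_eqI[of "V \<inter> W"])
      show "open (V \<inter> W)" "k \<in> V \<inter> W" using V openW k by auto
      show "(\<lambda>z. r z * g z) holomorphic_on V \<inter> W"
        by (intro holomorphic_intros holomorphic_on_subset[OF V(3)] holomorphic_on_subset[OF g(1)]) auto
      show "r k * g k \<noteq> 0" using r0[OF k] g(2) by simp
      show "\<zeta> z = (r z * g z) * (z - k) powi int (eigenvalue_mult (k\<^sup>2))" if "z \<in> V \<inter> W" for z
        using eq[of z] that by simp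
    qed
    moreover have "isolated_zero \<zeta> k"
      unfolding isolated_zero_def
    proof
      show "\<zeta> \<midarrow>k\<rightarrow> 0" using analytic_at_imp_isCont[OF an(1)] zero by (simp add: isCont_def)
      have "isCont g k"
        using holomorphic_on_imp_continuous_on[OF g(1)] k continuous_on_eq_continuous_at[OF openW] by blast
      then have "\<forall>\<^sub>F z in at k. g z \<noteq> 0"
        using g(2) unfolding isCont_def by (rule tendsto_imp_eventually_ne)
      moreover have "\<forall>\<^sub>F z in at k. z \<in> W - {k}"
        by (rule eventually_at_in_open[OF openW k])
      ultimately show "\<forall>\<^sub>F z in at k. \<zeta> z \<noteq> 0"
      proof eventually_elim
        case (elim z)
        then show ?case using eq[of z] r0[of z] by auto
      qed
    qed
    ultimately show ?thesis using an(1) by blast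
  qed
  note zeros = this
  have in_domain: "\<real> - {0} \<subseteq> scattering_domain" using real_in_domain by blast
  show ?thesis
    unfolding W_def[symmetric]
  proof (rule conjI[OF in_domain], rule conjI, intro allI impI finite_outside_domain, assumption,
      rule exI[of _ \<zeta>], rule exI[of _ r], intro conjI ballI impI)
    show "(r k)\<^sup>2 * det (graph_scattering k) = 1" if "k \<in> scattering_domain" for k
      using s0[OF that] by (simp add: s(1)[symmetric] r_def power_inverse)
    show "\<zeta> k = r k * det (mat 1 - graph_scattering k)" for k
      by (rule \<zeta>_def)
    show "\<zeta> k = 0 \<longleftrightarrow> is_eigenvalue (k\<^sup>2)" if "k \<in> W" for k
      using \<zeta>_zero[OF that] is_eigenvalue_iff[of k] sub that by blast
  qed (use r_an \<zeta>_an zeros in \<open>simp_all only:\<close>)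
qed

end

theorem theorem1p1:
  fixes G :: "('v, 'd::finite) pre_digraph" and arev :: "'d \<Rightarrow> 'd"
    and L :: "'d \<Rightarrow> real" and w :: "'d \<Rightarrow> real \<Rightarrow> real"
  assumes "schroedinger_graph G arev L w"
  shows "let
      S = schroedinger_graph.graph_scattering G arev L w;
      \<Omega> = schroedinger_graph.scattering_domain G arev L w
    in \<real> - {0} \<subseteq> \<Omega> \<and> (\<forall>B. bounded B \<longrightarrow> finite (B - \<Omega>)) \<and>
    (\<exists>(\<zeta> :: complex \<Rightarrow> complex) (r :: complex \<Rightarrow> complex).
      (\<forall>k\<in>\<Omega>. (r k)\<^sup>2 * det (S k) = 1 \<and> \<zeta> k = r k * det (mat 1 - S k)) \<and>
      r analytic_on {k \<in> \<Omega> - {0}. k\<^sup>2 \<in> \<real>} \<and>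
      \<zeta> analytic_on {k \<in> \<Omega> - {0}. k\<^sup>2 \<in> \<real>} \<and>
      (\<forall>k\<in>\<Omega> - {0}. \<zeta> k = 0 \<longleftrightarrow> schroedinger_graph.is_eigenvalue G arev L w (k\<^sup>2)) \<and>
      (\<forall>k\<in>\<Omega> - {0}. \<zeta> k = 0 \<longrightarrow>
         \<zeta> analytic_on {k} \<and> isolated_zero \<zeta> k \<and>
         zorder \<zeta> k = int (schroedinger_graph.eigenvalue_mult G arev L w (k\<^sup>2))))"
  unfolding Let_def by (rule schroedinger_graph.secular_function[OF assms])

end
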